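(* Let $H$ be a Hilbert space, let $(T_t)_{t\ge0}$ be a bounded $C_0$-semigroup on $H$ with infinitesimal generator $-A$, and let $C=\sup_{t\ge0}\|T_t\|$. Then there exists a unique bounded algebra homomorphism $\rho_{0,A}\colon\mathcal{A}_0(\mathbb{C}_+)\to B(H)$ such that $$\rho_{0,A}(L_b)=\int_0^\infty b(t)T_t\,dt\qquad\text{for all } b\in L^1(0,\infty).$$ Moreover $\|\rho_{0,A}\|\le C^2$.
   Context: $\mathbb{C}_+=\{z:\mathrm{Re}\,z>0\}$. $H^1(\mathbb{R})=\{h\in L^1(\mathbb{R}):\widehat h(u)=0\ \forall u\le0\}$, $\widehat h(u)=\int h(t)e^{-itu}dt$. $\mathcal{A}_0(\mathbb{R})$ is the set of $F\colon\mathbb{R}\to\mathbb{C}$ with $F=\sum_kf_k\star h_k$ pointwise for some $(f_k)\subset C_0(\mathbb{R})$, $(h_k)\subset H^1(\mathbb{R})$, $\sum_k\|f_k\|_\infty\|h_k\|_1<\infty$, with norm $\|F\|_{\mathcal{A}_0}=\inf\sum_k\|f_k\|_\infty\|h_k\|_1$; such $F$ lie in $H^\infty(\mathbb{R})$ (bounded functions with analytic Poisson extension $\mathcal{P}[F]$ to the upper half-plane). For such $F$ set $\widetilde F(z)=\mathcal{P}[F](iz)$, $z\in\mathbb{C}_+$, and $\mathcal{A}_0(\mathbb{C}_+)=\{\widetilde F:F\in\mathcal{A}_0(\mathbb{R})\}$ with $\|\widetilde F\|_{\mathcal{A}_0}=\|F\|_{\mathcal{A}_0}$; it is a Banach algebra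 under pointwise multiplication. For $b\in L^1(0,\infty)$, $L_b(z)=\int_0^\infty e^{-tz}b(t)dt$ ($z\in\mathbb{C}_+$) is the Laplace transform; $L_b=\widetilde F$ with $F(u)=\widehat b(-u)$, and $L_b\in\mathcal{A}_0(\mathbb{C}_+)$. The integral $\int_0^\infty b(t)T_tdt$ is in the strong sense. *)

theory Defs
  imports "HOL-Analysis.Analysis"
begin

text \<open>A complex Hilbert space is a real Hilbert space (type class real_inner + complete_space)
  together with an orthogonal operator J with J o J = -id (multiplication by i).
  The complex inner product is recovered as inner x y + i * inner x (J y).\<close>

definition cplx_struct :: "('h::{real_inner,complete_space} \<Rightarrow> 'h) \<Rightarrow> bool" where
  "cplx_struct J \<longleftrightarrow> bounded_linear J \<and> (\<forall>x. J (J x) = - x) \<and>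
     (\<forall>x y. inner (J x) (J y) = inner x y)"

definition cscale :: "('h::real_normed_vector \<Rightarrow> 'h) \<Rightarrow> complex \<Rightarrow> 'h \<Rightarrow> 'h" where
  "cscale J c x = Re c *\<^sub>R x + Im c *\<^sub>R J x"

text \<open>B(H): bounded complex-linear operators = bounded real-linear operators commuting with J\<close>
definition BH :: "('h::real_normed_vector \<Rightarrow> 'h) \<Rightarrow> ('h \<Rightarrow>\<^sub>L 'h) set" where
  "BH J = {X. \<forall>x. blinfun_apply X (J x) = J (blinfun_apply X x)}"

definition bounded_C0_semigroup :: "('h::real_normed_vector \<Rightarrow> 'h) \<Rightarrow> (real \<Rightarrow> 'h \<Rightarrow>\<^sub>L 'h) \<Rightarrow> bool" where
  "bounded_C0_semigroup J T \<longleftrightarrow>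
     (\<forall>t\<ge>0. T t \<in> BH J) \<and>
     T 0 = id_blinfun \<and>
     (\<forall>s\<ge>0. \<forall>t\<ge>0. T (s + t) = T s o\<^sub>L T t) \<and>
     (\<forall>x. continuous_on {0..} (\<lambda>t. blinfun_apply (T t) x)) \<and>
     (\<exists>M. \<forall>t\<ge>0. norm (T t) \<le> M)"

definition C0fun :: "(real \<Rightarrow> complex) \<Rightarrow> bool" where
  "C0fun f \<longleftrightarrow> continuous_on UNIV f \<and> (f \<longlongrightarrow> 0) at_infinity"

definition supnorm :: "(real \<Rightarrow> complex) \<Rightarrow> real" where
  "supnorm f = (SUP t. norm (f t))"

definition fourier :: "(real \<Rightarrow> complex) \<Rightarrow> real \<Rightarrow> complex" where
  "fourier h u = integral UNIV (\<lambda>t. h t * exp (- (\<i> * complex_of_real (t * u))))"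

definition H1fun :: "(real \<Rightarrow> complex) \<Rightarrow> bool" where
  "H1fun h \<longleftrightarrow> h absolutely_integrable_on UNIV \<and> (\<forall>u\<le>0. fourier h u = 0)"

definition L1norm :: "(real \<Rightarrow> complex) \<Rightarrow> real" where
  "L1norm h = integral UNIV (\<lambda>t. norm (h t))"

definition conv :: "(real \<Rightarrow> complex) \<Rightarrow> (real \<Rightarrow> complex) \<Rightarrow> real \<Rightarrow> complex" where
  "conv f h t = integral UNIV (\<lambda>s. f (t - s) * h s)"

definition A0R_rep :: "(real \<Rightarrow> complex) \<Rightarrow> (nat \<Rightarrow> real \<Rightarrow> complex) \<Rightarrow> (nat \<Rightarrow> real \<Rightarrow> complex) \<Rightarrow> bool" where
  "A0R_rep F fs hs \<longleftrightarrow> (\<forall>k. C0fun (fs k) \<and> H1fun (hs k)) \<and>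
     summable (\<lambda>k. supnorm (fs k) * L1norm (hs k)) \<and>
     (\<forall>t. (\<lambda>k. conv (fs k) (hs k) t) sums F t)"

definition A0R :: "(real \<Rightarrow> complex) set" where
  "A0R = {F. \<exists>fs hs. A0R_rep F fs hs}"

definition A0R_norm :: "(real \<Rightarrow> complex) \<Rightarrow> real" where
  "A0R_norm F = Inf {(\<Sum>k. supnorm (fs k) * L1norm (hs k)) | fs hs. A0R_rep F fs hs}"

definition poisson :: "(real \<Rightarrow> complex) \<Rightarrow> complex \<Rightarrow> complex" where
  "poisson F w = integral UNIV
     (\<lambda>t. complex_of_real (Im w / (pi * ((Re w - t)\<^sup>2 + (Im w)\<^sup>2))) * F t)"

definition tildeF :: "(real \<Rightarrow> complex) \<Rightarrow> complex \<Rightarrow> complex" where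
  "tildeF F z = (if 0 < Re z then poisson F (\<i> * z) else 0)"

definition A0C :: "(complex \<Rightarrow> complex) set" where
  "A0C = tildeF ` A0R"

definition A0C_norm :: "(complex \<Rightarrow> complex) \<Rightarrow> real" where
  "A0C_norm \<phi> = Inf {A0R_norm F | F. F \<in> A0R \<and> tildeF F = \<phi>}"

definition laplace :: "(real \<Rightarrow> complex) \<Rightarrow> complex \<Rightarrow> complex" where
  "laplace b z = (if 0 < Re z then integral {0..} (\<lambda>t. exp (- (complex_of_real t * z)) * b t) else 0)"

definition A0C_bounded_hom :: "('h::real_normed_vector \<Rightarrow> 'h) \<Rightarrow> ((complex \<Rightarrow> complex) \<Rightarrow> ('h \<Rightarrow>\<^sub>L 'h)) \<Rightarrow> bool" where
  "A0C_bounded_hom J \<rho> \<longleftrightarrow>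
     (\<forall>\<phi>\<in>A0C. \<rho> \<phi> \<in> BH J) \<and>
     (\<forall>\<phi>\<in>A0C. \<forall>\<psi>\<in>A0C. \<rho> (\<lambda>z. \<phi> z + \<psi> z) = \<rho> \<phi> + \<rho> \<psi>) \<and>
     (\<forall>\<phi>\<in>A0C. \<forall>c x. blinfun_apply (\<rho> (\<lambda>z. c * \<phi> z)) x = cscale J c (blinfun_apply (\<rho> \<phi>) x)) \<and>
     (\<forall>\<phi>\<in>A0C. \<forall>\<psi>\<in>A0C. \<rho> (\<lambda>z. \<phi> z * \<psi> z) = \<rho> \<phi> o\<^sub>L \<rho> \<psi>) \<and>
     (\<exists>K. \<forall>\<phi>\<in>A0C. norm (\<rho> \<phi>) \<le> K * A0C_norm \<phi>)"

end

theory Submission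
  imports Defs "HOL-Probability.Probability"
begin

text \<open>For \<open>f \<in> C\<^sub>0\<close> with integrable Fourier transform and \<open>h \<in> H\<^sup>1\<close>, the function \<open>f \<star> h\<close> is the
  transform of a function \<open>b\<close> on the half-line, a multiple of the product of the Fourier transforms of
  \<open>f\<close> and \<open>h\<close>, and everything rests on the estimate \<open>\<parallel>\<integral> b(t) T\<^sub>t dt\<parallel> \<le> C\<^sup>2 \<parallel>f\<parallel>\<^sub>\<infinity> \<parallel>h\<parallel>\<^sub>1\<close>. Sampling \<open>t\<close> at
  multiples of a small step and smoothing with a Fejer kernel reduces it to analytic trigonometric
  polynomials \<open>p\<close>; if \<open>p\<close> is factored as \<open>w v\<close> with \<open>\<bar>w\<bar>\<^sup>2 = \<bar>v\<bar>\<^sup>2 = \<bar>p\<bar>\<close> on the circle, the semigroup law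
  turns the sum into a Hankel form in the vectors \<open>v\<^sub>k T\<^sub>k x\<close> and \<open>w\<^sub>m T\<^sub>m\<^sup>* y\<close>, and Parseval together with
  Cauchy--Schwarz gives the bound. Approximate factorizations suffice, and these come from
  exponentials of polynomials.

  The homomorphism is obtained by closing the Hille--Phillips calculus \<open>L\<^sub>b \<mapsto> \<integral> b(t) T\<^sub>t dt\<close> in the
  supremum norm of the symbol together with the operator norm, uniformly over the damped semigroups
  \<open>e\<^sup>-\<^sup>\<delta>\<^sup>t T\<^sub>t\<close>, \<open>\<delta> \<ge> 0\<close>. Fourier inversion shows that this closure is single-valued.\<close>

section \<open>Operators on Hilbert spaces\<close>

lemma dist_almost_closest_points_le:
  fixes S :: "'h::real_inner set"
  assumes "convex S" "x \<in> S" "y \<in> S" and m: "\<And>z. z \<in> S \<Longrightarrow> m \<le> (dist a z)\<^sup>2"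
    and "(dist a x)\<^sup>2 \<le> m + e" "(dist a y)\<^sup>2 \<le> m + e"
  shows "(dist x y)\<^sup>2 \<le> 4 * e"
proof -
  have "(1/2) *\<^sub>R x + (1/2) *\<^sub>R y \<in> S"
    using assms by (intro convexD) auto
  from m[OF this] have "4 * m \<le> 4 * (dist a ((1/2) *\<^sub>R x + (1/2) *\<^sub>R y))\<^sup>2" by simp
  also have "\<dots> = 2 * (dist a x)\<^sup>2 + 2 * (dist a y)\<^sup>2 - (dist x y)\<^sup>2"
    by (simp add: dist_norm power2_norm_eq_inner inner_diff inner_add inner_commute)
  finally show ?thesis using assms by simp
qed

lemma closest_point_of_closed_convex_exists:
  fixes S :: "'h::{real_inner,complete_space} set"
  assumes "convex S" "closed S" "S \<noteq> {}"
  shows "\<exists>y\<in>S. \<forall>x\<in>S. dist a y \<le> dist a x"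
proof -
  define m where "m = (INF x\<in>S. (dist a x)\<^sup>2)"
  have bdd: "bdd_below ((\<lambda>x. (dist a x)\<^sup>2) ` S)" by (rule bdd_belowI2[of _ 0]) simp
  have m_le: "m \<le> (dist a x)\<^sup>2" if "x \<in> S" for x
    unfolding m_def using bdd that by (rule cINF_lower)
  define near where "near n = {x \<in> S. (dist a x)\<^sup>2 \<le> m + 1 / real (Suc n)}" for n
  have near_dist: "(dist x y)\<^sup>2 \<le> 4 * (1 / real (Suc n))" if "x \<in> near n" "y \<in> near n" for x y n
    using that by (intro dist_almost_closest_points_le[OF assms(1) _ _ m_le]) (auto simp: near_def)
  have "\<exists>y. \<forall>n. y \<in> near n"
  proof (rule decreasing_closed_nest)
    show "closed (near n)" for n
      unfolding near_def using assms(2) by (intro closed_Collect_conj closed_Collect_le continuous_intros) simp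
    show "near n \<noteq> {}" for n
      using cINF_less_iff[OF assms(3) bdd, of "m + 1 / real (Suc n)"]
      by (force simp: near_def simp flip: m_def)
    show "near n \<subseteq> near m" if "m \<le> n" for m n
    proof -
      have "1 / real (Suc n) \<le> 1 / real (Suc m)" using that by (simp add: frac_le)
      then show ?thesis unfolding near_def by force
    qed
    show "\<exists>n. \<forall>x\<in>near n. \<forall>y\<in>near n. dist x y < e" if "e > 0" for e
    proof -
      have "e\<^sup>2 / 4 > 0" using that by simp
      then obtain n where "inverse (real (Suc n)) < e\<^sup>2 / 4"
        using reals_Archimedean by blast
      then have "4 * (1 / real (Suc n)) < e\<^sup>2" by (simp add: inverse_eq_divide)
      then show ?thesis
        using near_dist[of _ n] that by (meson le_less_trans less_imp_le power2_less_imp_less)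
    qed
  qed blast
  then obtain y where y: "\<And>n. y \<in> near n" by blast
  have "(\<lambda>n. m + 1 / real (Suc n)) \<longlonglongrightarrow> m + 0"
    by (intro tendsto_intros LIMSEQ_Suc[OF lim_const_over_n])
  then have "(dist a y)\<^sup>2 \<le> m"
    using y by (intro LIMSEQ_le_const[of _ m]) (auto simp: near_def)
  then have "dist a y \<le> dist a x" if "x \<in> S" for x
    using order_trans[OF _ m_le[OF that]] by (auto intro: power2_le_imp_le)
  moreover have "y \<in> S" using y[of 0] by (simp add: near_def)
  ultimately show ?thesis by blast
qed

theorem riesz_representation:
  fixes l :: "'h::{real_inner,complete_space} \<Rightarrow> real"
  assumes "bounded_linear l"
  shows "\<exists>y. \<forall>x. l x = inner x y"
proof (cases "l = (\<lambda>_. 0)")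
  case False
  interpret l: bounded_linear l by fact
  define S where "S = {x. l x = 1}"
  obtain v where "l v \<noteq> 0" using False by auto
  then have "v /\<^sub>R l v \<in> S" by (simp add: S_def l.scaleR)
  moreover have S: "convex S" "closed S"
    unfolding S_def
    by (auto simp: convex_def l.add l.scaleR intro!: closed_Collect_eq l.continuous_on continuous_intros)
  ultimately obtain y where y: "y \<in> S" "\<And>x. x \<in> S \<Longrightarrow> dist 0 y \<le> dist 0 x"
    using closest_point_of_closed_convex_exists[of S 0] by blast
  have le: "0 \<le> inner y z" if "l z = 0" for z
    using any_closest_point_dot[OF S y(1), of "y + z" 0] y that by (simp add: S_def l.add)
  have orth: "inner y z = 0" if "l z = 0" for z
    using le[OF that] le[of "-z"] that by (simp add: l.neg)
  have "l x * (inner y y) = inner x y" for x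
    using orth[of "x - l x *\<^sub>R y"] y(1) by (simp add: S_def l.diff l.scaleR inner_diff_right inner_commute)
  moreover have "inner y y \<noteq> 0" using y(1) by (auto simp: S_def l.zero)
  ultimately have "l x = inner x (y /\<^sub>R inner y y)" for x
    by (simp add: field_simps)
  then show ?thesis by blast
qed (auto intro: exI[of _ 0])

lemma norm_blinfun_le_of_inner:
  fixes S :: "'a::real_normed_vector \<Rightarrow>\<^sub>L 'b::real_inner"
  assumes "K \<ge> 0" and "\<And>x y. \<bar>inner (blinfun_apply S x) y\<bar> \<le> K * norm x * norm y"
  shows "norm S \<le> K"
proof (rule norm_blinfun_bound[OF assms(1)])
  fix x
  show "norm (blinfun_apply S x) \<le> K * norm x"
  proof (cases "blinfun_apply S x = 0")
    case False
    have "norm (S x) * norm (S x) \<le> (K * norm x) * norm (S x)"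
      using assms(2)[of x "S x"] by (simp add: dot_square_norm power2_eq_square)
    then show ?thesis using False by simp
  qed (use assms(1) in simp)
qed

lemma inner_blinfun_le:
  fixes S :: "'a::real_normed_vector \<Rightarrow>\<^sub>L 'b::real_inner"
  shows "\<bar>inner (blinfun_apply S x) y\<bar> \<le> norm S * norm x * norm y"
  using Cauchy_Schwarz_ineq2[of "S x" y] norm_blinfun[of S x]
  by (meson mult_right_mono norm_ge_zero order_trans)

lemma norm_blinfun_le_of_quadratic:
  fixes S :: "'a::real_normed_vector \<Rightarrow>\<^sub>L 'b::real_inner"
  assumes K: "K \<ge> 0" and le: "\<And>x y. inner (blinfun_apply S x) y \<le> K * ((norm x)\<^sup>2 + (norm y)\<^sup>2) / 2"
  shows "norm S \<le> K"
proof (rule norm_blinfun_le_of_inner[OF K])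
  have upper: "inner (S x) y \<le> K * norm x * norm y" for x y
  proof (cases "x = 0 \<or> y = 0")
    case False
    then have pos: "norm x > 0" "norm y > 0" by auto
    have "inner (S x) y / (norm x * norm y) = inner (S ((1 / norm x) *\<^sub>R x)) ((1 / norm y) *\<^sub>R y)"
      by (simp add: blinfun.scaleR_right divide_inverse mult_ac)
    also have "\<dots> \<le> K * ((norm ((1 / norm x) *\<^sub>R x))\<^sup>2 + (norm ((1 / norm y) *\<^sub>R y))\<^sup>2) / 2"
      by (rule le)
    also have "\<dots> = K" using pos by simp
    finally show ?thesis using pos by (simp add: divide_le_eq mult_ac)
  qed auto
  show "\<bar>inner (S x) y\<bar> \<le> K * norm x * norm y" for x y
    using upper[of x y] upper[of "-x" y] by (simp add: blinfun.minus_right abs_le_iff)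
qed

lemma bounded_bilinear_form_representation:
  fixes B :: "'a::real_normed_vector \<Rightarrow> 'h::{real_inner,complete_space} \<Rightarrow> real"
  assumes "bounded_bilinear B"
  shows "\<exists>S :: 'a \<Rightarrow>\<^sub>L 'h. \<forall>x y. inner (blinfun_apply S x) y = B x y"
proof -
  interpret B: bounded_bilinear B by fact
  have "\<exists>s. \<forall>x y. B x y = inner y (s x)"
    using riesz_representation[OF B.bounded_linear_right] by metis
  then obtain s where s: "\<And>x y. B x y = inner y (s x)" by blast
  obtain K where K: "K \<ge> 0" "\<And>x y. norm (B x y) \<le> norm x * norm y * K"
    using B.nonneg_bounded by blast
  have "bounded_linear s"
  proof (rule bounded_linear_intro)
    show "s (x + x') = s x + s x'" for x x'
      by (rule vector_eq_ldot[THEN iffD1], rule allI) (simp add: inner_add_right B.add_left flip: s)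
    show "s (r *\<^sub>R x) = r *\<^sub>R s x" for r x
      by (rule vector_eq_ldot[THEN iffD1], rule allI) (simp add: B.scaleR_left flip: s)
    show "norm (s x) \<le> norm x * K" for x
    proof (cases "s x = 0")
      case False
      have "norm (s x) * norm (s x) \<le> norm x * K * norm (s x)"
        using K(2)[of x "s x"] by (simp add: s dot_square_norm power2_eq_square mult_ac)
      then show ?thesis using False by simp
    qed (use K in simp)
  qed
  then show ?thesis
    by (intro exI[of _ "Blinfun s"]) (simp add: bounded_linear_Blinfun_apply s inner_commute)
qed

lemma blinfun_adjoint_exists:
  fixes S :: "'h::{real_inner,complete_space} \<Rightarrow>\<^sub>L 'a::real_inner"
  shows "\<exists>S' :: 'a \<Rightarrow>\<^sub>L 'h. (\<forall>x y. inner (blinfun_apply S x) y = inner x (blinfun_apply S' y))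
      \<and> norm S' \<le> norm S"
proof -
  have "bounded_bilinear (\<lambda>y x. inner (S x) y)"
    by (rule bounded_bilinear.flip[OF bounded_bilinear.comp1[OF bounded_bilinear_inner blinfun.bounded_linear_right]])
  from bounded_bilinear_form_representation[OF this]
  obtain S' :: "'a \<Rightarrow>\<^sub>L 'h" where S': "\<And>x y. inner (S' y) x = inner (S x) y" by blast
  have "norm S' \<le> norm S"
    by (rule norm_blinfun_le_of_inner) (use inner_blinfun_le[of S] in \<open>auto simp: S' mult_ac\<close>)
  moreover have "inner (S x) y = inner x (S' y)" for x y
    by (simp add: S' inner_commute[of x])
  ultimately show ?thesis by blast
qed

text \<open>The sort \<open>{real_normed_vector,complete_space}\<close> is not contained in \<open>banach\<close>, so completeness of
  the operator space is not available as a type class instance.\<close>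

lemma blinfun_limit_exists:
  fixes S :: "nat \<Rightarrow> 'a::real_normed_vector \<Rightarrow>\<^sub>L 'b::{real_normed_vector,complete_space}"
  assumes e: "e \<longlonglongrightarrow> 0" and S: "\<And>i j. i \<le> j \<Longrightarrow> norm (S i - S j) \<le> e i"
  shows "\<exists>L. \<forall>i. norm (S i - L) \<le> e i"
proof -
  have diff_le: "norm (S i x - S j x) \<le> e i * norm x" if "i \<le> j" for i j x
    using norm_blinfun[of "S i - S j" x] mult_right_mono[OF S[OF that] norm_ge_zero[of x]]
    by (simp add: blinfun.diff_left)
  have "Cauchy (\<lambda>i. S i x)" for x
  proof (rule CauchyI')
    fix r :: real assume "r > 0"
    moreover have "(\<lambda>i. e i * norm x) \<longlonglongrightarrow> 0" using tendsto_mult_right[OF e, of "norm x"] by simp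
    ultimately obtain N where "\<And>i. i \<ge> N \<Longrightarrow> e i * norm x < r"
      using order_tendstoD(2)[of _ 0] by (force simp: eventually_sequentially)
    then have "dist (S i x) (S j x) < r" if "i \<ge> N" "j > i" for i j
      using diff_le[of i j x] that by (force simp: dist_norm)
    then show "\<exists>N. \<forall>i\<ge>N. \<forall>j>i. dist (S i x) (S j x) < r" by blast
  qed
  then obtain s where s: "\<And>x. (\<lambda>i. S i x) \<longlonglongrightarrow> s x"
    unfolding Cauchy_convergent_iff convergent_def by metis
  have s_le: "norm (S i x - s x) \<le> e i * norm x" for i x
  proof (rule tendsto_upperbound)
    show "(\<lambda>j. norm (S i x - S j x)) \<longlonglongrightarrow> norm (S i x - s x)" by (intro tendsto_intros s)
    show "\<forall>\<^sub>F j in sequentially. norm (S i x - S j x) \<le> e i * norm x"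
      using eventually_ge_at_top[of i] by eventually_elim (rule diff_le)
  qed simp
  have "bounded_linear s"
  proof (rule bounded_linear_intro)
    show "s (x + y) = s x + s y" for x y
      using tendsto_add[OF s[of x] s[of y]] by (intro LIMSEQ_unique[OF s]) (simp add: blinfun.add_right)
    show "s (r *\<^sub>R x) = r *\<^sub>R s x" for r x
      using tendsto_scaleR[OF tendsto_const s[of x]] by (intro LIMSEQ_unique[OF s])
          (simp add: blinfun.scaleR_right)
    show "norm (s x) \<le> norm x * (norm (S 0) + e 0)" for x
      using norm_triangle_sub[of "s x" "S 0 x"] s_le[of 0 x] norm_blinfun[of "S 0" x]
      by (simp add: algebra_simps norm_minus_commute)
  qed
  then have "norm (S i - Blinfun s) \<le> e i" for i
    using S[of i i] s_le[of i]
    by (intro norm_blinfun_bound) (auto simp: blinfun.diff_left bounded_linear_Blinfun_apply)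
  then show ?thesis by blast
qed

lemma complex_eqI_Re_mult: "(\<And>a. Re (a * u) = Re (a * v)) \<Longrightarrow> u = v"
proof -
  assume eq: "\<And>a. Re (a * u) = Re (a * v)"
  from eq[of 1] eq[of \<i>] show "u = v" by (simp add: complex_eq_iff)
qed

definition cinner :: "('h::real_inner \<Rightarrow> 'h) \<Rightarrow> 'h \<Rightarrow> 'h \<Rightarrow> complex" where
  "cinner J x y = Complex (inner x y) (- inner (J x) y)"

locale cplx_hilbert =
  fixes J :: "'h::{real_inner,complete_space} \<Rightarrow> 'h"
  assumes cplx_struct: "cplx_struct J"
begin

sublocale J: bounded_linear J
  using cplx_struct by (simp add: cplx_struct_def)

lemma J_J [simp]: "J (J x) = - x"
  and inner_J_J [simp]: "inner (J x) (J y) = inner x y"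
  using cplx_struct by (simp_all add: cplx_struct_def)

lemma inner_J_swap: "inner (J x) y = - inner x (J y)"
  by (metis J_J inner_J_J inner_minus_left)

lemma inner_J_self [simp]: "inner (J x) x = 0" "inner x (J x) = 0"
  using inner_J_swap[of x x] by (auto simp: inner_commute)

lemma cscale_cscale: "cscale J a (cscale J b x) = cscale J (a * b) x"
  by (simp add: cscale_def J.add J.scaleR scaleR_add_right scaleR_add_left algebra_simps)

lemma norm_cscale: "norm (cscale J a x) = norm a * norm x"
proof -
  have "(norm (cscale J a x))\<^sup>2 = (norm a * norm x)\<^sup>2"
    unfolding power_mult_distrib cmod_power2
    by (simp add: cscale_def power2_norm_eq_inner inner_add inner_commute)
       (simp add: power2_eq_square algebra_simps)
  then show ?thesis by (simp add: power2_eq_iff_nonneg)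
qed

lemma bounded_linear_cscale: "bounded_linear (cscale J a)"
proof (rule bounded_linear_intro)
  show "norm (cscale J a x) \<le> norm x * norm a" for x by (simp add: norm_cscale)
qed (simp_all add: cscale_def J.add J.scaleR scaleR_add_right mult.commute)

definition cscale_blinfun :: "complex \<Rightarrow> 'h \<Rightarrow>\<^sub>L 'h" where
  "cscale_blinfun a = Blinfun (cscale J a)"

lemma cscale_blinfun_apply [simp]: "blinfun_apply (cscale_blinfun a) = cscale J a"
  by (simp add: cscale_blinfun_def bounded_linear_Blinfun_apply bounded_linear_cscale)

lemma continuous_on_cscale [continuous_intros]:
  "continuous_on S a \<Longrightarrow> continuous_on S f \<Longrightarrow> continuous_on S (\<lambda>t. cscale J (a t) (f t))"
  unfolding cscale_def by (intro continuous_intros J.continuous_on)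

lemma Re_mult_cinner: "Re (a * cinner J x y) = inner (cscale J a x) y"
  by (simp add: cinner_def cscale_def inner_add_left)

lemma cinner_cscale: "cinner J (cscale J a x) y = a * cinner J x y"
  by (rule complex_eqI_Re_mult) (simp only: Re_mult_cinner cscale_cscale flip: mult.assoc)

lemma cinner_cscale_right: "cinner J x (cscale J a y) = cnj a * cinner J x y"
  by (simp add: cinner_def cscale_def complex_eq_iff inner_add_right inner_J_swap[of x y] algebra_simps)

lemma norm_cinner_le: "norm (cinner J x y) \<le> norm x * norm y"
proof (cases "cinner J x y = 0")
  case False
  define a where "a = cnj (cinner J x y)"
  have "norm (cinner J x y) * norm (cinner J x y) = Re (a * cinner J x y)"
    unfolding a_def by (metis cmod_power2 complex_norm_square mult.commute power2_eq_square
        Re_complex_of_real of_real_mult)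
  also have "\<dots> \<le> norm (cscale J a x) * norm y"
    unfolding Re_mult_cinner by (rule norm_cauchy_schwarz)
  also have "\<dots> = norm (cinner J x y) * (norm x * norm y)"
    by (simp add: norm_cscale a_def)
  finally show ?thesis using False by simp
qed simp

sublocale cinner: bounded_bilinear "cinner J"
proof
  show "cinner J (x + x') y = cinner J x y + cinner J x' y"
    "cinner J x (y + y') = cinner J x y + cinner J x y'"
    "cinner J (r *\<^sub>R x) y = r *\<^sub>R cinner J x y"
    "cinner J x (r *\<^sub>R y) = r *\<^sub>R cinner J x y" for x x' y y' r
    by (simp_all add: cinner_def complex_eq_iff J.add J.scaleR inner_add)
  show "\<exists>K. \<forall>x y. norm (cinner J x y) \<le> norm x * norm y * K"
    using norm_cinner_le by (intro exI[of _ 1]) simp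
qed

lemma continuous_on_cinner [continuous_intros]:
  "continuous_on S f \<Longrightarrow> continuous_on S g \<Longrightarrow> continuous_on S (\<lambda>t. cinner J (f t) (g t))"
  by (rule cinner.continuous_on)

lemma cinner_eqI:
  assumes "\<And>y. cinner J x y = cinner J x' y"
  shows "x = x'"
  by (rule vector_eq_rdot[THEN iffD1], rule allI) (use assms in \<open>simp add: cinner_def\<close>)

lemma norm_le_of_cinner:
  assumes "K \<ge> 0" "\<And>y. norm (cinner J x y) \<le> K * norm y"
  shows "norm x \<le> K"
proof (cases "x = 0")
  case False
  have "(norm x)\<^sup>2 \<le> norm (cinner J x x)"
    using complex_Re_le_cmod[of "cinner J x x"] by (simp add: cinner_def power2_norm_eq_inner)
  then have "norm x * norm x \<le> K * norm x" using assms(2)[of x] by (simp add: power2_eq_square)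
  then show ?thesis using False by simp
qed (use assms(1) in simp)

lemma norm_blinfun_le_of_cinner:
  assumes "K \<ge> 0" "\<And>x y. norm (cinner J (blinfun_apply S x) y) \<le> K * norm x * norm y"
  shows "norm S \<le> K"
  by (intro norm_blinfun_bound norm_le_of_cinner mult_nonneg_nonneg assms norm_ge_zero)

lemma BH_adjoint_exists:
  assumes "S \<in> BH J"
  shows "\<exists>S'. (\<forall>x y. cinner J (blinfun_apply S x) y = cinner J x (blinfun_apply S' y)) \<and> norm S' \<le> norm S"
proof -
  obtain S' where S': "\<And>x y. inner (S x) y = inner x (blinfun_apply S' y)" "norm S' \<le> norm S"
    using blinfun_adjoint_exists[of S] by blast
  moreover have "inner (J (S x)) y = inner (J x) (S' y)" for x y
    using assms S'(1)[of "J x" y] by (simp add: BH_def)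
  ultimately show ?thesis by (intro exI[of _ S']) (simp add: cinner_def)
qed

lemma sesquilinear_form_representation:
  fixes B :: "'h \<Rightarrow> 'h \<Rightarrow> complex"
  assumes B: "bounded_bilinear B"
    and J_left: "\<And>x y. B (J x) y = \<i> * B x y" and J_right: "\<And>x y. B x (J y) = - (\<i> * B x y)"
  shows "\<exists>S \<in> BH J. \<forall>x y. cinner J (blinfun_apply S x) y = B x y"
proof -
  interpret B: bounded_bilinear B by fact
  have "bounded_bilinear (\<lambda>x y. Re (B x y))"
  proof
    show "\<exists>K. \<forall>x y. norm (Re (B x y)) \<le> norm x * norm y * K"
      using B.bounded abs_Re_le_cmod by (metis order_trans real_norm_def)
  qed (simp_all add: B.add_left B.add_right B.scaleR_left B.scaleR_right)
  from bounded_bilinear_form_representation[OF this]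
  obtain S :: "'h \<Rightarrow>\<^sub>L 'h" where S: "\<And>x y. inner (S x) y = Re (B x y)" by blast
  have JS: "inner (J (S x)) y = - Im (B x y)" for x y
    by (simp add: inner_J_swap S J_right)
  then have "S (J x) = J (S x)" for x
    by (intro cinner_eqI) (simp add: cinner_def S J_left)
  moreover have "cinner J (S x) y = B x y" for x y
    by (simp add: cinner_def S JS complex_eq_iff)
  ultimately show ?thesis by (auto simp: BH_def)
qed

end

section \<open>Trigonometric polynomials\<close>

definition circle_mean :: "(real \<Rightarrow> 'a::real_normed_vector) \<Rightarrow> 'a" where
  "circle_mean f = integral {-pi..pi} f /\<^sub>R (2 * pi)"

lemma circle_mean_const [simp]: "circle_mean (\<lambda>_. c) = c"
  by (simp add: circle_mean_def)

lemma circle_mean_reflect: "circle_mean (\<lambda>t. f (- t)) = circle_mean f"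
  using Henstock_Kurzweil_Integration.integral_reflect_real[of pi "-pi" f] by (simp add: circle_mean_def)

lemma circle_mean_bounded_linear:
  fixes f :: "real \<Rightarrow> 'a::banach"
  assumes "bounded_linear L" "continuous_on {-pi..pi} f"
  shows "circle_mean (\<lambda>t. L (f t)) = L (circle_mean f)"
  using integral_linear[OF integrable_continuous_real[OF assms(2)] assms(1)]
  by (simp add: circle_mean_def o_def linear_simps(5)[OF assms(1)])

lemma circle_mean_mult_left:
  fixes f :: "real \<Rightarrow> 'a::{real_normed_algebra,banach}"
  shows "continuous_on {-pi..pi} f \<Longrightarrow> circle_mean (\<lambda>t. f t * c) = circle_mean f * c"
  by (rule circle_mean_bounded_linear[OF bounded_linear_mult_left])

lemma circle_mean_add:
  fixes f g :: "real \<Rightarrow> 'a::banach"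
  assumes "continuous_on {-pi..pi} f" "continuous_on {-pi..pi} g"
  shows "circle_mean (\<lambda>t. f t + g t) = circle_mean f + circle_mean g"
  using assms by (simp add: circle_mean_def integrable_continuous_real
      Henstock_Kurzweil_Integration.integral_add scaleR_add_right)

lemma circle_mean_sum:
  fixes f :: "'i \<Rightarrow> real \<Rightarrow> 'a::banach"
  assumes "finite I" "\<And>i. i \<in> I \<Longrightarrow> continuous_on {-pi..pi} (f i)"
  shows "circle_mean (\<lambda>t. \<Sum>i\<in>I. f i t) = (\<Sum>i\<in>I. circle_mean (f i))"
  using assms by (simp add: circle_mean_def integral_sum integrable_continuous_real scaleR_sum_right)

lemma circle_mean_mono:
  fixes f g :: "real \<Rightarrow> real"
  assumes "continuous_on {-pi..pi} f" "continuous_on {-pi..pi} g" "\<And>t. f t \<le> g t"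
  shows "circle_mean f \<le> circle_mean g"
  unfolding circle_mean_def
  by (intro scaleR_left_mono integral_le integrable_continuous_real assms) simp

lemma norm_circle_mean_le:
  fixes f :: "real \<Rightarrow> 'a::banach"
  assumes "continuous_on {-pi..pi} f" "continuous_on {-pi..pi} g" "\<And>t. norm (f t) \<le> g t"
  shows "norm (circle_mean f) \<le> circle_mean g"
proof -
  have "norm (integral {-pi..pi} f) \<le> integral {-pi..pi} g"
    by (intro integral_norm_bound_integral integrable_continuous_real assms)
  then show ?thesis by (simp add: circle_mean_def mult_left_mono)
qed

lemma circle_mean_cis: "circle_mean (\<lambda>t. cis (of_int k * t)) = (if k = 0 then 1 else 0)"
proof (cases "k = 0")
  case False
  have "((\<lambda>t. cis (of_int k * t)) has_integral
      (cis (of_int k * pi) / (\<i> * of_int k) - cis (of_int k * (-pi)) / (\<i> * of_int k))) {-pi..pi}"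
    using False
    by (intro fundamental_theorem_of_calculus)
       (auto intro!: derivative_eq_intros has_vector_derivative_real_field
          simp: has_real_derivative_iff_has_vector_derivative[symmetric] cis_conv_exp
            of_real_def[symmetric] field_simps)
  moreover have "cis (of_int k * pi) = cis (of_int k * (-pi))"
    using sin_zero_iff_int2 by (auto simp: complex_eq_iff)
  ultimately show ?thesis using False by (simp add: circle_mean_def integral_unique)
qed simp

lemma continuous_on_poly_cis [continuous_intros]: "continuous_on S (\<lambda>t. poly p (cis t))"
  by (intro continuous_intros)

context cplx_hilbert
begin

definition trig_sum :: "nat \<Rightarrow> (nat \<Rightarrow> 'h) \<Rightarrow> real \<Rightarrow> 'h" where
  "trig_sum n a t = (\<Sum>k<n. cscale J (cis (- (real k * t))) (a k))"

lemma continuous_on_trig_sum [continuous_intros]: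
  "continuous_on S u \<Longrightarrow> continuous_on S (\<lambda>t. trig_sum n a (u t))"
  unfolding trig_sum_def by (intro continuous_intros)

lemma cinner_trig_sum:
  "cinner J (trig_sum n a s) (trig_sum m b t)
    = (\<Sum>k<n. \<Sum>l<m. cis (real l * t - real k * s) * cinner J (a k) (b l))"
  unfolding trig_sum_def cinner.sum_left
  by (simp add: cinner.sum_right cinner_cscale cinner_cscale_right cis_cnj cis_mult flip: mult.assoc)

theorem parseval: "circle_mean (\<lambda>t. (norm (trig_sum n a t))\<^sup>2) = (\<Sum>k<n. (norm (a k))\<^sup>2)"
proof -
  have "(norm (trig_sum n a t))\<^sup>2 = Re (cinner J (trig_sum n a t) (trig_sum n a t))" for t
    by (simp add: cinner_def power2_norm_eq_inner)
  then have "circle_mean (\<lambda>t. (norm (trig_sum n a t))\<^sup>2)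
      = Re (circle_mean (\<lambda>t. cinner J (trig_sum n a t) (trig_sum n a t)))"
    by (simp only: circle_mean_bounded_linear[OF bounded_linear_Re] continuous_intros)
  also have "\<dots> = Re (circle_mean (\<lambda>t. \<Sum>k<n. \<Sum>l<n. cis (of_int (int l - int k) * t) * cinner J (a k) (a l)))"
    by (simp add: cinner_trig_sum left_diff_distrib)
  also have "\<dots> = Re (\<Sum>k<n. \<Sum>l<n. circle_mean (\<lambda>t. cis (of_int (int l - int k) * t)) * cinner J (a k) (a l))"
    by (simp only: circle_mean_sum circle_mean_mult_left continuous_intros finite_lessThan)
  also have "\<dots> = Re (\<Sum>k<n. \<Sum>l<n. if k = l then cinner J (a k) (a k) else 0)"
    unfolding circle_mean_cis by (intro arg_cong[of _ _ Re] sum.cong refl) auto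
  also have "\<dots> = (\<Sum>k<n. (norm (a k))\<^sup>2)"
    by (simp add: sum.delta cinner_def power2_norm_eq_inner)
  finally show ?thesis .
qed

end

lemma parseval_poly:
  fixes p :: "complex poly"
  shows "circle_mean (\<lambda>t. (norm (poly p (cis t)))\<^sup>2) = (\<Sum>k\<le>degree p. (norm (coeff p k))\<^sup>2)"
proof -
  interpret cplx_hilbert "\<lambda>z :: complex. \<i> * z"
    by unfold_locales
       (auto simp: cplx_struct_def inner_complex_def bounded_linear_mult_right simp flip: mult.assoc)
  have "cscale (\<lambda>z :: complex. \<i> * z) a z = z * a" for a z
    by (simp add: cscale_def complex_eq_iff)
  then have "poly p (cis t) = trig_sum (Suc (degree p)) (coeff p) (- t)" for t
    unfolding trig_sum_def lessThan_Suc_atMost poly_altdef by (simp add: Complex.DeMoivre)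
  then show ?thesis
    using parseval[of "Suc (degree p)" "coeff p"]
    by (simp add: circle_mean_reflect[of "\<lambda>t. (norm (trig_sum (Suc (degree p)) (coeff p) t))\<^sup>2"]
        lessThan_Suc_atMost)
qed

definition poly_l1norm :: "complex poly \<Rightarrow> real" where
  "poly_l1norm p = (\<Sum>k\<le>degree p. norm (coeff p k))"

lemma poly_l1norm_eq_sum:
  assumes "degree p \<le> n"
  shows "poly_l1norm p = (\<Sum>k\<le>n. norm (coeff p k))"
  unfolding poly_l1norm_def
  by (rule sum.mono_neutral_left) (use assms in \<open>auto simp: coeff_eq_0\<close>)

lemma poly_l1norm_nonneg [simp]: "0 \<le> poly_l1norm p"
  by (simp add: poly_l1norm_def sum_nonneg)

lemma poly_l1norm_0 [simp]: "poly_l1norm 0 = 0"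
  by (simp add: poly_l1norm_def)

lemma poly_l1norm_1 [simp]: "poly_l1norm 1 = 1"
  by (simp add: poly_l1norm_def)

lemma poly_l1norm_minus [simp]: "poly_l1norm (- p) = poly_l1norm p"
  by (simp add: poly_l1norm_def)

lemma poly_l1norm_smult: "poly_l1norm (smult c p) = norm c * poly_l1norm p"
  by (subst poly_l1norm_eq_sum[of _ "degree p"])
     (auto simp: poly_l1norm_def norm_mult sum_distrib_left degree_smult_le)

lemma poly_l1norm_pCons: "poly_l1norm (pCons a p) = norm a + poly_l1norm p"
  by (subst poly_l1norm_eq_sum[of _ "Suc (degree p)"])
     (simp_all add: poly_l1norm_def degree_pCons_le sum.atMost_Suc_shift del: sum.atMost_Suc)

lemma poly_l1norm_add_le: "poly_l1norm (p + q) \<le> poly_l1norm p + poly_l1norm q"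
proof -
  define n where "n = max (degree p) (degree q)"
  have "poly_l1norm (p + q) = (\<Sum>k\<le>n. norm (coeff p k + coeff q k))"
    by (subst poly_l1norm_eq_sum[of _ n]) (auto simp: n_def degree_add_le_max)
  also have "\<dots> \<le> (\<Sum>k\<le>n. norm (coeff p k) + norm (coeff q k))"
    by (intro sum_mono norm_triangle_ineq)
  also have "\<dots> = poly_l1norm p + poly_l1norm q"
    by (simp add: sum.distrib poly_l1norm_eq_sum[of p n] poly_l1norm_eq_sum[of q n] n_def)
  finally show ?thesis .
qed

lemma poly_l1norm_mult_le: "poly_l1norm (p * q) \<le> poly_l1norm p * poly_l1norm q"
proof (induction p)
  case (pCons a p)
  have "poly_l1norm (pCons a p * q) \<le> poly_l1norm (smult a q) + poly_l1norm (pCons 0 (p * q))"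
    by (simp add: poly_l1norm_add_le)
  also have "\<dots> \<le> norm a * poly_l1norm q + poly_l1norm p * poly_l1norm q"
    using pCons by (simp add: poly_l1norm_smult poly_l1norm_pCons)
  finally show ?case by (simp add: poly_l1norm_pCons distrib_right)
qed simp

lemma poly_l1norm_power_diff_one_le:
  "poly_l1norm ((1 + h) ^ n - 1) \<le> (1 + poly_l1norm h) ^ n - 1"
proof (induction n)
  case (Suc n)
  have "(1 + h) ^ Suc n - 1 = (1 + h) * ((1 + h) ^ n - 1) + h"
    by (simp add: algebra_simps)
  also have "poly_l1norm \<dots> \<le> poly_l1norm ((1 + h) * ((1 + h) ^ n - 1)) + poly_l1norm h"
    by (rule poly_l1norm_add_le)
  also have "poly_l1norm ((1 + h) * ((1 + h) ^ n - 1)) \<le> poly_l1norm (1 + h) * poly_l1norm ((1 + h) ^ n - 1)"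
    by (rule poly_l1norm_mult_le)
  also have "\<dots> \<le> (1 + poly_l1norm h) * ((1 + poly_l1norm h) ^ n - 1)"
    using poly_l1norm_add_le[of 1 h] Suc by (intro mult_mono) auto
  finally show ?case by (simp add: algebra_simps)
qed simp

lemma norm_poly_le_poly_l1norm:
  assumes "norm z = 1"
  shows "norm (poly p z) \<le> poly_l1norm p"
  unfolding poly_altdef poly_l1norm_def
  by (rule sum_norm_le) (simp add: norm_mult norm_power assms)

definition coeff_pairing :: "(nat \<Rightarrow> complex) \<Rightarrow> complex poly \<Rightarrow> complex" where
  "coeff_pairing \<phi> p = (\<Sum>n\<le>degree p. coeff p n * \<phi> n)"

lemma coeff_pairing_eq_sum:
  assumes "degree p \<le> n"
  shows "coeff_pairing \<phi> p = (\<Sum>k\<le>n. coeff p k * \<phi> k)"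
  unfolding coeff_pairing_def
  by (rule sum.mono_neutral_left) (use assms in \<open>auto simp: coeff_eq_0\<close>)

lemma coeff_pairing_0 [simp]: "coeff_pairing \<phi> 0 = 0"
  by (simp add: coeff_pairing_def)

lemma coeff_pairing_add: "coeff_pairing \<phi> (p + q) = coeff_pairing \<phi> p + coeff_pairing \<phi> q"
proof -
  define n where "n = max (degree p) (degree q)"
  have "degree (p + q) \<le> n" "degree p \<le> n" "degree q \<le> n"
    by (auto simp: n_def degree_add_le_max)
  then show ?thesis by (simp add: coeff_pairing_eq_sum[of _ n] sum.distrib distrib_right)
qed

lemma coeff_pairing_sum: "coeff_pairing \<phi> (\<Sum>i\<in>A. q i) = (\<Sum>i\<in>A. coeff_pairing \<phi> (q i))"
  by (induction A rule: infinite_finite_induct) (simp_all add: coeff_pairing_add)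

lemma coeff_pairing_smult: "coeff_pairing \<phi> (smult c p) = c * coeff_pairing \<phi> p"
  by (subst coeff_pairing_eq_sum[of _ "degree p"])
     (auto simp: coeff_pairing_def sum_distrib_left degree_smult_le mult_ac)

lemma coeff_pairing_pCons:
  "coeff_pairing \<phi> (pCons a p) = a * \<phi> 0 + coeff_pairing (\<lambda>n. \<phi> (Suc n)) p"
  by (subst coeff_pairing_eq_sum[of _ "Suc (degree p)"])
     (simp_all add: coeff_pairing_def degree_pCons_le sum.atMost_Suc_shift del: sum.atMost_Suc)

lemma coeff_pairing_monom: "coeff_pairing \<phi> (monom a n) = a * \<phi> n"
  by (induction n arbitrary: \<phi>) (simp_all add: monom_0 monom_Suc coeff_pairing_pCons)

lemma coeff_pairing_mult:
  "coeff_pairing \<phi> (p * q) = coeff_pairing (\<lambda>m. coeff_pairing (\<lambda>k. \<phi> (m + k)) q) p"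
proof (induction p arbitrary: \<phi>)
  case (pCons a p)
  have "coeff_pairing \<phi> (pCons a p * q) = a * coeff_pairing \<phi> q + coeff_pairing (\<lambda>n. \<phi> (Suc n)) (p * q)"
    by (simp only: mult_pCons_left coeff_pairing_add coeff_pairing_smult coeff_pairing_pCons) simp
  then show ?case
    by (simp only: coeff_pairing_pCons pCons.IH add_0 add_Suc)
qed simp

lemma norm_coeff_pairing_le:
  assumes "\<And>n. norm (\<phi> n) \<le> K"
  shows "norm (coeff_pairing \<phi> p) \<le> K * poly_l1norm p"
proof -
  have "norm (coeff_pairing \<phi> p) \<le> (\<Sum>k\<le>degree p. norm (coeff p k) * K)"
    unfolding coeff_pairing_def
    by (rule sum_norm_le) (auto simp: norm_mult intro!: mult_left_mono assms)
  then show ?thesis by (simp add: poly_l1norm_def sum_distrib_left mult.commute)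
qed

section \<open>Approximate factorization on the unit circle\<close>

text \<open>Real polynomials in \<open>Re z\<close> and \<open>Im z\<close> restrict on the unit circle to real parts of
  holomorphic polynomials, because \<open>2 Re a Re b = Re (a b) + Re (a (cnj b))\<close> and \<open>cnj z = 1 / z\<close>.\<close>

lemma Re_monom_mult_on_circle:
  "\<exists>r. \<forall>z. norm z = 1 \<longrightarrow> Re (a * z ^ j) * Re (b * z ^ k) = Re (poly r z)"
proof -
  define q where "q = (if k \<le> j then monom (a * cnj b / 2) (j - k) else monom (cnj a * b / 2) (k - j))"
  have "Re (a * z ^ j) * Re (b * z ^ k) = Re (poly (monom (a * b / 2) (j + k) + q) z)"
    if z: "norm z = 1" for z
  proof -
    have z_cnj: "z * cnj z = 1" using z by (simp add: complex_norm_square[symmetric])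
    have Re_mult_Re: "Re u * Re v = (Re (u * v) + Re (u * cnj v)) / 2" for u v
      by simp
    have "Re (a * z ^ j * cnj (b * z ^ k)) / 2 = Re (poly q z)"
    proof (cases "k \<le> j")
      case True
      have "z ^ j * cnj (z ^ k) = z ^ (j - k) * (z * cnj z) ^ k"
        using True by (simp add: power_mult_distrib mult.assoc[symmetric] flip: power_add)
      then have "a * z ^ j * cnj (b * z ^ k) / 2 = poly q z"
        using True z_cnj by (simp add: q_def poly_monom mult_ac)
      then show ?thesis by (metis Re_divide_numeral)
    next
      case False
      have "cnj (z ^ j) * z ^ k = z ^ (k - j) * (z * cnj z) ^ j"
        using False by (simp add: power_mult_distrib mult_ac flip: power_add)
      then have "cnj (a * z ^ j * cnj (b * z ^ k)) / 2 = poly q z"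
        using False z_cnj by (simp add: q_def poly_monom mult_ac)
      then show ?thesis by (metis Re_divide_numeral cnj.sel(1))
    qed
    moreover have "Re (a * z ^ j * (b * z ^ k)) / 2 = Re (poly (monom (a * b / 2) (j + k)) z)"
      by (simp add: poly_monom power_add mult_ac flip: Re_divide_numeral)
    ultimately show ?thesis unfolding Re_mult_Re by (simp add: add_divide_distrib)
  qed
  then show ?thesis by blast
qed

lemma sum_Re_poly_on_circle:
  assumes "finite A" "\<And>i. i \<in> A \<Longrightarrow> \<exists>r. \<forall>z. norm z = 1 \<longrightarrow> f i z = Re (poly r z)"
  shows "\<exists>r. \<forall>z. norm z = 1 \<longrightarrow> (\<Sum>i\<in>A. f i z) = Re (poly r z)"
proof -
  obtain r where r: "\<And>i z. i \<in> A \<Longrightarrow> norm z = 1 \<Longrightarrow> f i z = Re (poly (r i) z)"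
    using assms(2) by metis
  then show ?thesis
    by (intro exI[of _ "\<Sum>i\<in>A. r i"]) (simp add: poly_sum)
qed

lemma real_polynomial_function_on_circle:
  fixes g :: "complex \<Rightarrow> real"
  assumes "real_polynomial_function g"
  shows "\<exists>r. \<forall>z. norm z = 1 \<longrightarrow> g z = Re (poly r z)"
  using assms
proof induction
  case (linear f)
  have "f z = Re (poly [:0, Complex (f 1) (- f \<i>):] z)" for z
  proof -
    have "f z = f (Re z *\<^sub>R 1 + Im z *\<^sub>R \<i>)"
      by (metis complex_eq scaleR_conv_of_real mult.right_neutral mult.commute)
    also have "\<dots> = Re z * f 1 + Im z * f \<i>"
      using linear by (simp add: linear_simps)
    finally show ?thesis by simp
  qed
  then show ?case by blast
next
  case (const c)
  show ?case by (intro exI[of _ "[:of_real c:]"]) simp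
next
  case (add f g)
  then obtain r s where "\<forall>z. norm z = 1 \<longrightarrow> f z = Re (poly r z)" "\<forall>z. norm z = 1 \<longrightarrow> g z = Re (poly s z)"
    by blast
  then show ?case by (intro exI[of _ "r + s"]) simp
next
  case (mult f g)
  then obtain r s where rs: "\<And>z. norm z = 1 \<Longrightarrow> f z = Re (poly r z)" "\<And>z. norm z = 1 \<Longrightarrow> g z = Re (poly s z)"
    by blast
  have "\<exists>q. \<forall>z. norm z = 1 \<longrightarrow>
      (\<Sum>i\<le>degree r. \<Sum>j\<le>degree s. Re (coeff r i * z ^ i) * Re (coeff s j * z ^ j)) = Re (poly q z)"
    by (intro sum_Re_poly_on_circle Re_monom_mult_on_circle) auto
  moreover have "f z * g z = (\<Sum>i\<le>degree r. \<Sum>j\<le>degree s. Re (coeff r i * z ^ i) * Re (coeff s j * z ^ j))"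
    if "norm z = 1" for z
    by (simp only: rs[OF that] poly_altdef Re_sum sum_product)
  ultimately show ?case by (metis (no_types, lifting))
qed

lemma Re_poly_dense_on_circle:
  fixes u :: "complex \<Rightarrow> real"
  assumes "continuous_on {z. norm z = 1} u" "e > 0"
  shows "\<exists>r. \<forall>z. norm z = 1 \<longrightarrow> \<bar>u z - Re (poly r z)\<bar> < e"
proof -
  have "compact {z :: complex. norm z = 1}"
    using compact_sphere[of "0 :: complex" 1] by (simp add: sphere_def)
  from Stone_Weierstrass_real_polynomial_function[OF this assms]
  obtain g where g: "real_polynomial_function g" "\<And>x. norm x = 1 \<Longrightarrow> \<bar>u x - g x\<bar> < e"
    by auto
  from real_polynomial_function_on_circle[OF g(1)] g(2) show ?thesis by fastforce
qed

lemma norm_one_plus_div_power_le: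
  fixes z :: complex
  assumes "N > 0"
  shows "(norm ((1 + z / of_nat N) ^ N))\<^sup>2 \<le> exp (2 * Re z + (norm z)\<^sup>2 / N)"
proof -
  have "(norm (1 + z / of_nat N))\<^sup>2 = 1 + (2 * Re z / N + (norm z)\<^sup>2 / N\<^sup>2)"
    using assms unfolding cmod_power2 by (simp add: field_simps power2_eq_square)
  also have "\<dots> \<le> exp (2 * Re z / N + (norm z)\<^sup>2 / N\<^sup>2)" by (rule exp_ge_add_one_self)
  finally have "((norm (1 + z / of_nat N))\<^sup>2) ^ N \<le> exp (2 * Re z / N + (norm z)\<^sup>2 / N\<^sup>2) ^ N"
    by (intro power_mono) auto
  also have "\<dots> = exp (real N * (2 * Re z / N + (norm z)\<^sup>2 / N\<^sup>2))"
    by (rule exp_of_nat_mult[symmetric])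
  also have "real N * (2 * Re z / N + (norm z)\<^sup>2 / N\<^sup>2) = 2 * Re z + (norm z)\<^sup>2 / N"
    using assms by (simp add: field_simps power2_eq_square)
  finally show ?thesis by (simp add: norm_power power_mult[symmetric] mult.commute)
qed

definition exp_poly :: "nat \<Rightarrow> complex poly \<Rightarrow> complex poly" where
  "exp_poly N g = (1 + smult (1 / of_nat N) g) ^ N"

lemma norm_poly_exp_poly_le:
  assumes "N > 0" "norm z = 1"
  shows "(norm (poly (exp_poly N g) z))\<^sup>2 \<le> exp (2 * Re (poly g z) + (poly_l1norm g)\<^sup>2 / N)"
proof -
  have "(norm (poly (exp_poly N g) z))\<^sup>2 \<le> exp (2 * Re (poly g z) + (norm (poly g z))\<^sup>2 / N)"
    using norm_one_plus_div_power_le[OF assms(1), of "poly g z"] by (simp add: exp_poly_def)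
  also have "\<dots> \<le> exp (2 * Re (poly g z) + (poly_l1norm g)\<^sup>2 / N)"
    using norm_poly_le_poly_l1norm[OF assms(2), of g]
    by (simp add: divide_right_mono power_mono)
  finally show ?thesis .
qed

lemma poly_l1norm_exp_poly_mult_minus_le:
  assumes "N > 0"
  shows "poly_l1norm (exp_poly N g * exp_poly N (- g) - 1) \<le> exp ((poly_l1norm g)\<^sup>2 / N) - 1"
proof -
  define s where "s = smult (1 / of_nat N) g"
  define h where "h = - (s * s)"
  have "exp_poly N g * exp_poly N (- g) = ((1 + s) * (1 - s)) ^ N"
    by (simp add: exp_poly_def s_def power_mult_distrib)
  also have "(1 + s) * (1 - s) = 1 + h" by (simp add: h_def algebra_simps)
  finally have "exp_poly N g * exp_poly N (- g) = (1 + h) ^ N" .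
  then have "poly_l1norm (exp_poly N g * exp_poly N (- g) - 1) \<le> (1 + poly_l1norm h) ^ N - 1"
    using poly_l1norm_power_diff_one_le by simp
  also have "(1 + poly_l1norm h) ^ N \<le> exp ((poly_l1norm g)\<^sup>2 / N\<^sup>2) ^ N"
  proof (rule power_mono)
    have "poly_l1norm h \<le> (poly_l1norm g)\<^sup>2 / N\<^sup>2"
      using poly_l1norm_mult_le[of s s]
      by (simp add: h_def s_def poly_l1norm_smult norm_divide power2_eq_square)
    then show "1 + poly_l1norm h \<le> exp ((poly_l1norm g)\<^sup>2 / N\<^sup>2)"
      using exp_ge_add_one_self[of "(poly_l1norm g)\<^sup>2 / N\<^sup>2"] by linarith
  qed simp
  also have "\<dots> = exp (real N * ((poly_l1norm g)\<^sup>2 / N\<^sup>2))"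
    by (rule exp_of_nat_mult[symmetric])
  also have "real N * ((poly_l1norm g)\<^sup>2 / N\<^sup>2) = (poly_l1norm g)\<^sup>2 / N"
    using assms by (simp add: field_simps power2_eq_square)
  finally show ?thesis by simp
qed

lemma ln_norm_poly_approx_exists:
  assumes "e > 0" "d > 0"
  shows "\<exists>g. \<forall>z. norm z = 1 \<longrightarrow> \<bar>ln (norm (poly p z) + e) - 2 * Re (poly g z)\<bar> < d"
proof -
  have "norm (poly p z) + e \<noteq> 0" for z
    using assms norm_ge_zero[of "poly p z"] by linarith
  then have "continuous_on {z. norm z = 1} (\<lambda>z. ln (norm (poly p z) + e) / 2)"
    by (intro continuous_intros) auto
  from Re_poly_dense_on_circle[OF this, of "d / 2"] assms(2)
  obtain g where g: "\<And>z. norm z = 1 \<Longrightarrow> \<bar>ln (norm (poly p z) + e) / 2 - Re (poly g z)\<bar> < d / 2"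
    by auto
  have "\<bar>ln (norm (poly p z) + e) - 2 * Re (poly g z)\<bar> < d" if "norm z = 1" for z
    using g[OF that] by linarith
  then show ?thesis by blast
qed

text \<open>With \<open>2 Re g\<close> close to \<open>ln (\<bar>p\<bar> + e)\<close> on the circle, the polynomials
  \<open>w = (1 + g/N)\<^sup>N \<approx> e\<^sup>g\<close> and \<open>v = p (1 - g/N)\<^sup>N \<approx> p e\<^sup>-\<^sup>g\<close> have
  \<open>\<bar>w\<bar>\<^sup>2 \<approx> \<bar>p\<bar> + e\<close> and \<open>\<bar>v\<bar>\<^sup>2 \<approx> \<bar>p\<bar>\<^sup>2 / (\<bar>p\<bar> + e) \<le> \<bar>p\<bar>\<close>.\<close>

lemma exp_mult_le_of_ln_approx:
  fixes a d e q r s :: real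
  assumes "0 \<le> r" "0 < e" "\<bar>ln (r + e) - a\<bar> \<le> d" "q \<le> d"
  shows "exp (a + q) \<le> (r + e) * exp (2 * d)" and "r\<^sup>2 * exp (- a + q) \<le> (r + e) * exp (2 * d)"
proof -
  have pos: "r + e > 0" using assms by simp
  have "exp (a + q) \<le> exp (ln (r + e) + 2 * d)" using assms by simp
  also have "\<dots> = (r + e) * exp (2 * d)" using pos by (simp add: exp_add)
  finally show "exp (a + q) \<le> (r + e) * exp (2 * d)" .
  have "r\<^sup>2 * exp (- a + q) \<le> (r + e)\<^sup>2 * exp (2 * d - ln (r + e))"
    using assms by (intro mult_mono power_mono) auto
  also have "\<dots> = (r + e) * exp (2 * d)"
    using pos by (simp add: exp_diff power2_eq_square)
  finally show "r\<^sup>2 * exp (- a + q) \<le> (r + e) * exp (2 * d)" .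
qed

lemma exists_small_exp_dilation:
  fixes P e :: real
  assumes "0 \<le> P" "0 < e"
  obtains d where "d > 0" "\<And>r. 0 \<le> r \<Longrightarrow> r \<le> P \<Longrightarrow> (r + e / 2) * exp (2 * d) \<le> r + e"
proof -
  define d where "d = ln (1 + e / (2 * (P + e))) / 2"
  have ratio_pos: "e / (2 * (P + e)) > 0" using assms by simp
  then have exp_d: "exp (2 * d) = 1 + e / (2 * (P + e))" by (simp add: d_def)
  show thesis
  proof (rule that[of d])
    show "d > 0" using ratio_pos by (simp add: d_def)
    fix r :: real assume r: "0 \<le> r" "r \<le> P"
    have "(r + e / 2) * (e / (2 * (P + e))) \<le> (P + e) * (e / (2 * (P + e)))"
      using r ratio_pos assms by (intro mult_right_mono) auto
    also have "\<dots> = e / 2" using assms by (simp add: field_simps)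
    finally show "(r + e / 2) * exp (2 * d) \<le> r + e"
      unfolding exp_d by (simp only: distrib_left mult_1_right)
  qed
qed

theorem approx_factorization:
  fixes p :: "complex poly"
  assumes e: "e > 0"
  obtains w v where "poly_l1norm (p - w * v) \<le> e"
    "\<And>z. norm z = 1 \<Longrightarrow> (norm (poly w z))\<^sup>2 \<le> norm (poly p z) + e"
    "\<And>z. norm z = 1 \<Longrightarrow> (norm (poly v z))\<^sup>2 \<le> norm (poly p z) + e"
proof -
  define P where "P = poly_l1norm p"
  obtain d where d: "d > 0" "\<And>r. 0 \<le> r \<Longrightarrow> r \<le> P \<Longrightarrow> (r + e / 2) * exp (2 * d) \<le> r + e"
    using exists_small_exp_dilation[of P e] e by (auto simp: P_def)
  obtain g where g: "\<And>z. norm z = 1 \<Longrightarrow> \<bar>ln (norm (poly p z) + e / 2) - 2 * Re (poly g z)\<bar> < d"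
    using ln_norm_poly_approx_exists[of "e / 2" d p] e d(1) by auto
  define G where "G = poly_l1norm g"
  have "(\<lambda>N. G\<^sup>2 / real N) \<longlonglongrightarrow> 0" "(\<lambda>N. P * (exp (G\<^sup>2 / real N) - 1)) \<longlonglongrightarrow> P * (exp 0 - 1)"
    by (intro tendsto_intros lim_const_over_n)+
  then have "\<forall>\<^sub>F N in sequentially. G\<^sup>2 / real N < d \<and> P * (exp (G\<^sup>2 / real N) - 1) < e \<and> N > 0"
    using d(1) e by (intro eventually_conj order_tendstoD(2)[of _ "0"] eventually_gt_at_top) auto
  then obtain N where N: "G\<^sup>2 / real N < d" "P * (exp (G\<^sup>2 / real N) - 1) < e" "N > 0"
    by (metis (no_types, lifting) eventually_sequentially order.refl)
  show thesis
  proof (rule that[of "exp_poly N g" "p * exp_poly N (- g)"])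
    have "poly_l1norm (p - exp_poly N g * (p * exp_poly N (- g)))
        = poly_l1norm (- (p * (exp_poly N g * exp_poly N (- g) - 1)))"
      by (simp add: algebra_simps)
    also have "\<dots> \<le> P * poly_l1norm (exp_poly N g * exp_poly N (- g) - 1)"
      unfolding P_def poly_l1norm_minus by (rule poly_l1norm_mult_le)
    also have "\<dots> \<le> P * (exp (G\<^sup>2 / real N) - 1)"
      unfolding G_def P_def by (intro mult_left_mono poly_l1norm_exp_poly_mult_minus_le N(3)) simp
    finally show "poly_l1norm (p - exp_poly N g * (p * exp_poly N (- g))) \<le> e" using N(2) by simp
  next
    fix z :: complex assume z: "norm z = 1"
    let ?r = "norm (poly p z)"
    have small: "(?r + e / 2) * exp (2 * d) \<le> ?r + e"
      using norm_poly_le_poly_l1norm[OF z, of p] by (intro d(2)) (auto simp: P_def)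
    have bounds: "exp (2 * Re (poly g z) + G\<^sup>2 / N) \<le> (?r + e / 2) * exp (2 * d)"
      "?r\<^sup>2 * exp (- (2 * Re (poly g z)) + G\<^sup>2 / N) \<le> (?r + e / 2) * exp (2 * d)"
      using exp_mult_le_of_ln_approx[of ?r "e / 2" "2 * Re (poly g z)" d "G\<^sup>2 / N"] g[OF z] N(1) e by auto
    show "(norm (poly (exp_poly N g) z))\<^sup>2 \<le> ?r + e"
      using norm_poly_exp_poly_le[OF N(3) z, of g] bounds(1) small by (simp add: G_def)
    have "(norm (poly (p * exp_poly N (- g)) z))\<^sup>2 \<le> ?r\<^sup>2 * exp (- (2 * Re (poly g z)) + G\<^sup>2 / N)"
      using norm_poly_exp_poly_le[OF N(3) z, of "- g"]
      by (simp add: norm_mult power_mult_distrib mult_left_mono G_def)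
    then show "(norm (poly (p * exp_poly N (- g)) z))\<^sup>2 \<le> ?r + e" using bounds(2) small by simp
  qed
qed

section \<open>Hankel forms of a bounded operator semigroup\<close>

definition fourier_coeff :: "(real \<Rightarrow> complex) \<Rightarrow> nat \<Rightarrow> complex" where
  "fourier_coeff g n = circle_mean (\<lambda>t. g t * cis (- (real n * t)))"

lemma norm_fourier_coeff_le:
  assumes "continuous_on {-pi..pi} g" "\<And>t. norm (g t) \<le> F"
  shows "norm (fourier_coeff g n) \<le> F"
proof -
  have "norm (fourier_coeff g n) \<le> circle_mean (\<lambda>_. F)"
    unfolding fourier_coeff_def
    by (rule norm_circle_mean_le) (use assms in \<open>auto intro!: continuous_intros simp: norm_mult\<close>)
  then show ?thesis by simp
qed

context cplx_hilbert
begin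

lemma circle_mean_trig_sum_le:
  assumes "\<And>k. norm (a k) \<le> norm (coeff v k) * M"
  shows "circle_mean (\<lambda>t. (norm (trig_sum (Suc (degree v)) a t))\<^sup>2)
    \<le> circle_mean (\<lambda>t. (norm (poly v (cis t)))\<^sup>2) * M\<^sup>2"
proof -
  have "(\<Sum>k\<le>degree v. (norm (a k))\<^sup>2) \<le> (\<Sum>k\<le>degree v. (norm (coeff v k) * M)\<^sup>2)"
    by (intro sum_mono power_mono assms) simp
  then show ?thesis
    by (simp add: parseval parseval_poly lessThan_Suc_atMost power_mult_distrib sum_distrib_right)
qed

lemma hankel_form_eq_circle_mean:
  fixes S S' :: "nat \<Rightarrow> 'h \<Rightarrow>\<^sub>L 'h"
  assumes add: "\<And>m k. S (m + k) = S m o\<^sub>L S k"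
    and adj: "\<And>n x y. cinner J (S n x) y = cinner J x (S' n y)"
    and g: "continuous_on {-pi..pi} g"
  shows "coeff_pairing (\<lambda>n. fourier_coeff g n * cinner J (S n x) y) (w * v)
    = circle_mean (\<lambda>t. g t * cinner J (trig_sum (Suc (degree v)) (\<lambda>k. cscale J (coeff v k) (S k x)) t)
        (trig_sum (Suc (degree w)) (\<lambda>m. cscale J (cnj (coeff w m)) (S' m y)) (- t)))"
proof -
  let ?a = "\<lambda>m k. coeff w m * (coeff v k * cinner J (S (m + k) x) y)"
  have "cinner J (trig_sum (Suc (degree v)) (\<lambda>k. cscale J (coeff v k) (S k x)) t)
        (trig_sum (Suc (degree w)) (\<lambda>m. cscale J (cnj (coeff w m)) (S' m y)) (- t))
      = (\<Sum>m\<le>degree w. \<Sum>k\<le>degree v. cis (- (real (m + k) * t)) * ?a m k)" for t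
    unfolding cinner_trig_sum cinner_cscale cinner_cscale_right lessThan_Suc_atMost
    by (subst sum.swap) (simp add: add adj algebra_simps)
  then have "circle_mean (\<lambda>t. g t * cinner J (trig_sum (Suc (degree v)) (\<lambda>k. cscale J (coeff v k) (S k x)) t)
        (trig_sum (Suc (degree w)) (\<lambda>m. cscale J (cnj (coeff w m)) (S' m y)) (- t)))
      = circle_mean (\<lambda>t. \<Sum>m\<le>degree w. \<Sum>k\<le>degree v. g t * cis (- (real (m + k) * t)) * ?a m k)"
    by (simp only: sum_distrib_left mult.assoc)
  also have "\<dots> = (\<Sum>m\<le>degree w. \<Sum>k\<le>degree v. circle_mean (\<lambda>t. g t * cis (- (real (m + k) * t))) * ?a m k)"
    by (simp only: circle_mean_sum circle_mean_mult_left g continuous_intros finite_atMost)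
  also have "\<dots> = coeff_pairing (\<lambda>n. fourier_coeff g n * cinner J (S n x) y) (w * v)"
    unfolding coeff_pairing_mult unfolding coeff_pairing_def fourier_coeff_def
    by (simp add: sum_distrib_left mult_ac)
  finally show ?thesis by simp
qed

lemma norm_hankel_form_product_le:
  fixes S :: "nat \<Rightarrow> 'h \<Rightarrow>\<^sub>L 'h"
  assumes S: "\<And>n. S n \<in> BH J" "\<And>m k. S (m + k) = S m o\<^sub>L S k" "\<And>n. norm (S n) \<le> C"
    and g: "continuous_on {-pi..pi} g" "\<And>t. norm (g t) \<le> F"
  shows "norm (coeff_pairing (\<lambda>n. fourier_coeff g n * cinner J (S n x) y) (w * v))
    \<le> F * C\<^sup>2 * (circle_mean (\<lambda>t. (norm (poly v (cis t)))\<^sup>2) * (norm x)\<^sup>2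
              + circle_mean (\<lambda>t. (norm (poly w (cis t)))\<^sup>2) * (norm y)\<^sup>2) / 2"
proof -
  obtain S' :: "nat \<Rightarrow> 'h \<Rightarrow>\<^sub>L 'h"
    where adj: "\<And>n x y. cinner J (S n x) y = cinner J x (S' n y)" and S': "\<And>n. norm (S' n) \<le> norm (S n)"
    using BH_adjoint_exists[OF S(1)] by metis
  have F: "F \<ge> 0" using g(2)[of 0] norm_ge_zero order_trans by blast
  define X where "X = trig_sum (Suc (degree v)) (\<lambda>k. cscale J (coeff v k) (S k x))"
  define Y where "Y = trig_sum (Suc (degree w)) (\<lambda>m. cscale J (cnj (coeff w m)) (S' m y))"
  have contX: "continuous_on {-pi..pi} X" and contY: "continuous_on {-pi..pi} (\<lambda>t. Y (- t))"
    unfolding X_def Y_def by (intro continuous_intros)+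
  have meanX: "circle_mean (\<lambda>t. (norm (X t))\<^sup>2) \<le> circle_mean (\<lambda>t. (norm (poly v (cis t)))\<^sup>2) * (C * norm x)\<^sup>2"
    unfolding X_def
    by (intro circle_mean_trig_sum_le)
       (auto simp: norm_cscale intro!: mult_left_mono order_trans[OF norm_blinfun] mult_right_mono S)
  have meanY: "circle_mean (\<lambda>t. (norm (Y (- t)))\<^sup>2)
      \<le> circle_mean (\<lambda>t. (norm (poly w (cis t)))\<^sup>2) * (C * norm y)\<^sup>2"
    unfolding circle_mean_reflect[of "\<lambda>t. (norm (Y t))\<^sup>2"] unfolding Y_def
    by (intro circle_mean_trig_sum_le)
       (auto simp: norm_cscale
           intro!: mult_left_mono order_trans[OF norm_blinfun] mult_right_mono order_trans[OF S'] S)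
  have "norm (g t * cinner J (X t) (Y (- t))) \<le> ((norm (X t))\<^sup>2 + (norm (Y (- t)))\<^sup>2) * (F / 2)" for t
  proof -
    have "norm (g t * cinner J (X t) (Y (- t))) \<le> F * (norm (X t) * norm (Y (- t)))"
      unfolding norm_mult by (intro mult_mono g(2) norm_cinner_le F) simp
    also have "\<dots> \<le> F * (((norm (X t))\<^sup>2 + (norm (Y (- t)))\<^sup>2) / 2)"
      using sum_squares_bound[of "norm (X t)" "norm (Y (- t))"] by (intro mult_left_mono F) simp
    finally show ?thesis by (simp add: mult.commute)
  qed
  then have "norm (circle_mean (\<lambda>t. g t * cinner J (X t) (Y (- t))))
      \<le> circle_mean (\<lambda>t. ((norm (X t))\<^sup>2 + (norm (Y (- t)))\<^sup>2) * (F / 2))"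
    by (intro norm_circle_mean_le continuous_intros g(1) contX contY)
  also have "\<dots> = (circle_mean (\<lambda>t. (norm (X t))\<^sup>2) + circle_mean (\<lambda>t. (norm (Y (- t)))\<^sup>2)) * (F / 2)"
    by (simp only: circle_mean_mult_left circle_mean_add continuous_intros contX contY)
  also have "\<dots> \<le> (circle_mean (\<lambda>t. (norm (poly v (cis t)))\<^sup>2) * (C * norm x)\<^sup>2
      + circle_mean (\<lambda>t. (norm (poly w (cis t)))\<^sup>2) * (C * norm y)\<^sup>2) * (F / 2)"
    using F by (intro mult_right_mono add_mono meanX meanY) simp
  finally show ?thesis
    unfolding hankel_form_eq_circle_mean[OF S(2) adj g(1)] X_def Y_def
    by (simp add: power_mult_distrib algebra_simps)
qed

lemma norm_fourier_coeff_mult_cinner_le: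
  fixes S :: "'h \<Rightarrow>\<^sub>L 'h"
  assumes S: "norm S \<le> C" and g: "continuous_on {-pi..pi} g" "\<And>t. norm (g t) \<le> F"
  shows "norm (fourier_coeff g n * cinner J (S x) y) \<le> F * (C * norm x * norm y)"
proof -
  have "0 \<le> F" using g(2)[of 0] norm_ge_zero order_trans by blast
  moreover have "norm (S x) \<le> C * norm x"
    by (rule order_trans[OF norm_blinfun mult_right_mono[OF S]]) simp
  ultimately show ?thesis
    unfolding norm_mult
    by (intro mult_mono norm_fourier_coeff_le g order_trans[OF norm_cinner_le mult_right_mono]) auto
qed

theorem norm_hankel_form_le:
  fixes S :: "nat \<Rightarrow> 'h \<Rightarrow>\<^sub>L 'h"
  assumes S: "\<And>n. S n \<in> BH J" "\<And>m k. S (m + k) = S m o\<^sub>L S k" "\<And>n. norm (S n) \<le> C"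
    and g: "continuous_on {-pi..pi} g" "\<And>t. norm (g t) \<le> F"
  shows "norm (coeff_pairing (\<lambda>n. fourier_coeff g n * cinner J (S n x) y) p)
    \<le> F * C\<^sup>2 * circle_mean (\<lambda>t. norm (poly p (cis t))) * ((norm x)\<^sup>2 + (norm y)\<^sup>2) / 2"
proof (rule field_le_epsilon)
  have F: "F \<ge> 0" using g(2)[of 0] norm_ge_zero order_trans by blast
  let ?\<phi> = "\<lambda>n. fourier_coeff g n * cinner J (S n x) y" and ?q = "(norm x)\<^sup>2 + (norm y)\<^sup>2"
    and ?m = "circle_mean (\<lambda>t. norm (poly p (cis t)))"
  define K where "K = F * (C * norm x * norm y)"
  have \<phi>: "norm (?\<phi> n) \<le> K" for n
    unfolding K_def by (rule norm_fourier_coeff_mult_cinner_le[OF S(3) g])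
  then have K: "K \<ge> 0" using norm_ge_zero order_trans by blast
  fix \<epsilon> :: real assume \<epsilon>: "\<epsilon> > 0"
  define e where "e = \<epsilon> / (F * C\<^sup>2 * ?q / 2 + K + 1)"
  have D: "F * C\<^sup>2 * ?q / 2 + K + 1 > 0" using F K by (simp add: add_nonneg_pos)
  then have e: "e > 0" using \<epsilon> by (simp add: e_def)
  obtain w v where wv: "poly_l1norm (p - w * v) \<le> e"
    "\<And>z. norm z = 1 \<Longrightarrow> (norm (poly w z))\<^sup>2 \<le> norm (poly p z) + e"
    "\<And>z. norm z = 1 \<Longrightarrow> (norm (poly v z))\<^sup>2 \<le> norm (poly p z) + e"
    using approx_factorization[OF e] by blast
  have mean: "circle_mean (\<lambda>t. (norm (poly u (cis t)))\<^sup>2) \<le> ?m + e"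
    if "\<And>z. norm z = 1 \<Longrightarrow> (norm (poly u z))\<^sup>2 \<le> norm (poly p z) + e" for u
  proof -
    have "circle_mean (\<lambda>t. (norm (poly u (cis t)))\<^sup>2) \<le> circle_mean (\<lambda>t. norm (poly p (cis t)) + e)"
      by (intro circle_mean_mono continuous_intros that) simp
    then show ?thesis by (simp add: circle_mean_add continuous_intros)
  qed
  have "coeff_pairing ?\<phi> p = coeff_pairing ?\<phi> (w * v) + coeff_pairing ?\<phi> (p - w * v)"
    using coeff_pairing_add[of ?\<phi> "w * v" "p - w * v"] by simp
  also have "norm \<dots> \<le> norm (coeff_pairing ?\<phi> (w * v)) + norm (coeff_pairing ?\<phi> (p - w * v))"
    by (rule norm_triangle_ineq)
  also have "norm (coeff_pairing ?\<phi> (p - w * v)) \<le> K * e"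
    by (rule order_trans[OF norm_coeff_pairing_le[OF \<phi>] mult_left_mono[OF wv(1) K]])
  also have "norm (coeff_pairing ?\<phi> (w * v)) \<le> F * C\<^sup>2 * ((?m + e) * (norm x)\<^sup>2 + (?m + e) * (norm y)\<^sup>2) / 2"
    using F by (intro order_trans[OF norm_hankel_form_product_le[OF S g]] divide_right_mono
        mult_left_mono add_mono
        mult_right_mono mean wv) auto
  also have "F * C\<^sup>2 * ((?m + e) * (norm x)\<^sup>2 + (?m + e) * (norm y)\<^sup>2) / 2 + K * e
      = F * C\<^sup>2 * ?m * ?q / 2 + e * (F * C\<^sup>2 * ?q / 2 + K)"
    by (simp add: algebra_simps add_divide_distrib)
  also have "e * (F * C\<^sup>2 * ?q / 2 + K) \<le> \<epsilon>"
    using e D by (simp add: e_def field_simps)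
  finally show "norm (coeff_pairing ?\<phi> p) \<le> F * C\<^sup>2 * ?m * ?q / 2 + \<epsilon>" by simp
qed

end

section \<open>The Fourier transform on the line\<close>

lemma integrable_mult_bounded:
  fixes f w :: "'a \<Rightarrow> 'b::{real_normed_algebra,banach,second_countable_topology}"
  assumes f: "integrable M f" and w[measurable]: "w \<in> borel_measurable M" and le: "\<And>t. norm (w t) \<le> B"
  shows "integrable M (\<lambda>t. f t * w t)"
proof (rule Bochner_Integration.integrable_bound)
  note [measurable] = borel_measurable_integrable[OF f]
  show "integrable M (\<lambda>t. norm (f t) * B)" using f by simp
  show "(\<lambda>t. f t * w t) \<in> borel_measurable M" by measurable
  have "norm (f t * w t) \<le> norm (f t) * B" for t
    by (rule order_trans[OF norm_mult_ineq mult_left_mono[OF le norm_ge_zero]])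
  then show "AE t in M. norm (f t * w t) \<le> norm (norm (f t) * B)"
    by (intro AE_I2) (simp add: order_trans[OF _ abs_ge_self])
qed

lemma LINT_norm_mult_le:
  fixes f w :: "'a \<Rightarrow> 'b::{real_normed_algebra,banach,second_countable_topology}"
  assumes f: "integrable M f" and w: "w \<in> borel_measurable M" and le: "\<And>t. norm (w t) \<le> B"
  shows "(LINT t|M. norm (f t * w t)) \<le> (LINT t|M. norm (f t)) * B"
proof -
  have "norm (f t * w t) \<le> norm (f t) * B" for t
    by (rule order_trans[OF norm_mult_ineq mult_left_mono[OF le norm_ge_zero]])
  then have "(LINT t|M. norm (f t * w t)) \<le> (LINT t|M. norm (f t) * B)"
    by (intro integral_mono integrable_norm integrable_mult_bounded[OF assms] integrable_mult_left f)
  then show ?thesis by simp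
qed

lemma norm_LINT_mult_le:
  fixes f w :: "'a \<Rightarrow> 'b::{real_normed_algebra,banach,second_countable_topology}"
  assumes "integrable M f" "w \<in> borel_measurable M" "\<And>t. norm (w t) \<le> B"
  shows "norm (LINT t|M. f t * w t) \<le> (LINT t|M. norm (f t)) * B"
  by (rule order_trans[OF integral_norm_bound LINT_norm_mult_le[OF assms]])

lemma tendsto_LINT_mult_bounded:
  fixes f v :: "'a \<Rightarrow> 'b::{real_normed_algebra,banach,second_countable_topology}"
  assumes f: "integrable M f" and w[measurable]: "\<And>n. w n \<in> borel_measurable M"
    and le: "\<And>n t. norm (w n t) \<le> B" and lim: "\<And>t. (\<lambda>n. w n t) \<longlonglongrightarrow> v t"
  shows "(\<lambda>n. LINT t|M. f t * w n t) \<longlonglongrightarrow> (LINT t|M. f t * v t)"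
proof (rule integral_dominated_convergence)
  note [measurable] = borel_measurable_integrable[OF f]
  have [measurable]: "v \<in> borel_measurable M" by (rule borel_measurable_LIMSEQ_metric[OF w lim])
  show "integrable M (\<lambda>t. norm (f t) * B)" using f by simp
  show "(\<lambda>t. f t * v t) \<in> borel_measurable M" "\<And>n. (\<lambda>t. f t * w n t) \<in> borel_measurable M" by measurable
  show "AE t in M. (\<lambda>n. f t * w n t) \<longlonglongrightarrow> f t * v t"
    by (intro AE_I2 tendsto_mult tendsto_const lim)
  show "AE t in M. norm (f t * w n t) \<le> norm (f t) * B" for n
    by (intro AE_I2 order_trans[OF norm_mult_ineq] mult_left_mono le norm_ge_zero)
qed

lemma integrable_pair_mult:
  fixes a b :: "real \<Rightarrow> complex"
  assumes a: "integrable lborel a" and b: "integrable lborel b"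
    and w[measurable]: "(\<lambda>(s, r). w s r) \<in> borel_measurable (lborel \<Otimes>\<^sub>M lborel)"
    and le: "\<And>s r. norm (w s r) \<le> B"
  shows "integrable (lborel \<Otimes>\<^sub>M lborel) (\<lambda>(s, r). a s * b r * w s r)"
proof (rule lborel_pair.Fubini_integrable)
  have [measurable]: "a \<in> borel_measurable lborel" "b \<in> borel_measurable lborel"
    using a b by (auto dest: borel_measurable_integrable)
  have w_slice: "(\<lambda>r. w s r) \<in> borel_measurable lborel" for s
    using measurable_compose[OF measurable_Pair1' w, of s] by simp
  show "(\<lambda>(s, r). a s * b r * w s r) \<in> borel_measurable (lborel \<Otimes>\<^sub>M lborel)" by measurable
  have int_slice: "integrable lborel (\<lambda>r. b r * w s r)" for s
    by (rule integrable_mult_bounded[OF b w_slice le])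
  then show "AE s in lborel. integrable lborel (\<lambda>r. case (s, r) of (s, r) \<Rightarrow> a s * b r * w s r)"
    by (simp add: mult.assoc)
  have "integrable lborel (\<lambda>s. norm (a s) * (LINT r|lborel. norm (b r * w s r)))"
  proof (rule integrable_mult_bounded)
    show "integrable lborel (\<lambda>s. norm (a s))" using a by simp
    show "(\<lambda>s. LINT r|lborel. norm (b r * w s r)) \<in> borel_measurable lborel" by measurable
    show "norm (LINT r|lborel. norm (b r * w s r)) \<le> (LINT r|lborel. norm (b r)) * B" for s
      using LINT_norm_mult_le[OF b w_slice le] by simp
  qed
  then show "integrable lborel (\<lambda>s. LINT r|lborel. norm (case (s, r) of (s, r) \<Rightarrow> a s * b r * w s r))"
    by (simp add: norm_mult mult.assoc)
qed

lemma LINT_LINT_mult_swap: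
  fixes a b :: "real \<Rightarrow> complex"
  assumes "integrable lborel a" "integrable lborel b"
    and "(\<lambda>(s, r). w s r) \<in> borel_measurable (lborel \<Otimes>\<^sub>M lborel)" "\<And>s r. norm (w s r) \<le> B"
  shows "(LINT s|lborel. LINT r|lborel. a s * b r * w s r) = (LINT r|lborel. LINT s|lborel. a s * b r * w s r)"
  using lborel_pair.Fubini_integral[OF integrable_pair_mult[OF assms]] by simp

lemma integrable_lborel_affine:
  fixes f :: "real \<Rightarrow> 'a::{banach,second_countable_topology}"
  assumes "integrable lborel f" "c \<noteq> 0"
  shows "integrable lborel (\<lambda>x. f (c * x + t))"
  using lborel_integrable_real_affine[OF assms, of t] by (simp add: add.commute)

lemma LINT_lborel_affine:
  fixes f :: "real \<Rightarrow> 'a::{banach,second_countable_topology}"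
  assumes "c \<noteq> 0"
  shows "(LINT x|lborel. f (c * x + t)) = (LINT x|lborel. f x) /\<^sub>R \<bar>c\<bar>"
  using lborel_integral_real_affine[OF assms, of f t] assms by (simp add: add.commute)

lemma L1norm_nonneg: "0 \<le> L1norm h"
  unfolding L1norm_def
  by (cases "(\<lambda>t. norm (h t)) integrable_on UNIV") (auto intro: integral_nonneg simp: not_integrable_integral)

lemma L1norm_eq_LINT: "integrable lborel h \<Longrightarrow> L1norm h = (LINT t|lborel. norm (h t))"
  unfolding L1norm_def by (intro integral_lborel integrable_norm)

lemma cis_measurable [measurable]: "cis \<in> borel_measurable borel"
  by (intro borel_measurable_continuous_onI continuous_intros)

lemma integrable_mult_cis:
  "integrable lborel h \<Longrightarrow> v \<in> borel_measurable borel \<Longrightarrow> integrable lborel (\<lambda>t. h t * cis (v t))"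
  by (rule integrable_mult_bounded[where B = 1]) auto

lemma fourier_eq_LINT:
  assumes "integrable lborel h"
  shows "fourier h u = (LINT t|lborel. h t * cis (- (t * u)))"
  unfolding fourier_def using integral_lborel[OF integrable_mult_cis[OF assms, of "\<lambda>t. - (t * u)"]]
  by (simp add: cis_conv_exp)

lemma norm_fourier_le: "integrable lborel h \<Longrightarrow> norm (fourier h u) \<le> L1norm h"
  using norm_LINT_mult_le[of lborel h "\<lambda>t. cis (- (t * u))" 1] by (simp add: fourier_eq_LINT L1norm_eq_LINT)

lemma continuous_fourier:
  assumes "integrable lborel h"
  shows "continuous_on UNIV (fourier h)"
proof (rule continuous_on_sequentiallyI)
  fix U :: "nat \<Rightarrow> real" and u
  assume "U \<longlonglongrightarrow> u"
  then have "(\<lambda>n. cis (- (t * U n))) \<longlonglongrightarrow> cis (- (t * u))" for t by (intro tendsto_intros)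
  then show "(\<lambda>n. fourier h (U n)) \<longlonglongrightarrow> fourier h u"
    unfolding fourier_eq_LINT[OF assms] by (intro tendsto_LINT_mult_bounded[OF assms, where B = 1]) auto
qed

lemma fourier_measurable: "integrable lborel h \<Longrightarrow> fourier h \<in> borel_measurable borel"
  by (rule borel_measurable_continuous_onI[OF continuous_fourier])

lemma fourier_diff:
  assumes "integrable lborel f" "integrable lborel g"
  shows "fourier (\<lambda>t. f t - g t) u = fourier f u - fourier g u"
  using assms by (simp add: fourier_eq_LINT left_diff_distrib integrable_mult_cis)

lemma fourier_cis_mult:
  assumes "integrable lborel f"
  shows "fourier (\<lambda>t. f t * cis (a * t)) u = fourier f (u - a)"
proof -
  have "cis (a * t) * cis (- (t * u)) = cis (- (t * (u - a)))" for t
    unfolding cis_mult by (rule arg_cong[of _ _ cis]) (simp add: algebra_simps)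
  then show ?thesis using assms by (simp add: fourier_eq_LINT integrable_mult_cis mult.assoc)
qed

lemma fourier_affine:
  assumes f: "integrable lborel f" and c: "c \<noteq> 0"
  shows "fourier (\<lambda>t. f (c * t + a)) u = cis (a * u / c) * fourier f (u / c) /\<^sub>R \<bar>c\<bar>"
proof -
  have "cis (- (t * u)) = cis (- ((c * t + a) * (u / c))) * cis (a * u / c)" for t
    unfolding cis_mult using c by (intro arg_cong[of _ _ cis]) (simp add: field_simps)
  then have "fourier (\<lambda>t. f (c * t + a)) u
      = (LINT t|lborel. f (c * t + a) * cis (- ((c * t + a) * (u / c))) * cis (a * u / c))"
    by (simp add: fourier_eq_LINT[OF integrable_lborel_affine[OF f c]] mult.assoc)
  also have "\<dots> = (LINT t|lborel. f t * cis (- (t * (u / c))) * cis (a * u / c)) /\<^sub>R \<bar>c\<bar>"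
    by (rule LINT_lborel_affine[OF c])
  finally show ?thesis by (simp add: fourier_eq_LINT[OF f] mult.commute)
qed

theorem fourier_multiplication_formula:
  assumes f: "integrable lborel f" and g: "integrable lborel g"
  shows "(LINT s|lborel. f s * fourier g s) = (LINT s|lborel. fourier f s * g s)"
proof -
  have "(LINT s|lborel. f s * fourier g s) = (LINT s|lborel. LINT r|lborel. f s * g r * cis (- (r * s)))"
    by (simp add: fourier_eq_LINT[OF g] mult.assoc)
  also have "\<dots> = (LINT r|lborel. LINT s|lborel. f s * g r * cis (- (r * s)))"
    by (rule LINT_LINT_mult_swap[OF f g, where B = 1]) auto
  also have "\<dots> = (LINT r|lborel. LINT s|lborel. f s * cis (- (s * r)) * g r)"
    by (simp only: mult_ac)
  finally show ?thesis by (simp add: fourier_eq_LINT[OF f])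
qed

abbreviation gauss :: "real \<Rightarrow> complex" where
  "gauss x \<equiv> complex_of_real (std_normal_density x)"

lemma integrable_gauss: "integrable lborel gauss"
  using integrable_std_normal_moment[of 0] by (auto intro: integrable_of_real)

lemma LINT_gauss: "(LINT x|lborel. gauss x) = 1"
  using integral_std_normal_moment_even[of 0] by (simp add: integral_complex_of_real)

lemma gauss_eq: "gauss x = of_real (exp (- x\<^sup>2 / 2)) / of_real (sqrt (2 * pi))"
  by (simp add: std_normal_density_def)

lemma norm_gauss_le: "norm (gauss x) \<le> 1 / sqrt (2 * pi)"
  unfolding gauss_eq norm_divide norm_of_real by (simp add: divide_right_mono)

lemma fourier_gauss: "fourier gauss u = of_real (exp (- u\<^sup>2 / 2))"
proof -
  have "char std_normal_distribution (- u) = (LINT v|lborel. std_normal_density v *\<^sub>R iexp (- u * v))"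
    unfolding char_def by (subst integral_density) (auto simp: normal_density_nonneg)
  then show ?thesis
    unfolding char_std_normal_distribution fourier_eq_LINT[OF integrable_gauss]
    by (simp add: scaleR_conv_of_real cis_conv_exp mult.commute)
qed

lemma LINT_fourier_mult_gauss:
  assumes g: "integrable lborel g" and \<sigma>: "\<sigma> > 0"
  shows "(LINT u|lborel. fourier g u * (gauss (\<sigma> * u) * cis (t * u)))
    = of_real (sqrt (2 * pi)) * (LINT x|lborel. gauss x * g (\<sigma> * x + t))"
proof -
  have int: "integrable lborel (\<lambda>u. gauss (\<sigma> * u))"
    using integrable_lborel_affine[OF integrable_gauss, of \<sigma> 0] \<sigma> by simp
  have fourier_gauss_cis: "fourier (\<lambda>u. gauss (\<sigma> * u) * cis (t * u)) s
      = of_real (exp (- ((s - t) / \<sigma>)\<^sup>2 / 2)) /\<^sub>R \<sigma>" for s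
    using fourier_affine[OF integrable_gauss, of \<sigma> 0 "s - t"] \<sigma>
    by (simp only: fourier_cis_mult[OF int] fourier_gauss) simp
  have gauss_cancel: "of_real (exp (- ((\<sigma> * x + t - t) / \<sigma>)\<^sup>2 / 2)) = of_real (sqrt (2 * pi)) * gauss x" for x
    using \<sigma> by (simp add: gauss_eq)
  have "(LINT u|lborel. fourier g u * (gauss (\<sigma> * u) * cis (t * u)))
      = (LINT s|lborel. g s * fourier (\<lambda>u. gauss (\<sigma> * u) * cis (t * u)) s)"
    by (rule fourier_multiplication_formula[OF g, symmetric]) (intro integrable_mult_cis int, measurable)
  also have "\<dots> = (LINT s|lborel. g s * of_real (exp (- ((s - t) / \<sigma>)\<^sup>2 / 2))) /\<^sub>R \<sigma>"
    by (simp only: fourier_gauss_cis mult_scaleR_right integral_scaleR_right)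
  also have "\<dots> = (LINT x|lborel. g (\<sigma> * x + t) * of_real (exp (- ((\<sigma> * x + t - t) / \<sigma>)\<^sup>2 / 2)))"
    using LINT_lborel_affine[of \<sigma> "\<lambda>s. g s * of_real (exp (- ((s - t) / \<sigma>)\<^sup>2 / 2))" t] \<sigma> by simp
  also have "\<dots> = (LINT x|lborel. of_real (sqrt (2 * pi)) * (gauss x * g (\<sigma> * x + t)))"
    unfolding gauss_cancel by (simp only: mult_ac)
  finally show ?thesis by simp
qed

theorem fourier_inversion:
  assumes cont: "continuous_on UNIV g" and B: "\<And>t. norm (g t) \<le> B"
    and g: "integrable lborel g" and Fg: "integrable lborel (fourier g)"
  shows "fourier (fourier g) (- t) = of_real (2 * pi) * g t"
proof -
  have [measurable]: "g \<in> borel_measurable borel" using g by (auto dest: borel_measurable_integrable)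
  define \<sigma> where "\<sigma> n = 1 / real (Suc n)" for n
  have \<sigma>: "\<sigma> \<longlonglongrightarrow> 0" unfolding \<sigma>_def by (rule LIMSEQ_Suc[OF lim_const_over_n])
  have "(\<lambda>n. LINT u|lborel. fourier g u * (gauss (\<sigma> n * u) * cis (t * u))) \<longlonglongrightarrow>
      (LINT u|lborel. fourier g u * (gauss (0 * u) * cis (t * u)))"
  proof (rule tendsto_LINT_mult_bounded[OF Fg])
    show "(\<lambda>n. gauss (\<sigma> n * u) * cis (t * u)) \<longlonglongrightarrow> gauss (0 * u) * cis (t * u)" for u
      unfolding gauss_eq by (intro tendsto_intros \<sigma>) auto
    show "norm (gauss (\<sigma> n * u) * cis (t * u)) \<le> 1 / sqrt (2 * pi)" for n u
      by (simp only: norm_mult norm_cis mult_1_right norm_gauss_le)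
  qed measurable
  moreover have "(\<lambda>n. LINT x|lborel. gauss x * g (\<sigma> n * x + t)) \<longlonglongrightarrow> (LINT x|lborel. gauss x * g t)"
  proof (rule tendsto_LINT_mult_bounded[OF integrable_gauss])
    show "(\<lambda>n. g (\<sigma> n * x + t)) \<longlonglongrightarrow> g t" for x
      using \<sigma> by (intro continuous_on_tendsto_compose[OF cont]) (auto intro!: tendsto_eq_intros)
  qed (use B in auto)
  moreover have "(LINT u|lborel. fourier g u * (gauss (\<sigma> n * u) * cis (t * u)))
      = of_real (sqrt (2 * pi)) * (LINT x|lborel. gauss x * g (\<sigma> n * x + t))" for n
    by (rule LINT_fourier_mult_gauss[OF g]) (simp add: \<sigma>_def)
  ultimately have "(LINT u|lborel. fourier g u * (gauss (0 * u) * cis (t * u)))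
      = of_real (sqrt (2 * pi)) * (LINT x|lborel. gauss x * g t)"
    by (intro LIMSEQ_unique) (auto intro: tendsto_mult_left)
  then have "fourier (fourier g) (- t) / of_real (sqrt (2 * pi)) = of_real (sqrt (2 * pi)) * g t"
    using LINT_gauss by (simp add: gauss_eq fourier_eq_LINT[OF Fg] mult.commute)
  then have "fourier (fourier g) (- t) = of_real (sqrt (2 * pi) * sqrt (2 * pi)) * g t"
    by (simp add: field_simps del: real_sqrt_mult_self)
  then show ?thesis by simp
qed

text \<open>\<^const>\<open>conv\<close> is a gauge integral, which may exist where \<open>s \<mapsto> a s * b (r - s)\<close> is not Lebesgue integrable;
  this convolution is the one that is measurable for arbitrary integrable \<open>a\<close> and \<open>b\<close>.\<close>

definition lborel_conv :: "(real \<Rightarrow> complex) \<Rightarrow> (real \<Rightarrow> complex) \<Rightarrow> real \<Rightarrow> complex" where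
  "lborel_conv a b r = (LINT s|lborel. a s * b (r - s))"

lemma integrable_pair_conv:
  fixes a b :: "real \<Rightarrow> complex"
  assumes a: "integrable lborel a" and b: "integrable lborel b"
    and \<Phi>[measurable]: "\<Phi> \<in> borel_measurable lborel" and le: "\<And>r. norm (\<Phi> r) \<le> B"
  shows "integrable (lborel \<Otimes>\<^sub>M lborel) (\<lambda>(s, r). a s * b (r - s) * \<Phi> r)"
proof (rule lborel_pair.Fubini_integrable)
  have [measurable]: "a \<in> borel_measurable borel" "b \<in> borel_measurable borel"
    using a b by (auto dest: borel_measurable_integrable)
  show "(\<lambda>(s, r). a s * b (r - s) * \<Phi> r) \<in> borel_measurable (lborel \<Otimes>\<^sub>M lborel)" by measurable
  have shift: "integrable lborel (\<lambda>r. b (r - s))" for s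
    using integrable_lborel_affine[OF b, of 1 "- s"] by simp
  then show "AE s in lborel. integrable lborel (\<lambda>r. case (s, r) of (s, r) \<Rightarrow> a s * b (r - s) * \<Phi> r)"
    using integrable_mult_bounded[OF shift \<Phi> le] by (simp add: mult.assoc)
  have "integrable lborel (\<lambda>s. norm (a s) * (LINT r|lborel. norm (b (r - s) * \<Phi> r)))"
  proof (rule integrable_mult_bounded)
    show "integrable lborel (\<lambda>s. norm (a s))" using a by simp
    show "norm (LINT r|lborel. norm (b (r - s) * \<Phi> r)) \<le> (LINT r|lborel. norm (b r)) * B" for s
      using LINT_norm_mult_le[OF shift[of s] \<Phi> le] LINT_lborel_affine[of 1 "\<lambda>r. norm (b r)" "- s"] by simp
  qed measurable
  then show "integrable lborel (\<lambda>s. LINT r|lborel. norm (case (s, r) of (s, r) \<Rightarrow> a s * b (r - s) * \<Phi> r))"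
    by (simp add: norm_mult mult.assoc)
qed

lemma integrable_lborel_conv:
  assumes "integrable lborel a" "integrable lborel b"
  shows "integrable lborel (lborel_conv a b)"
  using lborel_pair.integrable_snd[OF integrable_pair_conv[OF assms, of "\<lambda>_. 1" 1]]
  by (simp add: lborel_conv_def[abs_def])

lemma LINT_lborel_conv_mult:
  assumes a: "integrable lborel a" and b: "integrable lborel b"
    and \<Phi>: "\<Phi> \<in> borel_measurable lborel" "\<And>t. norm (\<Phi> t) \<le> B"
  shows "(LINT r|lborel. lborel_conv a b r * \<Phi> r) = (LINT s|lborel. LINT v|lborel. a s * b v * \<Phi> (v + s))"
proof -
  have "(LINT r|lborel. lborel_conv a b r * \<Phi> r) = (LINT r|lborel. LINT s|lborel. a s * b (r - s) * \<Phi> r)"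
    by (simp add: lborel_conv_def)
  also have "\<dots> = (LINT s|lborel. LINT r|lborel. a s * b (r - s) * \<Phi> r)"
    by (rule lborel_pair.Fubini_integral[OF integrable_pair_conv[OF a b \<Phi>]])
  also have "\<dots> = (LINT s|lborel. LINT v|lborel. a s * b v * \<Phi> (v + s))"
    using LINT_lborel_affine[of 1 "\<lambda>r. a s * b (r - s) * \<Phi> r" s for s] by simp
  finally show ?thesis .
qed

lemma fourier_lborel_conv:
  assumes a: "integrable lborel a" and b: "integrable lborel b"
  shows "fourier (lborel_conv a b) u = fourier a u * fourier b u"
proof -
  have "fourier (lborel_conv a b) u = (LINT s|lborel. LINT v|lborel. a s * b v * cis (- ((v + s) * u)))"
    unfolding fourier_eq_LINT[OF integrable_lborel_conv[OF a b]]
    by (rule LINT_lborel_conv_mult[OF a b, where B = 1]) auto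
  also have "\<dots> = (LINT s|lborel. LINT v|lborel. a s * cis (- (s * u)) * (b v * cis (- (v * u))))"
  proof (intro Bochner_Integration.integral_cong refl)
    fix s v
    have "cis (- ((v + s) * u)) = cis (- (s * u)) * cis (- (v * u))"
      by (simp add: cis_mult algebra_simps)
    then show "a s * b v * cis (- ((v + s) * u)) = a s * cis (- (s * u)) * (b v * cis (- (v * u)))"
      by (simp only: mult_ac)
  qed
  finally show ?thesis by (simp add: fourier_eq_LINT a b)
qed

definition dilate :: "real \<Rightarrow> (real \<Rightarrow> complex) \<Rightarrow> real \<Rightarrow> complex" where
  "dilate l k t = of_real l * k (l * t)"

lemma integrable_dilate: "integrable lborel k \<Longrightarrow> l > 0 \<Longrightarrow> integrable lborel (dilate l k)"
  using integrable_lborel_affine[of k l 0] by (simp add: dilate_def[abs_def])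

lemma LINT_dilate_mult: "l > 0 \<Longrightarrow> (LINT t|lborel. dilate l k t * g t) = (LINT s|lborel. k s * g (s / l))"
  using LINT_lborel_affine[of l "\<lambda>s. k s * g (s / l)" 0]
  by (simp add: dilate_def scaleR_conv_of_real mult.assoc)

lemma fourier_dilate: "integrable lborel k \<Longrightarrow> l > 0 \<Longrightarrow> fourier (dilate l k) u = fourier k (u / l)"
  using LINT_dilate_mult[of l k "\<lambda>t. cis (- (t * u))"]
  by (simp add: fourier_eq_LINT integrable_dilate mult.commute)

lemma dilate_tendsto_delta:
  assumes k: "integrable lborel k" and g: "continuous_on UNIV g" and B: "\<And>t. norm (g t) \<le> B"
  shows "(\<lambda>n. LINT t|lborel. dilate (real (Suc n)) k t * g t) \<longlonglongrightarrow> (LINT t|lborel. k t) * g 0"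
proof -
  have [measurable]: "g \<in> borel_measurable borel" using g by (rule borel_measurable_continuous_onI)
  have "(\<lambda>n. LINT s|lborel. k s * g (s / real (Suc n))) \<longlonglongrightarrow> (LINT s|lborel. k s * g 0)"
  proof (rule tendsto_LINT_mult_bounded[OF k _ B])
    show "(\<lambda>n. g (s / real (Suc n))) \<longlonglongrightarrow> g 0" for s
      by (intro continuous_on_tendsto_compose[OF g] LIMSEQ_Suc[OF lim_const_over_n]) auto
  qed measurable
  then show ?thesis by (simp add: LINT_dilate_mult del: of_nat_Suc)
qed

lemma lborel_conv_dilate_uniform_approx:
  assumes k: "integrable lborel k" "(LINT t|lborel. k t) = 1"
    and f: "uniformly_continuous_on UNIV f" "\<And>t. norm (f t) \<le> B" and e: "e > 0"
  shows "\<exists>l>0. \<forall>u. norm (lborel_conv (dilate l k) f u - f u) \<le> e"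
proof (rule ccontr)
  assume "\<not> ?thesis"
  then have "\<exists>u. norm (lborel_conv (dilate (real (Suc n)) k) f u - f u) > e" for n
    by (meson not_le of_nat_0_less_iff zero_less_Suc)
  then obtain U where U: "\<And>n. norm (lborel_conv (dilate (real (Suc n)) k) f (U n) - f (U n)) > e"
    by metis
  have [measurable]: "f \<in> borel_measurable borel"
    by (intro borel_measurable_continuous_onI uniformly_continuous_imp_continuous f(1))
  have "(\<lambda>n. LINT s|lborel. k s * (f (U n - s / real (Suc n)) - f (U n))) \<longlonglongrightarrow> (LINT s|lborel. k s * 0)"
  proof (rule tendsto_LINT_mult_bounded[OF k(1)])
    show "norm (f (U n - s / real (Suc n)) - f (U n)) \<le> 2 * B" for n s
      using norm_triangle_ineq4[of "f (U n - s / real (Suc n))" "f (U n)"] f(2)[of "U n"]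
          f(2)[of "U n - s / real (Suc n)"]
      by linarith
    show "(\<lambda>n. f (U n - s / real (Suc n)) - f (U n)) \<longlonglongrightarrow> 0" for s
    proof -
      have "(\<lambda>n. dist (U n - s / real (Suc n)) (U n)) \<longlonglongrightarrow> 0"
        using LIMSEQ_Suc[OF lim_const_over_n[of "\<bar>s\<bar>"]] by (simp add: dist_real_def)
      then have "(\<lambda>n. dist (f (U n - s / real (Suc n))) (f (U n))) \<longlonglongrightarrow> 0"
        using f(1) by (simp add: uniformly_continuous_on_sequentially)
      then show ?thesis by (simp add: dist_norm tendsto_norm_zero_iff)
    qed
  qed measurable
  moreover have "(LINT s|lborel. k s * (f (U n - s / real (Suc n)) - f (U n)))
      = lborel_conv (dilate (real (Suc n)) k) f (U n) - f (U n)" for n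
    using k integrable_mult_bounded[OF k(1), of "\<lambda>s. f (U n - s / real (Suc n))" B] f(2)
    by (simp add: lborel_conv_def LINT_dilate_mult right_diff_distrib del: of_nat_Suc)
  ultimately have "(\<lambda>n. norm (lborel_conv (dilate (real (Suc n)) k) f (U n) - f (U n))) \<longlonglongrightarrow> 0"
    by (simp add: tendsto_norm_zero)
  then have "e \<le> 0" using U by (intro LIMSEQ_le_const) (auto intro: less_imp_le)
  then show False using e by simp
qed

section \<open>Functions vanishing at infinity\<close>

lemma C0fun_measurable: "C0fun f \<Longrightarrow> f \<in> borel_measurable borel"
  by (simp add: C0fun_def borel_measurable_continuous_onI)

lemma C0fun_zero: "C0fun (\<lambda>_. 0)"
  by (simp add: C0fun_def)

lemma C0fun_diff: "C0fun f \<Longrightarrow> C0fun g \<Longrightarrow> C0fun (\<lambda>t. f t - g t)"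
  unfolding C0fun_def using tendsto_diff[of f 0 at_infinity g 0] by (auto intro!: continuous_intros)

lemma C0fun_small_outside:
  assumes "C0fun f" "e > 0"
  obtains R where "\<And>t. R \<le> \<bar>t\<bar> \<Longrightarrow> norm (f t) < e"
proof -
  have "\<forall>\<^sub>F t in at_infinity. norm (f t) < e"
    using assms by (intro order_tendstoD(2)[where y = 0]) (auto simp: C0fun_def intro!: tendsto_norm_zero)
  then show thesis using that by (auto simp: eventually_at_infinity)
qed

lemma C0fun_bounded:
  assumes "C0fun f"
  shows "bounded (range f)"
proof -
  obtain R where R: "\<And>t. R \<le> \<bar>t\<bar> \<Longrightarrow> norm (f t) < 1"
    using C0fun_small_outside[OF assms, of 1] by auto
  have "compact (f ` {-R..R})"
    using assms by (intro compact_continuous_image) (auto simp: C0fun_def intro: continuous_on_subset)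
  then have "bounded (f ` {-R..R} \<union> cball 0 1)"
    by (simp add: compact_imp_bounded)
  moreover have "f t \<in> f ` {-R..R} \<union> cball 0 1" for t
  proof (cases "R \<le> \<bar>t\<bar>")
    case False
    then have "t \<in> {-R..R}" by auto
    then show ?thesis by blast
  qed (use R[of t] in auto)
  ultimately show ?thesis by (meson bounded_subset image_subsetI)
qed

lemma norm_le_supnorm: "C0fun f \<Longrightarrow> norm (f t) \<le> supnorm f"
  unfolding supnorm_def using C0fun_bounded[of f]
  by (intro cSUP_upper) (auto simp: bounded_iff intro: bdd_aboveI)

lemma supnorm_nonneg: "C0fun f \<Longrightarrow> 0 \<le> supnorm f"
  using norm_le_supnorm[of f 0] norm_ge_zero order_trans by blast

lemma supnorm_le: "(\<And>t. norm (f t) \<le> K) \<Longrightarrow> supnorm f \<le> K"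
  unfolding supnorm_def by (rule cSUP_least) auto

lemma supnorm_zero [simp]: "supnorm (\<lambda>_. 0) = 0"
  by (simp add: supnorm_def)

lemma C0fun_uniformly_continuous:
  assumes f: "C0fun f"
  shows "uniformly_continuous_on UNIV f"
  unfolding uniformly_continuous_on_def
proof (intro allI impI)
  fix e :: real assume e: "e > 0"
  obtain R where R: "\<And>t. R \<le> \<bar>t\<bar> \<Longrightarrow> norm (f t) < e / 2"
    using C0fun_small_outside[OF f, of "e / 2"] e by auto
  define I where "I = {- (R + 1)..R + 1}"
  have "uniformly_continuous_on I f"
    using f by (intro compact_uniformly_continuous) (auto simp: C0fun_def I_def intro: continuous_on_subset)
  then obtain d where d: "d > 0" "\<And>s t. s \<in> I \<Longrightarrow> t \<in> I \<Longrightarrow> dist s t < d \<Longrightarrow> dist (f s) (f t) < e"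
    using e unfolding uniformly_continuous_on_def by metis
  have "dist (f s) (f t) < e" if st: "dist s t < min d 1" for s t
  proof (cases "s \<in> I \<and> t \<in> I")
    case False
    then have "R \<le> \<bar>s\<bar>" "R \<le> \<bar>t\<bar>"
      using st by (auto simp: I_def dist_real_def)
    then have "norm (f s) < e / 2" "norm (f t) < e / 2" using R by blast+
    then show ?thesis using norm_triangle_ineq4[of "f s" "f t"] by (simp add: dist_norm)
  qed (use d(2) st in auto)
  then show "\<exists>d>0. \<forall>t\<in>UNIV. \<forall>s\<in>UNIV. dist s t < d \<longrightarrow> dist (f s) (f t) < e"
    using d(1) by (intro exI[of _ "min d 1"]) auto
qed

lemma C0fun_cutoff:
  assumes f: "C0fun f" and e: "e > 0"
  shows "\<exists>g. C0fun g \<and> integrable lborel g \<and> (\<forall>t. norm (f t - g t) \<le> e)"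
proof -
  obtain R where R: "\<And>t. R \<le> \<bar>t\<bar> \<Longrightarrow> norm (f t) < e"
    using C0fun_small_outside[OF f e] by auto
  define \<eta> where "\<eta> t = max 0 (min 1 (R + 1 - \<bar>t\<bar>))" for t
  have cont: "continuous_on UNIV (\<lambda>t. of_real (\<eta> t) * f t)"
    using f unfolding \<eta>_def C0fun_def by (intro continuous_intros) auto
  have supp: "of_real (\<eta> t) * f t = 0" if "t \<notin> {- (R + 1)..R + 1}" for t
    using that by (auto simp: \<eta>_def)
  have "C0fun (\<lambda>t. of_real (\<eta> t) * f t)"
    unfolding C0fun_def using cont
    by (intro conjI tendsto_eventually eventually_at_infinityI[of "R + 2"] supp) auto
  moreover have "integrable lborel (\<lambda>t. of_real (\<eta> t) * f t)"
  proof -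
    have "set_integrable lborel {- (R + 1)..R + 1} (\<lambda>t. of_real (\<eta> t) * f t)"
      by (intro borel_integrable_atLeastAtMost' continuous_on_subset[OF cont]) auto
    moreover have "indicator {- (R + 1)..R + 1} t *\<^sub>R (of_real (\<eta> t) * f t) = of_real (\<eta> t) * f t" for t
      using supp[of t] by (auto simp: indicator_def)
    ultimately show ?thesis by (simp only: set_integrable_def)
  qed
  moreover have "norm (f t - of_real (\<eta> t) * f t) \<le> e" for t
  proof (cases "R \<le> \<bar>t\<bar>")
    case True
    have "norm (f t - of_real (\<eta> t) * f t) = norm (of_real (1 - \<eta> t) * f t)"
      by (simp add: algebra_simps)
    also have "\<dots> \<le> 1 * norm (f t)"
      unfolding norm_mult norm_of_real by (intro mult_right_mono) (auto simp: \<eta>_def)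
    also have "\<dots> \<le> e" using R[of t] True by simp
    finally show ?thesis .
  qed (use e in \<open>simp add: \<eta>_def\<close>)
  ultimately show ?thesis by blast
qed

lemma tendsto_at_infinityI_sequentially:
  fixes f :: "real \<Rightarrow> 'a::first_countable_topology"
  assumes "\<And>U. filterlim U at_infinity sequentially \<Longrightarrow> (\<lambda>n. f (U n)) \<longlonglongrightarrow> l"
  shows "(f \<longlongrightarrow> l) at_infinity"
  unfolding at_infinity_eq_at_top_bot
  by (intro filterlim_sup tendsto_at_topI_sequentially tendsto_at_botI_sequentially assms)
     (auto intro: filterlim_mono at_top_le_at_infinity at_bot_le_at_infinity)

lemma C0fun_lborel_conv:
  assumes k: "integrable lborel k" and f: "C0fun f"
  shows "C0fun (lborel_conv k f)"
  unfolding C0fun_def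
proof
  note [measurable] = C0fun_measurable[OF f]
  have lim: "(\<lambda>n. lborel_conv k f (U n)) \<longlonglongrightarrow> (LINT s|lborel. k s * v s)"
    if "\<And>s. (\<lambda>n. f (U n - s)) \<longlonglongrightarrow> v s" for U :: "nat \<Rightarrow> real" and v
    unfolding lborel_conv_def
    by (rule tendsto_LINT_mult_bounded[OF k _ norm_le_supnorm[OF f] that]) measurable
  show "continuous_on UNIV (lborel_conv k f)"
  proof (rule continuous_on_sequentiallyI)
    fix U :: "nat \<Rightarrow> real" and u assume "U \<longlonglongrightarrow> u"
    then have "(\<lambda>n. f (U n - s)) \<longlonglongrightarrow> f (u - s)" for s
      using f unfolding C0fun_def
      by (intro continuous_on_tendsto_compose[where s = UNIV and f = f] tendsto_intros) auto
    from lim[OF this] show "(\<lambda>n. lborel_conv k f (U n)) \<longlonglongrightarrow> lborel_conv k f u"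
      by (simp add: lborel_conv_def)
  qed
  show "(lborel_conv k f \<longlongrightarrow> 0) at_infinity"
  proof (rule tendsto_at_infinityI_sequentially)
    fix U :: "nat \<Rightarrow> real" assume U: "filterlim U at_infinity sequentially"
    have "(\<lambda>n. f (U n - s)) \<longlonglongrightarrow> 0" for s
    proof (rule filterlim_compose[of f])
      show "(f \<longlongrightarrow> 0) at_infinity" using f by (simp add: C0fun_def)
      show "filterlim (\<lambda>n. U n - s) at_infinity sequentially"
        using tendsto_add_filterlim_at_infinity'[OF U tendsto_const, of "- s"] by simp
    qed
    from lim[OF this] show "(\<lambda>n. lborel_conv k f (U n)) \<longlonglongrightarrow> 0" by simp
  qed
qed

lemma conv_eq_lborel_conv:
  assumes f: "C0fun f" and h: "integrable lborel h"
  shows "conv f h = lborel_conv h f"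
proof
  fix t
  note [measurable] = C0fun_measurable[OF f]
  have "integrable lborel (\<lambda>s. h s * f (t - s))"
    by (rule integrable_mult_bounded[OF h _ norm_le_supnorm[OF f]]) measurable
  from integral_lborel[OF this] show "conv f h t = lborel_conv h f t"
    by (simp add: conv_def lborel_conv_def mult.commute)
qed

definition fourier_invertible :: "(real \<Rightarrow> complex) \<Rightarrow> bool" where
  "fourier_invertible f \<longleftrightarrow> C0fun f \<and> integrable lborel f \<and> integrable lborel (fourier f)"

lemma fourier_invertibleD:
  assumes "fourier_invertible f"
  shows "C0fun f" "continuous_on UNIV f" "integrable lborel f" "integrable lborel (fourier f)"
  using assms by (auto simp: fourier_invertible_def C0fun_def)

lemma fourier_fourier:
  assumes "fourier_invertible f"
  shows "fourier (fourier f) (- t) = of_real (2 * pi) * f t"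
  using assms norm_le_supnorm by (intro fourier_inversion) (auto dest: fourier_invertibleD)

lemma fourier_invertible_diff:
  assumes "fourier_invertible f" "fourier_invertible g"
  shows "fourier_invertible (\<lambda>t. f t - g t)"
proof -
  have "fourier (\<lambda>t. f t - g t) = (\<lambda>u. fourier f u - fourier g u)"
    using assms by (intro ext fourier_diff) (auto dest: fourier_invertibleD)
  then show ?thesis using assms by (simp add: fourier_invertible_def C0fun_diff)
qed

lemma fourier_invertible_dilate:
  assumes f: "fourier_invertible f" and l: "l > 0"
  shows "fourier_invertible (dilate l f)"
  unfolding fourier_invertible_def
proof (intro conjI)
  note f = fourier_invertibleD[OF f]
  have "filterlim (\<lambda>t. l * t) at_infinity at_infinity"
    by (rule tendsto_mult_filterlim_at_infinity[OF tendsto_const _ filterlim_ident]) (use l in simp)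
  moreover have "(f \<longlongrightarrow> 0) at_infinity" using f(1) by (simp add: C0fun_def)
  ultimately have "((\<lambda>t. f (l * t)) \<longlongrightarrow> 0) at_infinity" by (rule filterlim_compose[rotated])
  then show "C0fun (dilate l f)"
    unfolding C0fun_def dilate_def[abs_def]
    by (intro conjI tendsto_mult_right_zero continuous_intros continuous_on_compose2[OF f(2)]) auto
  show "integrable lborel (dilate l f)" using f(3) l by (rule integrable_dilate)
  show "integrable lborel (fourier (dilate l f))"
    unfolding fourier_dilate[OF f(3) l, THEN ext]
    using integrable_lborel_affine[OF f(4), of "1 / l" 0] l by simp
qed

theorem fourier_invertible_dense:
  assumes f: "C0fun f" and e: "e > 0"
  shows "\<exists>g. fourier_invertible g \<and> (\<forall>t. norm (f t - g t) \<le> e)"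
proof -
  obtain f0 where f0: "C0fun f0" "integrable lborel f0" "\<And>t. norm (f t - f0 t) \<le> e / 2"
    using C0fun_cutoff[OF f, of "e / 2"] e by auto
  obtain l where l: "l > 0" "\<And>u. norm (lborel_conv (dilate l gauss) f0 u - f0 u) \<le> e / 2"
    using lborel_conv_dilate_uniform_approx[OF integrable_gauss LINT_gauss C0fun_uniformly_continuous[OF f0(1)]
        norm_le_supnorm[OF f0(1)], of "e / 2"] e by auto
  define g where "g = lborel_conv (dilate l gauss) f0"
  have k: "integrable lborel (dilate l gauss)" by (rule integrable_dilate[OF integrable_gauss l(1)])
  have "fourier_invertible g"
    unfolding fourier_invertible_def
  proof (intro conjI)
    show "C0fun g" unfolding g_def by (rule C0fun_lborel_conv[OF k f0(1)])
    show "integrable lborel g" unfolding g_def by (rule integrable_lborel_conv[OF k f0(2)])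
    have "fourier g = (\<lambda>u. of_real (sqrt (2 * pi)) * (gauss (u / l) * fourier f0 u))"
      by (rule ext, simp only: g_def fourier_lborel_conv[OF k f0(2)]
          fourier_dilate[OF integrable_gauss l(1)] fourier_gauss)
         (simp add: gauss_eq)
    moreover have "integrable lborel (\<lambda>u. gauss (u / l) * fourier f0 u)"
    proof (rule integrable_mult_bounded)
      show "integrable lborel (\<lambda>u. gauss (u / l))"
        using integrable_lborel_affine[OF integrable_gauss, of "1 / l" 0] l(1) by simp
    qed (use fourier_measurable norm_fourier_le f0(2) in auto)
    ultimately show "integrable lborel (fourier g)" by simp
  qed
  moreover have "norm (f t - g t) \<le> e" for t
    using norm_triangle_ineq[of "f t - f0 t" "f0 t - g t"] f0(3)[of t] l(2)[of t]
    by (simp add: g_def norm_minus_commute)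
  ultimately show ?thesis by blast
qed

text \<open>The function \<open>b\<close> with \<open>(f \<star> h)(t) = \<integral> b(r) e\<^bsup>itr\<^esup> dr\<close>.\<close>

definition conv_symbol :: "(real \<Rightarrow> complex) \<Rightarrow> (real \<Rightarrow> complex) \<Rightarrow> real \<Rightarrow> complex" where
  "conv_symbol f h r = fourier f r * fourier h r / of_real (2 * pi)"

lemma integrable_conv_symbol:
  assumes "fourier_invertible f" "integrable lborel h"
  shows "integrable lborel (conv_symbol f h)"
  unfolding conv_symbol_def
  using integrable_mult_bounded[OF fourier_invertibleD(4)[OF assms(1)] _ norm_fourier_le[OF assms(2)]]
    fourier_measurable[OF assms(2)] by simp

lemma conv_symbol_diff:
  "integrable lborel f \<Longrightarrow> integrable lborel g \<Longrightarrow>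
    conv_symbol (\<lambda>t. f t - g t) h = (\<lambda>r. conv_symbol f h r - conv_symbol g h r)"
  by (simp add: conv_symbol_def fun_eq_iff fourier_diff left_diff_distrib diff_divide_distrib)

lemma lborel_conv_eq_fourier_symbol:
  assumes f: "fourier_invertible f" and h: "integrable lborel h"
  shows "lborel_conv h f t = fourier (conv_symbol f h) (- t)"
proof -
  note f' = fourier_invertibleD[OF f]
  have "f (t - s) = fourier (fourier f) (s - t) / of_real (2 * pi)" for s
    using fourier_fourier[OF f, of "t - s"] by simp
  then have "lborel_conv h f t = (LINT s|lborel. h s * fourier (fourier f) (s - t)) / of_real (2 * pi)"
    by (simp add: lborel_conv_def)
  also have "\<dots> = (LINT s|lborel. h s * fourier (\<lambda>r. fourier f r * cis (t * r)) s) / of_real (2 * pi)"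
    by (simp only: fourier_cis_mult[OF f'(4)])
  also have "\<dots> = (LINT r|lborel. fourier h r * (fourier f r * cis (t * r))) / of_real (2 * pi)"
    by (subst fourier_multiplication_formula[OF h integrable_mult_cis[OF f'(4)]]) auto
  also have "\<dots> = (LINT r|lborel. conv_symbol f h r * cis (- (r * (- t))))"
    by (simp add: conv_symbol_def mult_ac flip: integral_divide_zero)
  finally show ?thesis by (simp add: fourier_eq_LINT[OF integrable_conv_symbol[OF f h]])
qed

lemma norm_lborel_conv_le_of_fourier:
  assumes f: "fourier_invertible f" and h: "integrable lborel h" and e: "\<And>u. norm (fourier h u) \<le> e"
  shows "norm (lborel_conv h f t) \<le> L1norm (fourier f) / (2 * pi) * e"
proof -
  have "norm (lborel_conv h f t) \<le> (LINT r|lborel. norm (conv_symbol f h r))"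
    using norm_fourier_le[OF integrable_conv_symbol[OF f h]]
    by (simp add: lborel_conv_eq_fourier_symbol[OF f h] L1norm_eq_LINT integrable_conv_symbol[OF f h])
  also have "\<dots> \<le> L1norm (fourier f) * e / (2 * pi)"
    using LINT_norm_mult_le[OF fourier_invertibleD(4)[OF f] _ e] h
    by (simp add: conv_symbol_def norm_divide L1norm_eq_LINT[OF fourier_invertibleD(4)[OF f]]
        divide_right_mono fourier_measurable)
  finally show ?thesis by simp
qed

section \<open>Exponentials on the half-line and the Poisson kernel\<close>

lemma integral_FTC_halfline:
  fixes f F :: "real \<Rightarrow> 'a::euclidean_space"
  assumes F: "\<And>t. (F has_vector_derivative f t) (at t)" and f: "\<And>t. isCont f t"
    and int: "set_integrable lborel {0<..} f" and lim: "(F \<longlongrightarrow> 0) at_top"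
  shows "(LINT t:{0<..}|lborel. f t) = - F 0"
proof -
  have einterval_halfline: "einterval (ereal 0) \<infinity> = {0<..}"
    by (auto simp: einterval_def)
  have "isCont F 0" using F[of 0] by (rule has_vector_derivative_continuous)
  then have "(F \<longlongrightarrow> F 0) (at_right 0)"
    unfolding isCont_def by (rule tendsto_within_subset) simp
  then have "(LBINT t=ereal 0..\<infinity>. f t) = 0 - F 0"
    using int lim
    by (intro interval_integral_FTC_integrable)
       (simp_all only: einterval_halfline ereal_tendsto_simps, simp_all add: F f)
  then show ?thesis by (simp add: interval_integral_to_infinity_eq)
qed

lemma set_integrable_power_mult_exp:
  fixes z :: complex
  assumes z: "Re z > 0"
  shows "set_integrable lborel {0<..} (\<lambda>t. of_real t ^ k * exp (- (of_real t * z)))"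
proof -
  have "integrable lborel (erlang_density k (Re z))"
    by (rule integrableI_nonneg)
       (use nn_integral_erlang_ith_moment[OF z, of k 0] z in auto)
  then have "set_integrable lborel {0<..} (\<lambda>t. fact k / Re z ^ Suc k * erlang_density k (Re z) t)"
    unfolding set_integrable_def by (intro integrable_mult_indicator integrable_mult_right) auto
  then show ?thesis
    unfolding set_integrable_def
    by (rule Bochner_Integration.integrable_bound)
       (use z in \<open>auto simp: erlang_density_def indicator_def norm_mult norm_power field_simps\<close>)
qed

theorem integral_power_mult_exp_halfline:
  fixes z :: complex
  assumes z: "Re z > 0"
  shows "(LINT t:{0<..}|lborel. of_real t ^ k * exp (- (of_real t * z))) = fact k / z ^ Suc k"
proof (induction k)
  have z_nonzero: "z \<noteq> 0" using z by auto
  have lim: "((\<lambda>t. of_real t ^ k * exp (- (of_real t * z)) / z) \<longlongrightarrow> 0) at_top" for k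
  proof (rule tendsto_divide_zero[OF tendsto_norm_zero_cancel])
    have "((\<lambda>t. \<bar>t\<bar> ^ k * exp (- (t * Re z))) \<longlongrightarrow> 0) at_top"
      using z by real_asymp
    then show "((\<lambda>t. norm (of_real t ^ k * exp (- (of_real t * z)))) \<longlongrightarrow> 0) at_top"
      by (simp add: norm_mult norm_power)
  qed
  note int = set_integrable_power_mult_exp[OF z]
  {
    case 0
    have "(LINT t:{0<..}|lborel. exp (- (of_real t * z))) = - (- (exp (- (of_real 0 * z)) / z))"
    proof (rule integral_FTC_halfline)
      show "((\<lambda>t. - (exp (- (of_real t * z)) / z)) has_vector_derivative exp (- (of_real t * z))) (at t)" for t
        using z_nonzero by (auto intro!: derivative_eq_intros has_vector_derivative_real_field simp: field_simps)
    qed (use int[of 0] tendsto_minus[OF lim[of 0]] in \<open>auto intro!: continuous_intros\<close>)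
    then show ?case by simp
  next
    case (Suc k)
    have "(LINT t:{0<..}|lborel. of_real t ^ Suc k * exp (- (of_real t * z))
          - of_nat (Suc k) / z * (of_real t ^ k * exp (- (of_real t * z))))
        = - (- (of_real 0 ^ Suc k * exp (- (of_real 0 * z)) / z))"
    proof (rule integral_FTC_halfline)
      show "((\<lambda>t. - (of_real t ^ Suc k * exp (- (of_real t * z)) / z)) has_vector_derivative
          of_real t ^ Suc k * exp (- (of_real t * z))
              - of_nat (Suc k) / z * (of_real t ^ k * exp (- (of_real t * z)))) (at t)" for t
        by (rule has_vector_derivative_real_field, (rule derivative_eq_intros refl z_nonzero)+)
           (use z_nonzero in \<open>simp add: field_simps\<close>)
    qed (use int[of "Suc k"] int[of k] tendsto_minus[OF lim[of "Suc k"]] z_nonzero in \<open>auto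
        intro!: continuous_intros set_integral_diff\<close>)
    then show ?case
      using int[of "Suc k"] int[of k] Suc z_nonzero by (simp add: set_integral_diff)
  }
qed

lemma LINT_split_halflines:
  fixes f :: "real \<Rightarrow> 'a::{banach,second_countable_topology}"
  assumes f[measurable]: "f \<in> borel_measurable borel"
    and int: "set_integrable lborel {0<..} f" "set_integrable lborel {0<..} (\<lambda>t. f (- t))"
  shows "integrable lborel f"
    and "(LINT t|lborel. f t) = (LINT t:{0<..}|lborel. f t) + (LINT t:{0<..}|lborel. f (- t))"
proof -
  define p where "p t = indicator {0<..} t *\<^sub>R f t" for t
  define q where "q t = indicator {0<..} (- t) *\<^sub>R f t" for t
  have p: "integrable lborel p" "(LINT t|lborel. p t) = (LINT t:{0<..}|lborel. f t)"
    using int(1) by (simp_all add: p_def[abs_def] set_integrable_def set_lebesgue_integral_def)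
  have q: "integrable lborel q" "(LINT t|lborel. q t) = (LINT t:{0<..}|lborel. f (- t))"
    using int(2) integrable_lborel_affine[of "\<lambda>t. indicator {0<..} t *\<^sub>R f (- t)" "-1" 0]
      LINT_lborel_affine[of "-1" "\<lambda>t. indicator {0<..} t *\<^sub>R f (- t)" 0]
    by (simp_all add: q_def[abs_def] set_integrable_def set_lebesgue_integral_def)
  have AE_eq: "AE t in lborel. p t + q t = f t"
    using AE_lborel_singleton[of "0::real"] by eventually_elim (auto simp: p_def q_def indicator_def)
  have meas: "(\<lambda>t. p t + q t) \<in> borel_measurable lborel" "f \<in> borel_measurable lborel"
    using p q f by auto
  show "integrable lborel f"
    "(LINT t|lborel. f t) = (LINT t:{0<..}|lborel. f t) + (LINT t:{0<..}|lborel. f (- t))"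
    using integrable_cong_AE[OF meas AE_eq] integral_cong_AE[OF meas AE_eq] p q by simp_all
qed

definition poisson_kernel :: "real \<Rightarrow> real \<Rightarrow> real" where
  "poisson_kernel a s = a / (pi * (s\<^sup>2 + a\<^sup>2))"

lemma poisson_kernel_nonneg: "a > 0 \<Longrightarrow> 0 \<le> poisson_kernel a s"
  by (simp add: poisson_kernel_def)

lemma integrable_inverse_sum_squares:
  assumes "a > 0"
  shows "integrable lborel (\<lambda>u :: real. 1 / (u\<^sup>2 + a\<^sup>2))"
proof -
  have "integrable lborel (\<lambda>x :: real. inverse (1 + x\<^sup>2))"
    using integrable_inverse_1_plus_square by (simp add: set_integrable_def einterval_def)
  from integrable_lborel_affine[OF this, of "1 / a" 0]
  have "integrable lborel (\<lambda>x :: real. (1 / a\<^sup>2) * inverse (1 + (x / a)\<^sup>2))"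
    using assms by simp
  moreover have "(1 / a\<^sup>2) * inverse (1 + (x / a)\<^sup>2) = 1 / (x\<^sup>2 + a\<^sup>2)" for x
    using assms by (simp add: field_simps power_divide)
  ultimately show ?thesis by simp
qed

lemma integrable_poisson_kernel:
  assumes "a > 0"
  shows "integrable lborel (poisson_kernel a)"
  using integrable_mult_right[OF integrable_inverse_sum_squares[OF assms], of "a / pi"]
  by (simp add: poisson_kernel_def[abs_def])

lemma fourier_exp_abs:
  assumes a: "a > 0"
  defines "g \<equiv> (\<lambda>t. complex_of_real (exp (- a * \<bar>t\<bar>)))"
  shows "integrable lborel g" and "fourier g u = of_real (2 * pi * poisson_kernel a u)"
proof -
  have halfline: "g t * cis (v * t) = exp (- (of_real t * Complex a (- v)))" if "t \<in> {0<..}" for t v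
    using that by (simp add: g_def exp_eq_polar mult.commute)
  have g_minus: "g (- t) = g t" for t by (simp add: g_def)
  have int: "set_integrable lborel {0<..} (\<lambda>t. g t * cis (v * t))"
    and LINT: "(LINT t:{0<..}|lborel. g t * cis (v * t)) = 1 / Complex a (- v)" for v
  proof -
    show "set_integrable lborel {0<..} (\<lambda>t. g t * cis (v * t))"
      using set_integrable_power_mult_exp[of "Complex a (- v)" 0] a
      by (subst set_integrable_cong[OF refl refl halfline]) auto
    show "(LINT t:{0<..}|lborel. g t * cis (v * t)) = 1 / Complex a (- v)"
      using integral_power_mult_exp_halfline[of "Complex a (- v)" 0] a
      by (subst set_lebesgue_integral_cong[where g = "\<lambda>t. exp (- (of_real t * Complex a (- v)))"])
         (auto simp: halfline)
  qed
  have [measurable]: "g \<in> borel_measurable borel" unfolding g_def by measurable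
  show g: "integrable lborel g"
    using LINT_split_halflines(1)[of g] int[of 0] by (simp add: g_minus)
  have "fourier g u = 1 / Complex a u + 1 / Complex a (- u)"
    using LINT_split_halflines(2)[of "\<lambda>t. g t * cis (- (t * u))"] int[of u] int[of "- u"]
        LINT[of u] LINT[of "- u"]
    by (simp add: fourier_eq_LINT[OF g] g_minus mult.commute)
  also have "\<dots> = of_real (2 * a) / of_real (u\<^sup>2 + a\<^sup>2)"
  proof -
    have "Complex a u \<noteq> 0" "Complex a (- u) \<noteq> 0" using a by (auto simp: complex_eq_iff)
    then have "1 / Complex a u + 1 / Complex a (- u)
        = (Complex a (- u) + Complex a u) / (Complex a u * Complex a (- u))"
      by (simp add: field_simps)
    also have "\<dots> = of_real (2 * a) / of_real (u\<^sup>2 + a\<^sup>2)"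
      by (intro arg_cong2[of _ _ _ _ "(/)"]) (auto simp: complex_eq_iff power2_eq_square)
    finally show ?thesis .
  qed
  also have "\<dots> = of_real (2 * pi * poisson_kernel a u)"
    unfolding poisson_kernel_def of_real_divide[symmetric] by (rule arg_cong[of _ _ of_real]) simp
  finally show "fourier g u = of_real (2 * pi * poisson_kernel a u)" .
qed

lemma fourier_poisson_kernel:
  assumes a: "a > 0"
  shows "fourier (\<lambda>s. of_real (poisson_kernel a s)) t = of_real (exp (- a * \<bar>t\<bar>))"
proof -
  define g where "g = (\<lambda>t. complex_of_real (exp (- a * \<bar>t\<bar>)))"
  have P: "integrable lborel (\<lambda>s. complex_of_real (poisson_kernel a s))"
    using integrable_poisson_kernel[OF a] by (rule integrable_of_real)
  have Fg: "fourier g = (\<lambda>u. of_real (2 * pi) * of_real (poisson_kernel a u))"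
    using fourier_exp_abs(2)[OF a] by (auto simp: g_def)
  have "fourier (fourier g) (- (- t)) = of_real (2 * pi) * g (- t)"
  proof (rule fourier_inversion)
    show "continuous_on UNIV g" unfolding g_def by (intro continuous_intros)
    show "norm (g t) \<le> 1" for t using a by (simp add: g_def)
    show "integrable lborel g" unfolding g_def by (rule fourier_exp_abs(1)[OF a])
    show "integrable lborel (fourier g)" unfolding Fg using P by (rule integrable_mult_right)
  qed
  moreover have "fourier (fourier g) t = of_real (2 * pi) * fourier (\<lambda>s. of_real (poisson_kernel a s)) t"
    using P unfolding Fg by (simp add: fourier_eq_LINT mult.assoc)
  ultimately show ?thesis by (simp add: g_def)
qed

lemma LINT_poisson_kernel:
  assumes "a > 0"
  shows "(LINT s|lborel. poisson_kernel a s) = 1"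
proof -
  have "complex_of_real (LINT s|lborel. poisson_kernel a s) = fourier (\<lambda>s. of_real (poisson_kernel a s)) 0"
    using integrable_poisson_kernel[OF assms]
    by (subst fourier_eq_LINT) (auto simp: integral_complex_of_real intro: integrable_of_real)
  then show ?thesis by (simp add: fourier_poisson_kernel[OF assms])
qed

text \<open>The density of the Gamma distribution with shape 2 and rate 1: its dilates form an approximate identity
  supported on the half-line, and its Fourier transform is integrable.\<close>

definition gamma2 :: "real \<Rightarrow> complex" where
  "gamma2 t = of_real (max 0 t * exp (- max 0 t))"

lemma gamma2_neg: "t < 0 \<Longrightarrow> gamma2 t = 0"
  by (simp add: gamma2_def)

lemma gamma2_mult_cis:
  "gamma2 t * cis (- (t * u)) = indicator {0<..} t *\<^sub>R (of_real t ^ 1 * exp (- (of_real t * Complex 1 u)))"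
  by (simp add: gamma2_def indicator_def max_def exp_eq_polar)

lemma integrable_gamma2: "integrable lborel gamma2"
  using set_integrable_power_mult_exp[of "Complex 1 0" 1]
  by (simp add: set_integrable_def flip: gamma2_mult_cis[of _ 0, simplified])

lemma fourier_gamma2: "fourier gamma2 u = 1 / (Complex 1 u)\<^sup>2"
  using integral_power_mult_exp_halfline[of "Complex 1 u" 1]
  by (simp add: fourier_eq_LINT[OF integrable_gamma2] gamma2_mult_cis set_lebesgue_integral_def numeral_2_eq_2
      del: power_one_right)

lemma LINT_gamma2: "(LINT t|lborel. gamma2 t) = 1"
  using fourier_gamma2[of 0] by (simp add: fourier_eq_LINT[OF integrable_gamma2] Complex_eq)

lemma fourier_invertible_gamma2: "fourier_invertible gamma2"
  unfolding fourier_invertible_def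
proof (intro conjI integrable_gamma2)
  have "((\<lambda>t. t * exp (- t)) \<longlongrightarrow> 0) (at_top :: real filter)" by real_asymp
  then have "(gamma2 \<longlongrightarrow> of_real 0) at_top"
    unfolding gamma2_def
    by (intro tendsto_of_real) (erule Lim_transform_eventually, auto intro: eventually_at_top_linorderI[of 0])
  moreover have "(gamma2 \<longlongrightarrow> 0) at_bot"
    by (rule tendsto_eventually) (auto simp: gamma2_neg intro: eventually_at_bot_linorderI[of "-1"])
  ultimately show "C0fun gamma2"
    unfolding C0fun_def at_infinity_eq_at_top_bot gamma2_def
    by (auto intro!: filterlim_sup continuous_intros)
  show "integrable lborel (fourier gamma2)"
  proof (rule Bochner_Integration.integrable_bound)
    show "integrable lborel (\<lambda>u :: real. 1 / (u\<^sup>2 + 1\<^sup>2))" by (rule integrable_inverse_sum_squares) simp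
    show "AE u in lborel. norm (fourier gamma2 u) \<le> norm (1 / (u\<^sup>2 + 1\<^sup>2))"
      by (intro AE_I2) (simp add: fourier_gamma2 norm_divide norm_power cmod_power2 add.commute)
  qed (use fourier_measurable[OF integrable_gamma2] in simp)
qed

section \<open>Laplace transforms and Poisson extensions\<close>

definition L1_halfline :: "(real \<Rightarrow> complex) set" where
  "L1_halfline = {b. integrable lborel b \<and> (\<forall>t<0. b t = 0)}"

lemma L1_halflineD:
  assumes "b \<in> L1_halfline"
  shows "integrable lborel b" "t < 0 \<Longrightarrow> b t = 0"
  using assms by (auto simp: L1_halfline_def)

lemma L1_halfline_zero: "(\<lambda>_. 0) \<in> L1_halfline"
  by (simp add: L1_halfline_def)

lemma L1_halfline_add: "a \<in> L1_halfline \<Longrightarrow> b \<in> L1_halfline \<Longrightarrow> (\<lambda>t. a t + b t) \<in> L1_halfline"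
  by (simp add: L1_halfline_def)

lemma L1_halfline_cmult: "b \<in> L1_halfline \<Longrightarrow> (\<lambda>t. c * b t) \<in> L1_halfline"
  by (simp add: L1_halfline_def)

lemma L1_halfline_lborel_conv:
  assumes ab: "a \<in> L1_halfline" "b \<in> L1_halfline"
  shows "lborel_conv a b \<in> L1_halfline"
proof -
  have "lborel_conv a b r = 0" if "r < 0" for r
  proof -
    have "a s * b (r - s) = 0" for s using that ab by (cases "s < 0") (auto simp: L1_halflineD)
    then show ?thesis unfolding lborel_conv_def by (simp only: integral_zero)
  qed
  then show ?thesis using ab by (simp add: L1_halfline_def integrable_lborel_conv)
qed

text \<open>Truncation at \<open>0\<close> keeps the kernel bounded on the whole line.\<close>

definition laplace_kernel :: "complex \<Rightarrow> real \<Rightarrow> complex" where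
  "laplace_kernel z t = exp (- (of_real (max 0 t) * z))"

lemma laplace_kernel_measurable [measurable]: "laplace_kernel z \<in> borel_measurable borel"
  unfolding laplace_kernel_def by measurable

lemma norm_laplace_kernel_le: "0 \<le> Re z \<Longrightarrow> norm (laplace_kernel z t) \<le> 1"
  by (simp add: laplace_kernel_def)

lemma laplace_kernel_zero [simp]: "laplace_kernel 0 t = 1"
  by (simp add: laplace_kernel_def)

lemma laplace_kernel_add: "0 \<le> s \<Longrightarrow> 0 \<le> t \<Longrightarrow> laplace_kernel z (s + t) = laplace_kernel z s * laplace_kernel z t"
  by (simp add: laplace_kernel_def mult_exp_exp algebra_simps)

lemma laplace_kernel_tendsto: "z \<longlonglongrightarrow> w \<Longrightarrow> (\<lambda>n. laplace_kernel (z n) t) \<longlonglongrightarrow> laplace_kernel w t"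
  unfolding laplace_kernel_def by (intro tendsto_intros)

lemma integrable_mult_laplace_kernel:
  "integrable lborel b \<Longrightarrow> 0 \<le> Re z \<Longrightarrow> integrable lborel (\<lambda>t. b t * laplace_kernel z t)"
  by (rule integrable_mult_bounded[OF _ _ norm_laplace_kernel_le]) auto

lemma laplace_eq_LINT:
  assumes b: "b \<in> L1_halfline" and z: "0 < Re z"
  shows "laplace b z = (LINT t|lborel. b t * laplace_kernel z t)"
proof -
  have "laplace b z = integral UNIV (\<lambda>t. if t \<in> {0..} then exp (- (of_real t * z)) * b t else 0)"
    using z by (simp only: laplace_def if_True integral_restrict_UNIV)
  also have "(\<lambda>t. if t \<in> {0..} then exp (- (of_real t * z)) * b t else 0) = (\<lambda>t. b t * laplace_kernel z t)"
    using b by (auto simp: L1_halfline_def laplace_kernel_def fun_eq_iff max_def)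
  also have "integral UNIV \<dots> = (LINT t|lborel. b t * laplace_kernel z t)"
    using b z by (intro integral_lborel integrable_mult_laplace_kernel) (auto dest: L1_halflineD)
  finally show ?thesis .
qed

lemma laplace_add:
  assumes "a \<in> L1_halfline" "b \<in> L1_halfline" "0 < Re z"
  shows "laplace (\<lambda>t. a t + b t) z = laplace a z + laplace b z"
  using assms
  by (simp add: laplace_eq_LINT L1_halfline_add distrib_right integrable_mult_laplace_kernel L1_halflineD)

lemma laplace_cmult:
  assumes "b \<in> L1_halfline" "0 < Re z"
  shows "laplace (\<lambda>t. c * b t) z = c * laplace b z"
  using assms by (simp add: laplace_eq_LINT L1_halfline_cmult mult.assoc)

lemma laplace_lborel_conv:
  assumes a: "a \<in> L1_halfline" and b: "b \<in> L1_halfline" and z: "0 < Re z"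
  shows "laplace (lborel_conv a b) z = laplace a z * laplace b z"
proof -
  have "laplace (lborel_conv a b) z = (LINT s|lborel. LINT v|lborel. a s * b v * laplace_kernel z (v + s))"
    unfolding laplace_eq_LINT[OF L1_halfline_lborel_conv[OF a b] z]
    by (rule LINT_lborel_conv_mult[OF L1_halflineD(1)[OF a] L1_halflineD(1)[OF b] _ norm_laplace_kernel_le])
       (use z in auto)
  also have "\<dots> = (LINT s|lborel. LINT v|lborel. a s * laplace_kernel z s * (b v * laplace_kernel z v))"
  proof (intro Bochner_Integration.integral_cong refl)
    fix s v
    show "a s * b v * laplace_kernel z (v + s) = a s * laplace_kernel z s * (b v * laplace_kernel z v)"
      using a b by (cases "s < 0 \<or> v < 0") (auto simp: L1_halflineD laplace_kernel_add)
  qed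
  also have "\<dots> = laplace a z * laplace b z"
    by (simp add: laplace_eq_LINT[OF a z] laplace_eq_LINT[OF b z])
  finally show ?thesis .
qed

lemma norm_laplace_le:
  assumes b: "b \<in> L1_halfline"
  shows "norm (laplace b z) \<le> L1norm b"
proof (cases "0 < Re z")
  case True
  have "norm (LINT t|lborel. b t * laplace_kernel z t) \<le> (LINT t|lborel. norm (b t)) * 1"
    using True by (intro norm_LINT_mult_le norm_laplace_kernel_le L1_halflineD(1)[OF b]) auto
  then show ?thesis using laplace_eq_LINT[OF b True] by (simp add: L1norm_eq_LINT L1_halflineD[OF b])
qed (simp add: laplace_def L1norm_nonneg)

lemma norm_fourier_le_of_laplace:
  assumes b: "b \<in> L1_halfline" and e: "\<And>z. 0 < Re z \<Longrightarrow> norm (laplace b z) \<le> e"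
  shows "norm (fourier b u) \<le> e"
proof -
  define z where "z n = of_real (1 / real (Suc n)) + \<i> * of_real u" for n
  have "z \<longlonglongrightarrow> of_real 0 + \<i> * of_real u"
    unfolding z_def by (intro tendsto_intros LIMSEQ_Suc[OF lim_const_over_n])
  then have z: "z \<longlonglongrightarrow> \<i> * of_real u" by simp
  have "(\<lambda>n. LINT t|lborel. b t * laplace_kernel (z n) t)
      \<longlonglongrightarrow> (LINT t|lborel. b t * laplace_kernel (\<i> * of_real u) t)"
    by (rule tendsto_LINT_mult_bounded[OF L1_halflineD(1)[OF b] _ _ laplace_kernel_tendsto[OF z], where B = 1])
       (auto simp: z_def intro!: norm_laplace_kernel_le)
  moreover have "b t * laplace_kernel (\<i> * of_real u) t = b t * cis (- (t * u))" for t
    using b by (cases "t < 0") (auto simp: L1_halflineD laplace_kernel_def cis_conv_exp max_def mult_ac)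
  ultimately have "(\<lambda>n. laplace b (z n)) \<longlonglongrightarrow> fourier b u"
    using b by (simp add: laplace_eq_LINT z_def fourier_eq_LINT L1_halflineD)
  from tendsto_norm[OF this] show ?thesis
    by (rule LIMSEQ_le_const2) (auto simp: z_def intro!: e)
qed

lemma tildeF_eq_LINT:
  assumes G[measurable]: "G \<in> borel_measurable borel" and K: "\<And>t. norm (G t) \<le> K" and z: "0 < Re z"
  shows "integrable lborel (\<lambda>t. of_real (poisson_kernel (Re z) (- Im z - t)) * G t)"
    and "tildeF G z = (LINT t|lborel. of_real (poisson_kernel (Re z) (- Im z - t)) * G t)"
proof -
  have "integrable lborel (\<lambda>t. poisson_kernel (Re z) (- Im z - t))"
    using integrable_lborel_affine[OF integrable_poisson_kernel[OF z], of "-1" "- Im z"]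
    by (simp add: minus_diff_commute)
  then show int: "integrable lborel (\<lambda>t. of_real (poisson_kernel (Re z) (- Im z - t)) * G t)"
    by (intro integrable_mult_bounded[where B = K] integrable_of_real) (use K in auto)
  have "tildeF G z = integral UNIV (\<lambda>t. of_real (poisson_kernel (Re z) (- Im z - t)) * G t)"
    using z by (simp add: tildeF_def poisson_def poisson_kernel_def)
  then show "tildeF G z = (LINT t|lborel. of_real (poisson_kernel (Re z) (- Im z - t)) * G t)"
    using integral_lborel[OF int] by simp
qed

lemma tildeF_add:
  assumes G: "G \<in> borel_measurable borel" "\<And>t. norm (G t) \<le> K"
    and H: "H \<in> borel_measurable borel" "\<And>t. norm (H t) \<le> L"
  shows "tildeF (\<lambda>t. G t + H t) = (\<lambda>z. tildeF G z + tildeF H z)"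
proof
  fix z
  show "tildeF (\<lambda>t. G t + H t) z = tildeF G z + tildeF H z"
  proof (cases "0 < Re z")
    case True
    have GH: "(\<lambda>t. G t + H t) \<in> borel_measurable borel" "\<And>t. norm (G t + H t) \<le> K + L"
      using G H by (auto intro: order_trans[OF norm_triangle_ineq add_mono])
    show ?thesis
      unfolding tildeF_eq_LINT(2)[OF G True] tildeF_eq_LINT(2)[OF H True] tildeF_eq_LINT(2)[OF GH True]
      using tildeF_eq_LINT(1)[OF G True] tildeF_eq_LINT(1)[OF H True] by (simp add: distrib_left)
  qed (simp add: tildeF_def)
qed

lemma norm_tildeF_le:
  assumes G: "G \<in> borel_measurable borel" "\<And>t. norm (G t) \<le> K"
  shows "norm (tildeF G z) \<le> K"
proof (cases "0 < Re z")
  case True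
  let ?P = "\<lambda>t. poisson_kernel (Re z) (- Im z - t)"
  have P: "integrable lborel ?P" "(LINT t|lborel. ?P t) = 1"
    using integrable_lborel_affine[OF integrable_poisson_kernel[OF True], of "-1" "- Im z"]
      LINT_lborel_affine[of "-1" "poisson_kernel (Re z)" "- Im z"] LINT_poisson_kernel[OF True]
    by (simp_all add: minus_diff_commute)
  have "norm (tildeF G z) \<le> (LINT t|lborel. norm (complex_of_real (?P t))) * K"
    unfolding tildeF_eq_LINT(2)[OF G True]
    by (rule norm_LINT_mult_le) (use P G in \<open>auto intro: integrable_of_real\<close>)
  then show ?thesis using P poisson_kernel_nonneg[OF True] by simp
next
  case False
  have "0 \<le> K" using norm_ge_zero[of "G 0"] G(2)[of 0] by linarith
  then show ?thesis using False by (simp add: tildeF_def)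
qed

theorem tildeF_fourier:
  assumes b: "b \<in> L1_halfline"
  shows "tildeF (\<lambda>u. fourier b (- u)) = laplace b"
proof
  fix z
  show "tildeF (\<lambda>u. fourier b (- u)) z = laplace b z"
  proof (cases "0 < Re z")
    case True
    note bi = L1_halflineD(1)[OF b]
    let ?P = "\<lambda>s. complex_of_real (poisson_kernel (Re z) s)"
    have P: "integrable lborel ?P" using integrable_poisson_kernel[OF True] by (rule integrable_of_real)
    have P_shift: "integrable lborel (\<lambda>s. ?P (1 * s + - Im z))" by (rule integrable_lborel_affine[OF P]) simp
    have "tildeF (\<lambda>u. fourier b (- u)) z = (LINT t|lborel. ?P (- Im z - t) * fourier b (- t))"
      using fourier_measurable[OF bi] norm_fourier_le[OF bi] by (intro tildeF_eq_LINT(2)[OF _ _ True]) auto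
    also have "\<dots> = (LINT t|lborel. ?P (1 * t + - Im z) * fourier b t)"
      using LINT_lborel_affine[of "-1" "\<lambda>t. ?P (1 * t + - Im z) * fourier b t" 0]
      by (simp add: minus_diff_commute)
    also have "\<dots> = (LINT t|lborel. fourier (\<lambda>s. ?P (1 * s + - Im z)) t * b t)"
      by (rule fourier_multiplication_formula[OF P_shift bi])
    also have "\<dots> = (LINT t|lborel. b t * laplace_kernel z t)"
    proof (rule Bochner_Integration.integral_cong[OF refl])
      fix t
      have "fourier (\<lambda>s. ?P (1 * s + - Im z)) t = cis (- Im z * t) * of_real (exp (- Re z * \<bar>t\<bar>))"
        by (subst fourier_affine[OF P]) (auto simp: fourier_poisson_kernel[OF True])
      also have "\<dots> = laplace_kernel z t" if "t \<ge> 0"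
        using that by (simp add: laplace_kernel_def exp_eq_polar mult_ac)
      finally show "fourier (\<lambda>s. ?P (1 * s + - Im z)) t * b t = b t * laplace_kernel z t"
        using b by (cases "t \<ge> 0") (auto simp: L1_halflineD)
    qed
    finally show ?thesis using laplace_eq_LINT[OF b True] by simp
  qed (simp add: tildeF_def laplace_def)
qed

section \<open>The spaces \<open>H\<^sup>1\<close> and \<open>\<A>\<^sub>0\<close>\<close>

lemma borel_representative:
  fixes h :: "real \<Rightarrow> complex"
  assumes "h absolutely_integrable_on UNIV"
  shows "\<exists>h'. integrable lborel h' \<and> negligible {t. h t \<noteq> h' t}"
proof -
  have h: "integrable lebesgue h" using assms by (simp add: set_integrable_def)
  then have h_measurable: "h \<in> borel_measurable lebesgue" by (rule borel_measurable_integrable)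
  have "(\<lambda>t. Re (h t)) \<in> borel_measurable lebesgue" "(\<lambda>t. Im (h t)) \<in> borel_measurable lebesgue"
    using h_measurable by measurable
  then obtain r i where ri[measurable]: "r \<in> borel_measurable lborel" "i \<in> borel_measurable lborel"
    and AE_eq: "AE t in lborel. Re (h t) = r t" "AE t in lborel. Im (h t) = i t"
    using completion_ex_borel_measurable_real by metis
  define h' where "h' t = of_real (r t) + \<i> * of_real (i t)" for t
  have h'_measurable: "h' \<in> borel_measurable lborel" unfolding h'_def by measurable
  have "AE t in lborel. h t = h' t"
    using AE_eq by eventually_elim (simp add: h'_def complex_eq_iff)
  then have AE_lebesgue: "AE t in lebesgue. h t = h' t" by (rule AE_completion)
  have "integrable lebesgue h'"
    using integrable_cong_AE[OF h_measurable measurable_completion[OF h'_measurable] AE_lebesgue] h by simp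
  then have "integrable lborel h'" using integrable_completion[OF h'_measurable] by simp
  moreover obtain N where "N \<in> null_sets lebesgue" "{t. h t \<noteq> h' t} \<subseteq> N"
    using AE_lebesgue unfolding eventually_ae_filter by auto
  then have "negligible {t. h t \<noteq> h' t}"
    using negligible_iff_null_sets negligible_subset by blast
  ultimately show ?thesis by blast
qed

lemma absolutely_integrable_on_lborel:
  fixes b :: "'a::euclidean_space \<Rightarrow> 'b::euclidean_space"
  assumes "integrable lborel b" "S \<in> sets lebesgue"
  shows "b absolutely_integrable_on S"
  using assms integrable_completion[of b lborel] borel_measurable_integrable[OF assms(1)]
  unfolding set_integrable_def by (intro integrable_mult_indicator) auto

lemma L1_halfline_representative:
  fixes b :: "real \<Rightarrow> complex"
  assumes "b absolutely_integrable_on {0..}"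
  obtains b' where "b' \<in> L1_halfline" "laplace b = laplace b'" "negligible {t \<in> {0..}. b t \<noteq> b' t}"
proof -
  have "(\<lambda>t. if t \<in> {0..} then b t else 0) absolutely_integrable_on UNIV"
    using assms by (simp only: absolutely_integrable_restrict_UNIV)
  then obtain b0 where b0: "integrable lborel b0" "negligible {t. (if t \<in> {0..} then b t else 0) \<noteq> b0 t}"
    using borel_representative by blast
  define b' where "b' t = indicator {0..} t *\<^sub>R b0 t" for t
  have neg: "negligible {t \<in> {0..}. b t \<noteq> b' t}"
    by (rule negligible_subset[OF b0(2)]) (auto simp: b'_def)
  show thesis
  proof (rule that[OF _ _ neg])
    show "b' \<in> L1_halfline"
      unfolding L1_halfline_def b'_def using b0 by (auto intro!: integrable_mult_indicator)
    have "integral {0..} (\<lambda>t. exp (- (complex_of_real t * z)) * b t)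
        = integral {0..} (\<lambda>t. exp (- (complex_of_real t * z)) * b' t)" for z
      by (rule integral_spike[OF neg]) auto
    then show "laplace b = laplace b'" by (simp add: laplace_def fun_eq_iff)
  qed
qed

lemma H1fun_representative:
  assumes "H1fun h"
  obtains h' where "H1fun h'" "integrable lborel h'" "fourier h' = fourier h" "L1norm h' = L1norm h"
    "\<And>f. conv f h' = conv f h"
proof -
  obtain h' where h': "integrable lborel h'" and N: "negligible {t. h t \<noteq> h' t}"
    using borel_representative assms by (auto simp: H1fun_def)
  have spike: "integral UNIV (\<lambda>s. \<phi> s (h' s)) = integral UNIV (\<lambda>s. \<phi> s (h s))"
      for \<phi> :: "real \<Rightarrow> complex \<Rightarrow> complex"
    by (rule integral_spike[OF N]) auto
  have "integral UNIV (\<lambda>s. norm (h' s)) = integral UNIV (\<lambda>s. norm (h s))"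
    by (rule integral_spike[OF N]) auto
  then have "L1norm h' = L1norm h" by (simp add: L1norm_def)
  moreover have fourier: "fourier h' = fourier h"
    using spike[of "\<lambda>s x. x * exp (- (\<i> * complex_of_real (s * u)))" for u]
    by (simp add: fourier_def fun_eq_iff)
  moreover have "conv f h' = conv f h" for f
    using spike[of "\<lambda>s x. f (t - s) * x" for t] by (simp add: conv_def fun_eq_iff)
  moreover have "H1fun h'"
    using assms fourier absolutely_integrable_on_lborel[OF h', of UNIV] by (simp add: H1fun_def)
  ultimately show thesis using that h' by blast
qed

lemma
  assumes "H1fun h"
  shows norm_fourier_H1fun_le: "norm (fourier h u) \<le> L1norm h"
    and continuous_fourier_H1fun: "continuous_on UNIV (fourier h)"
proof -
  obtain h' where h': "integrable lborel h'" "fourier h' = fourier h" "L1norm h' = L1norm h"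
    using H1fun_representative[OF assms] by metis
  show "norm (fourier h u) \<le> L1norm h" "continuous_on UNIV (fourier h)"
    using norm_fourier_le[OF h'(1), of u] continuous_fourier[OF h'(1)] h'(2,3) by simp_all
qed

lemma conv_zero [simp]: "conv (\<lambda>_. 0) h t = 0"
  by (simp add: conv_def)

lemma
  assumes f: "C0fun f" and h: "H1fun h"
  shows conv_measurable: "conv f h \<in> borel_measurable borel"
    and norm_conv_le: "norm (conv f h t) \<le> supnorm f * L1norm h"
proof -
  note [measurable] = C0fun_measurable[OF f]
  obtain h' where h': "integrable lborel h'" "L1norm h' = L1norm h" "\<And>f. conv f h' = conv f h"
    using H1fun_representative[OF h] by metis
  note eq = conv_eq_lborel_conv[OF f h'(1), unfolded h'(3)]
  have [measurable]: "h' \<in> borel_measurable borel" using h'(1) by (auto dest: borel_measurable_integrable)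
  show "conv f h \<in> borel_measurable borel" unfolding eq lborel_conv_def by measurable
  have "norm (lborel_conv h' f t) \<le> (LINT s|lborel. norm (h' s)) * supnorm f"
    unfolding lborel_conv_def by (rule norm_LINT_mult_le[OF h'(1) _ norm_le_supnorm[OF f]]) measurable
  then show "norm (conv f h t) \<le> supnorm f * L1norm h"
    by (simp add: eq L1norm_eq_LINT[OF h'(1)] mult.commute flip: h'(2))
qed

lemma conv_diff:
  assumes f: "C0fun f" and g: "C0fun g" and h: "H1fun h"
  shows "conv (\<lambda>t. f t - g t) h t = conv f h t - conv g h t"
proof -
  obtain h' where h': "integrable lborel h'" "\<And>f. conv f h' = conv f h"
    using H1fun_representative[OF h] by metis
  have "integrable lborel (\<lambda>s. h' s * f (t - s))" if "C0fun f" for f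
  proof (rule integrable_mult_bounded[OF h'(1) _ norm_le_supnorm[OF that]])
    note [measurable] = C0fun_measurable[OF that]
    show "(\<lambda>s. f (t - s)) \<in> borel_measurable lborel" by measurable
  qed
  then show ?thesis
    using f g
    by (simp add: conv_eq_lborel_conv[OF _ h'(1)] C0fun_diff lborel_conv_def right_diff_distrib flip: h'(2))
qed

lemma conv_symbol_L1_halfline:
  assumes f: "fourier_invertible f" and h: "H1fun h"
  shows "conv_symbol f h \<in> L1_halfline"
proof -
  obtain h' where h': "integrable lborel h'" "fourier h' = fourier h"
    using H1fun_representative[OF h] by metis
  then have "integrable lborel (conv_symbol f h)"
    using integrable_conv_symbol[OF f h'(1)] by (simp add: conv_symbol_def[abs_def])
  then show ?thesis using h by (simp add: L1_halfline_def H1fun_def conv_symbol_def)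
qed

lemma continuous_on_conv_symbol:
  assumes "fourier_invertible f" "H1fun h"
  shows "continuous_on S (conv_symbol f h)"
  unfolding conv_symbol_def
  using continuous_fourier[OF fourier_invertibleD(3)[OF assms(1)]] continuous_fourier_H1fun[OF assms(2)]
  by (intro continuous_intros) (auto intro: continuous_on_subset)

lemma tildeF_conv:
  assumes f: "fourier_invertible f" and h: "H1fun h"
  shows "tildeF (conv f h) = laplace (conv_symbol f h)"
proof -
  obtain h' where h': "integrable lborel h'" "fourier h' = fourier h" "\<And>f. conv f h' = conv f h"
    using H1fun_representative[OF h] by metis
  have "conv_symbol f h' = conv_symbol f h" using h'(2) by (simp add: conv_symbol_def fun_eq_iff)
  then have "conv f h = (\<lambda>u. fourier (conv_symbol f h) (- u))"
    using lborel_conv_eq_fourier_symbol[OF f h'(1)] conv_eq_lborel_conv[OF fourier_invertibleD(1)[OF f] h'(1)]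
    by (intro ext) (simp flip: h'(3))
  then show ?thesis using tildeF_fourier[OF conv_symbol_L1_halfline[OF f h]] by simp
qed

definition rep_norm :: "(nat \<Rightarrow> real \<Rightarrow> complex) \<Rightarrow> (nat \<Rightarrow> real \<Rightarrow> complex) \<Rightarrow> real" where
  "rep_norm fs hs = (\<Sum>k. supnorm (fs k) * L1norm (hs k))"

lemma A0R_repD:
  assumes "A0R_rep F fs hs"
  shows "C0fun (fs k)" "H1fun (hs k)" "summable (\<lambda>k. supnorm (fs k) * L1norm (hs k))"
    "(\<lambda>k. conv (fs k) (hs k) t) sums F t"
  using assms by (auto simp: A0R_rep_def)

lemma A0R_rep_measurable:
  assumes rep: "A0R_rep F fs hs"
  shows "F \<in> borel_measurable borel"
proof (rule borel_measurable_LIMSEQ_metric)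
  show "(\<lambda>n. \<Sum>k<n. conv (fs k) (hs k) t) \<longlonglongrightarrow> F t" for t
    using A0R_repD(4)[OF rep] by (simp add: sums_def)
  show "(\<lambda>t. \<Sum>k<n. conv (fs k) (hs k) t) \<in> borel_measurable borel" for n
    by (intro borel_measurable_sum conv_measurable A0R_repD[OF rep])
qed

lemma norm_le_rep_norm:
  assumes rep: "A0R_rep F fs hs"
  shows "norm (F t) \<le> rep_norm fs hs"
proof -
  have "F t = (\<Sum>k. conv (fs k) (hs k) t)"
    by (rule sums_unique[OF A0R_repD(4)[OF rep]])
  also have "norm \<dots> \<le> rep_norm fs hs"
    unfolding rep_norm_def by (intro norm_suminf_le norm_conv_le A0R_repD[OF rep])
  finally show ?thesis .
qed

lemma rep_norm_nonneg: "A0R_rep F fs hs \<Longrightarrow> 0 \<le> rep_norm fs hs"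
  using norm_le_rep_norm[of F fs hs 0] norm_ge_zero order_trans by blast

lemma A0R_rep_finite_sum:
  assumes "\<And>k. C0fun (fs k)" "\<And>k. H1fun (hs k)"
  shows "A0R_rep (\<lambda>t. \<Sum>k<n. conv (fs k) (hs k) t) (\<lambda>k. if k < n then fs k else (\<lambda>_. 0)) hs"
  unfolding A0R_rep_def
proof (intro conjI allI)
  show "summable (\<lambda>k. supnorm (if k < n then fs k else (\<lambda>_. 0)) * L1norm (hs k))"
    by (rule summable_finite[of "{..<n}"]) auto
  show "(\<lambda>k. conv (if k < n then fs k else (\<lambda>_. 0)) (hs k) t) sums (\<Sum>k<n. conv (fs k) (hs k) t)" for t
    using sums_finite[of "{..<n}" "\<lambda>k. conv (if k < n then fs k else (\<lambda>_. 0)) (hs k) t"] by simp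
qed (use assms C0fun_zero in auto)

lemma A0R_rep_tail:
  assumes rep: "A0R_rep F fs hs"
  shows "A0R_rep (\<lambda>t. F t - (\<Sum>k<n. conv (fs k) (hs k) t)) (\<lambda>k. fs (k + n)) (\<lambda>k. hs (k + n))"
  unfolding A0R_rep_def
  using A0R_repD[OF rep] summable_ignore_initial_segment[OF A0R_repD(3)[OF rep], of n]
    sums_split_initial_segment[OF A0R_repD(4)[OF rep], of n] by simp

lemma rep_norm_tail_tendsto:
  assumes "A0R_rep F fs hs"
  shows "(\<lambda>n. rep_norm (\<lambda>k. fs (k + n)) (\<lambda>k. hs (k + n))) \<longlonglongrightarrow> 0"
  unfolding rep_norm_def by (rule suminf_exist_split2[OF A0R_repD(3)[OF assms]])

lemma A0R_rep_conv:
  assumes "C0fun f" "H1fun h"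
  shows "A0R_rep (conv f h) (\<lambda>k. if k < 1 then f else (\<lambda>_. 0)) (\<lambda>_. h)"
  using A0R_rep_finite_sum[of "\<lambda>_. f" "\<lambda>_. h" 1] assms by simp

lemma tildeF_rep_add:
  assumes "A0R_rep F fs hs" "A0R_rep G gs js"
  shows "tildeF (\<lambda>t. F t + G t) = (\<lambda>z. tildeF F z + tildeF G z)"
  by (rule tildeF_add[OF A0R_rep_measurable[OF assms(1)] norm_le_rep_norm[OF assms(1)]
        A0R_rep_measurable[OF assms(2)] norm_le_rep_norm[OF assms(2)]])

lemma norm_tildeF_le_rep_norm: "A0R_rep F fs hs \<Longrightarrow> norm (tildeF F z) \<le> rep_norm fs hs"
  by (rule norm_tildeF_le[OF A0R_rep_measurable norm_le_rep_norm])

lemma tildeF_in_A0C: "A0R_rep F fs hs \<Longrightarrow> tildeF F \<in> A0C"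
  by (auto simp: A0C_def A0R_def)

lemma A0R_norm_le: "A0R_rep F fs hs \<Longrightarrow> A0R_norm F \<le> rep_norm fs hs"
  unfolding A0R_norm_def rep_norm_def[symmetric]
  by (rule cInf_lower) (auto intro: bdd_belowI[of _ 0] rep_norm_nonneg)

lemma A0R_norm_nonneg: "F \<in> A0R \<Longrightarrow> 0 \<le> A0R_norm F"
  unfolding A0R_norm_def rep_norm_def[symmetric]
  by (rule cInf_greatest) (auto simp: A0R_def intro: rep_norm_nonneg)

lemma A0C_norm_nonneg: "\<phi> \<in> A0C \<Longrightarrow> 0 \<le> A0C_norm \<phi>"
  unfolding A0C_norm_def by (rule cInf_greatest) (auto simp: A0C_def intro: A0R_norm_nonneg)

lemma A0C_norm_le_rep_norm:
  assumes rep: "A0R_rep F fs hs"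
  shows "A0C_norm (tildeF F) \<le> rep_norm fs hs"
proof -
  have "A0C_norm (tildeF F) \<le> A0R_norm F"
    unfolding A0C_norm_def
  proof (rule cInf_lower)
    show "A0R_norm F \<in> {A0R_norm G |G. G \<in> A0R \<and> tildeF G = tildeF F}" using rep by (auto simp: A0R_def)
  qed (auto intro: bdd_belowI[of _ 0] A0R_norm_nonneg)
  then show ?thesis using A0R_norm_le[OF rep] by linarith
qed

lemma le_mult_cInf:
  fixes a K :: real
  assumes "S \<noteq> {}" "K \<ge> 0" "\<And>s. s \<in> S \<Longrightarrow> a \<le> K * s"
  shows "a \<le> K * Inf S"
proof (cases "K = 0")
  case False
  then have K: "K > 0" using assms by simp
  have "a / K \<le> Inf S"
    using assms K by (intro cInf_greatest) (auto simp: divide_le_eq mult.commute)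
  then show ?thesis using K by (simp add: divide_le_eq mult.commute)
qed (use assms in auto)

lemma le_mult_A0C_norm:
  assumes \<phi>: "\<phi> \<in> A0C" and K: "K \<ge> 0"
    and le: "\<And>F fs hs. A0R_rep F fs hs \<Longrightarrow> tildeF F = \<phi> \<Longrightarrow> a \<le> K * rep_norm fs hs"
  shows "a \<le> K * A0C_norm \<phi>"
  unfolding A0C_norm_def
proof (rule le_mult_cInf[OF _ K])
  show "{A0R_norm F |F. F \<in> A0R \<and> tildeF F = \<phi>} \<noteq> {}" using \<phi> by (auto simp: A0C_def)
  fix s assume "s \<in> {A0R_norm F |F. F \<in> A0R \<and> tildeF F = \<phi>}"
  then obtain F where F: "F \<in> A0R" "tildeF F = \<phi>" and s: "s = A0R_norm F" by blast
  show "a \<le> K * s"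
    unfolding s A0R_norm_def rep_norm_def[symmetric]
    by (rule le_mult_cInf[OF _ K]) (use F le in \<open>auto simp: A0R_def\<close>)
qed

lemma A0C_norm_tildeF_conv_le:
  assumes "C0fun f" "H1fun h"
  shows "A0C_norm (tildeF (conv f h)) \<le> supnorm f * L1norm h"
proof -
  have "rep_norm (\<lambda>k. if k < 1 then f else (\<lambda>_. 0)) (\<lambda>_. h) = supnorm f * L1norm h"
    unfolding rep_norm_def by (subst suminf_finite[of "{0}"]) auto
  then show ?thesis using A0C_norm_le_rep_norm[OF A0R_rep_conv[OF assms]] by simp
qed

lemma tildeF_conv_eq_add_diff:
  assumes f: "C0fun f" and g: "C0fun g" and h: "H1fun h"
  shows "tildeF (conv f h) = (\<lambda>z. tildeF (conv g h) z + tildeF (conv (\<lambda>t. f t - g t) h) z)"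
  using tildeF_rep_add[OF A0R_rep_conv[OF g h] A0R_rep_conv[OF C0fun_diff[OF f g] h]]
  by (simp add: conv_diff[OF f g h])

lemma norm_tildeF_conv_diff_le:
  assumes f: "C0fun f" and g: "C0fun g" and h: "H1fun h"
  shows "norm (tildeF (conv f h) z - tildeF (conv g h) z) \<le> supnorm (\<lambda>t. f t - g t) * L1norm h"
  using norm_tildeF_le[OF conv_measurable norm_conv_le] C0fun_diff[OF f g] h
  by (simp add: tildeF_conv_eq_add_diff[OF f g h])

lemma tildeF_partial_sum:
  fixes n :: nat
  assumes "\<And>k. C0fun (fs k)" "\<And>k. H1fun (hs k)"
  shows "tildeF (\<lambda>t. \<Sum>k<n. conv (fs k) (hs k) t) = (\<lambda>z. \<Sum>k<n. tildeF (conv (fs k) (hs k)) z)"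
proof (induction n)
  case 0
  show ?case by (simp add: tildeF_def poisson_def fun_eq_iff)
next
  case (Suc n)
  then show ?case
    using tildeF_rep_add[OF A0R_rep_finite_sum[of fs hs n] A0R_rep_conv[of "fs n" "hs n"]] assms by simp
qed

lemma tildeF_eq_partial_sum_add_tail:
  assumes rep: "A0R_rep F fs hs"
  shows "tildeF F = (\<lambda>z. tildeF (\<lambda>t. \<Sum>k<n. conv (fs k) (hs k) t) z
    + tildeF (\<lambda>t. F t - (\<Sum>k<n. conv (fs k) (hs k) t)) z)"
  using tildeF_rep_add[OF A0R_rep_finite_sum[of fs hs n] A0R_rep_tail[OF rep, of n]] A0R_repD(1,2)[OF rep]
  by simp

lemma norm_tildeF_minus_partial_sum_le:
  assumes rep: "A0R_rep F fs hs"
  shows "norm (tildeF F z - (\<Sum>k<n. tildeF (conv (fs k) (hs k)) z)) \<le> rep_norm (\<lambda>k. fs (k + n)) (\<lambda>k. hs (k + n))"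
  using norm_tildeF_le_rep_norm[OF A0R_rep_tail[OF rep, of n]]
  by (simp add: tildeF_eq_partial_sum_add_tail[OF rep, of n] tildeF_partial_sum A0R_repD[OF rep])

section \<open>Sampling\<close>

lemma norm_left_endpoint_rule_error_le:
  fixes f :: "real \<Rightarrow> 'a::banach"
  assumes f: "continuous_on {a..b} f" and ab: "a \<le> b" and e: "\<And>t. t \<in> {a..b} \<Longrightarrow> norm (f a - f t) \<le> e"
  shows "norm ((b - a) *\<^sub>R f a - integral {a..b} f) \<le> e * (b - a)"
proof -
  have "(b - a) *\<^sub>R f a - integral {a..b} f = integral {a..b} (\<lambda>t. f a - f t)"
    using ab f by (subst Henstock_Kurzweil_Integration.integral_diff) (auto intro: integrable_continuous_real)
  also have "norm \<dots> \<le> integral {a..b} (\<lambda>t. e)"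
    by (intro integral_norm_bound_integral integrable_continuous_real continuous_intros f e)
  also have "\<dots> = e * (b - a)" using ab by simp
  finally show ?thesis .
qed

lemma norm_riemann_sum_error_le:
  fixes f :: "real \<Rightarrow> 'a::banach"
  assumes f: "continuous_on {0..real k * \<tau>} f" and \<tau>: "\<tau> \<ge> 0"
    and e: "\<And>n t. n < k \<Longrightarrow> t \<in> {real n * \<tau>..real (Suc n) * \<tau>} \<Longrightarrow> norm (f (real n * \<tau>) - f t) \<le> e"
  shows "norm ((\<Sum>n<k. \<tau> *\<^sub>R f (real n * \<tau>)) - integral {0..real k * \<tau>} f) \<le> e * (real k * \<tau>)"
  using f e
proof (induction k)
  case (Suc k)
  let ?a = "real k * \<tau>" and ?b = "real (Suc k) * \<tau>"
  have ab: "0 \<le> ?a" "?a \<le> ?b" "?b - ?a = \<tau>" using \<tau> by (simp_all add: algebra_simps)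
  have "integral {0..?b} f = integral {0..?a} f + integral {?a..?b} f"
    using ab Suc.prems(1)
    by (intro Henstock_Kurzweil_Integration.integral_combine[symmetric] integrable_continuous_real) auto
  then have "(\<Sum>n<Suc k. \<tau> *\<^sub>R f (real n * \<tau>)) - integral {0..?b} f
      = ((\<Sum>n<k. \<tau> *\<^sub>R f (real n * \<tau>)) - integral {0..?a} f) + (\<tau> *\<^sub>R f ?a - integral {?a..?b} f)"
    by simp
  also have "norm \<dots> \<le> e * ?a + e * \<tau>"
  proof (rule norm_triangle_mono)
    show "norm ((\<Sum>n<k. \<tau> *\<^sub>R f (real n * \<tau>)) - integral {0..?a} f) \<le> e * ?a"
      using ab Suc.prems by (intro Suc.IH) (auto intro: continuous_on_subset)
    have "norm ((?b - ?a) *\<^sub>R f ?a - integral {?a..?b} f) \<le> e * (?b - ?a)"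
      using ab Suc.prems(2)[of k]
      by (intro norm_left_endpoint_rule_error_le continuous_on_subset[OF Suc.prems(1)]) auto
    then show "norm (\<tau> *\<^sub>R f ?a - integral {?a..?b} f) \<le> e * \<tau>" by (simp only: ab(3))
  qed
  finally show ?case by (simp add: algebra_simps)
qed simp

lemma riemann_sum_tendsto:
  fixes f :: "real \<Rightarrow> 'a::banach"
  assumes f: "continuous_on {0..N} f" and N: "N > 0"
  shows "(\<lambda>m. \<Sum>n<Suc m. (N / Suc m) *\<^sub>R f (real n * (N / Suc m))) \<longlonglongrightarrow> integral {0..N} f"
proof (rule LIMSEQ_I)
  fix r :: real assume r: "r > 0"
  define e where "e = r / (2 * N)"
  have e: "e > 0" "e * N < r" using r N by (simp_all add: e_def)
  have "uniformly_continuous_on {0..N} f"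
    by (intro compact_uniformly_continuous f) auto
  then obtain d where d: "d > 0" "\<And>s t. s \<in> {0..N} \<Longrightarrow> t \<in> {0..N} \<Longrightarrow> dist s t < d \<Longrightarrow> dist (f s) (f t) < e"
    using e unfolding uniformly_continuous_on_def by metis
  have "(\<lambda>m. N / real (Suc m)) \<longlonglongrightarrow> 0" by (rule LIMSEQ_Suc[OF lim_const_over_n])
  then obtain m0 where m0: "\<And>m. m \<ge> m0 \<Longrightarrow> N / real (Suc m) < d"
    using order_tendstoD(2)[of _ 0] d(1) by (force simp: eventually_sequentially)
  have "norm ((\<Sum>n<Suc m. (N / Suc m) *\<^sub>R f (real n * (N / Suc m))) - integral {0..N} f) < r"
    if m: "m \<ge> m0" for m
  proof -
    define \<tau> where "\<tau> = N / Suc m"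
    have \<tau>: "0 \<le> \<tau>" "\<tau> < d" "real (Suc m) * \<tau> = N" using N m0[OF m] by (simp_all add: \<tau>_def)
    have "norm (f (real n * \<tau>) - f t) \<le> e" if "n < Suc m" "t \<in> {real n * \<tau>..real (Suc n) * \<tau>}" for n t
    proof -
      define s where "s = real n * \<tau>"
      have "real (Suc n) * \<tau> \<le> real (Suc m) * \<tau>" using that(1) \<tau>(1) by (intro mult_right_mono) auto
      then have "0 \<le> s" "s \<le> t" "t \<le> s + \<tau>" "s + \<tau> \<le> N"
        using that(2) \<tau> by (simp_all add: s_def algebra_simps)
      then have "dist (f s) (f t) < e" using \<tau>(2) by (intro d(2)) (auto simp: dist_real_def)
      then show ?thesis by (simp add: s_def dist_norm)
    qed
    then have "norm ((\<Sum>n<Suc m. \<tau> *\<^sub>R f (real n * \<tau>)) - integral {0..real (Suc m) * \<tau>} f)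
        \<le> e * (real (Suc m) * \<tau>)"
      using f \<tau> by (intro norm_riemann_sum_error_le) auto
    then show ?thesis using e(2) unfolding \<tau>(3) unfolding \<tau>_def by linarith
  qed
  then show "\<exists>m0. \<forall>m\<ge>m0. norm ((\<Sum>n<Suc m. (N / Suc m) *\<^sub>R f (real n * (N / Suc m))) - integral {0..N} f) < r"
    by blast
qed

definition L1_tail :: "(real \<Rightarrow> complex) \<Rightarrow> real \<Rightarrow> real" where
  "L1_tail f R = (LINT u|lborel. norm (f u) * indicator {u. R \<le> \<bar>u\<bar>} u)"

lemma L1_tail_nonneg: "0 \<le> L1_tail f R"
  by (simp add: L1_tail_def)

lemma L1_tail_tendsto_0:
  assumes f: "integrable lborel f"
  shows "(L1_tail f \<longlongrightarrow> 0) at_top"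
proof (rule tendsto_at_topI_sequentially)
  fix R :: "nat \<Rightarrow> real" assume R: "filterlim R at_top sequentially"
  have "(\<lambda>n. LINT u|lborel. norm (f u) * indicator {u. R n \<le> \<bar>u\<bar>} u) \<longlonglongrightarrow> (LINT u|lborel. norm (f u) * 0)"
  proof (rule tendsto_LINT_mult_bounded[where B = 1])
    show "(\<lambda>n. indicator {u. R n \<le> \<bar>u\<bar>} u :: real) \<longlonglongrightarrow> 0" for u
    proof (rule tendsto_eventually)
      have "\<forall>\<^sub>F n in sequentially. \<bar>u\<bar> < R n" using R by (simp add: filterlim_at_top_dense)
      then show "\<forall>\<^sub>F n in sequentially. (indicator {u. R n \<le> \<bar>u\<bar>} u :: real) = 0"
        by eventually_elim simp
    qed
  qed (use f in \<open>auto simp: indicator_def\<close>)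
  then show "(\<lambda>n. L1_tail f (R n)) \<longlonglongrightarrow> 0" by (simp add: L1_tail_def)
qed

lemma norm_fourier_coeff_dilated_diff_le:
  assumes f: "continuous_on UNIV f" "integrable lborel f" and \<tau>: "\<tau> > 0"
  shows "norm (fourier_coeff (\<lambda>t. f (t / \<tau>)) n - of_real \<tau> * (fourier f (real n * \<tau>) / of_real (2 * pi)))
    \<le> \<tau> * (L1_tail f (pi / \<tau>) / (2 * pi))"
proof -
  let ?e = "\<lambda>u. f u * cis (- (u * (real n * \<tau>)))" and ?I = "\<lambda>u. indicator {-pi..pi} (\<tau> * u) :: real"
  have e: "integrable lborel ?e" by (intro integrable_mult_cis f) measurable
  have [measurable]: "f \<in> borel_measurable borel" using f(1) by (rule borel_measurable_continuous_onI)
  have Ie: "integrable lborel (\<lambda>u. ?I u *\<^sub>R ?e u)"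
    by (rule Bochner_Integration.integrable_bound[OF e]) (auto simp: indicator_def)
  have cont: "continuous_on {-pi..pi} (\<lambda>t. f (t / \<tau>) * cis (- (real n * t)))"
    using \<tau> by (intro continuous_intros continuous_on_compose2[OF f(1)]) auto
  have "integral {-pi..pi} (\<lambda>t. f (t / \<tau>) * cis (- (real n * t)))
      = (LINT t|lborel. indicator {-pi..pi} t *\<^sub>R (f (t / \<tau>) * cis (- (real n * t))))"
    using set_borel_integral_eq_integral(2)[OF borel_integrable_atLeastAtMost'[OF cont]]
    by (simp add: set_lebesgue_integral_def)
  also have "\<dots> = \<tau> *\<^sub>R (LINT u|lborel. ?I u *\<^sub>R ?e u)"
    using LINT_lborel_affine[of \<tau> "\<lambda>t. indicator {-pi..pi} t *\<^sub>R (f (t / \<tau>) * cis (- (real n * t)))" 0] \<tau>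
    by (simp add: mult_ac)
  finally have "fourier_coeff (\<lambda>t. f (t / \<tau>)) n - of_real \<tau> * (fourier f (real n * \<tau>) / of_real (2 * pi))
      = (\<tau> / (2 * pi)) *\<^sub>R (LINT u|lborel. ?I u *\<^sub>R ?e u - ?e u)"
    using e Ie
    by (simp add: fourier_coeff_def circle_mean_def fourier_eq_LINT[OF f(2)] scaleR_conv_of_real field_simps)
  moreover have "norm (LINT u|lborel. ?I u *\<^sub>R ?e u - ?e u)
      \<le> (LINT u|lborel. norm (f u) * indicator {u. pi / \<tau> \<le> \<bar>u\<bar>} u)"
  proof (rule Bochner_Integration.integral_norm_bound_integral)
    show "integrable lborel (\<lambda>u. norm (f u) * indicator {u. pi / \<tau> \<le> \<bar>u\<bar>} u)"
      by (rule integrable_mult_bounded[where B = 1]) (use f(2) in \<open>auto simp: indicator_def\<close>)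
    show "norm (?I u *\<^sub>R ?e u - ?e u) \<le> norm (f u) * indicator {u. pi / \<tau> \<le> \<bar>u\<bar>} u" for u
    proof (cases "\<tau> * u \<in> {-pi..pi}")
      case False
      then have "pi < \<bar>\<tau> * u\<bar>" by auto
      then have "pi / \<tau> \<le> \<bar>u\<bar>" using \<tau> by (simp add: abs_mult field_simps)
      then show ?thesis using False by (simp add: norm_mult)
    qed simp
  qed (use e Ie in simp)
  ultimately show ?thesis using \<tau> by (simp add: L1_tail_def mult_left_mono divide_right_mono)
qed

lemma cesaro_mean_tendsto:
  fixes g :: "real \<Rightarrow> complex"
  assumes g: "integrable lborel g" "\<And>t. t < 0 \<Longrightarrow> g t = 0" and cont: "continuous_on {0..} g"
  shows "(\<lambda>k. integral {0..real (Suc k)} (\<lambda>r. of_real (1 - r / Suc k) * g r)) \<longlonglongrightarrow> (LINT r|lborel. g r)"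
proof -
  define w where "w k r = complex_of_real (max 0 (1 - max 0 r / Suc k))" for k :: nat and r
  have "(\<lambda>k. LINT r|lborel. g r * w k r) \<longlonglongrightarrow> (LINT r|lborel. g r * of_real (max 0 (1 - 0)))"
  proof (rule tendsto_LINT_mult_bounded[OF g(1)])
    show "(\<lambda>k. w k r) \<longlonglongrightarrow> of_real (max 0 (1 - 0))" for r
      unfolding w_def by (intro tendsto_intros LIMSEQ_Suc[OF lim_const_over_n])
    show "norm (w k r) \<le> 1" for k r by (simp add: w_def)
  qed (simp add: w_def)
  moreover have "integral {0..real (Suc k)} (\<lambda>r. of_real (1 - r / Suc k) * g r)
      = (LINT r|lborel. g r * w k r)" for k
  proof -
    have "continuous_on {0..real (Suc k)} (\<lambda>r. of_real (1 - r / Suc k) * g r)"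
      by (intro continuous_intros continuous_on_subset[OF cont]) auto
    then have "integral {0..real (Suc k)} (\<lambda>r. of_real (1 - r / Suc k) * g r)
        = (LINT r:{0..real (Suc k)}|lborel. of_real (1 - r / Suc k) * g r)"
      by (intro set_borel_integral_eq_integral(2)[symmetric] borel_integrable_atLeastAtMost')
    also have "\<dots> = (LINT r|lborel. g r * w k r)"
      unfolding set_lebesgue_integral_def
    proof (rule Bochner_Integration.integral_cong[OF refl])
      fix r
      consider "r < 0" | "0 \<le> r" "r \<le> real (Suc k)" | "r > real (Suc k)" by linarith
      then show "indicator {0..real (Suc k)} r *\<^sub>R (of_real (1 - r / Suc k) * g r) = g r * w k r"
        by cases (auto simp: w_def g(2) max_def field_simps)
    qed
    finally show ?thesis .
  qed
  ultimately show ?thesis by simp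
qed

section \<open>Fejer polynomials of \<open>H\<^sup>1\<close> functions\<close>

definition fejer_kernel :: "nat \<Rightarrow> real \<Rightarrow> real" where
  "fejer_kernel M t = (norm (\<Sum>j<M. cis (real j * t)))\<^sup>2 / M"

lemma fejer_kernel_nonneg: "0 \<le> fejer_kernel M t"
  by (simp add: fejer_kernel_def)

lemma fejer_kernel_expand:
  "complex_of_real (fejer_kernel M t) = (\<Sum>j<M. \<Sum>l<M. cis ((real j - real l) * t)) / M"
proof -
  have "complex_of_real ((norm (\<Sum>j<M. cis (real j * t)))\<^sup>2)
      = (\<Sum>j<M. cis (real j * t)) * cnj (\<Sum>j<M. cis (real j * t))"
    by (rule complex_norm_square)
  also have "\<dots> = (\<Sum>j<M. \<Sum>l<M. cis (real j * t) * cis (- (real l * t)))"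
    by (simp add: sum_product cis_cnj)
  also have "\<dots> = (\<Sum>j<M. \<Sum>l<M. cis ((real j - real l) * t))"
    by (simp add: cis_mult left_diff_distrib)
  finally show ?thesis by (simp add: fejer_kernel_def)
qed

lemma LINT_mult_fejer_kernel:
  assumes h: "integrable lborel h"
  shows "(LINT s|lborel. h s * of_real (fejer_kernel M (t - \<tau> * s)))
    = (\<Sum>j<M. \<Sum>l<M. fourier h ((real j - real l) * \<tau>) * cis ((real j - real l) * t)) / M"
proof -
  have shift: "cis (a * (t - \<tau> * s)) = cis (- (s * (a * \<tau>))) * cis (a * t)" for a s
    unfolding cis_mult by (rule arg_cong[of _ _ cis]) (simp add: algebra_simps)
  have fourier_term: "(LINT s|lborel. h s * cis (a * (t - \<tau> * s))) = fourier h (a * \<tau>) * cis (a * t)" for a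
    using h by (simp add: shift fourier_eq_LINT integrable_mult_cis flip: mult.assoc)
  have int: "integrable lborel (\<lambda>s. h s * cis (a * (t - \<tau> * s)))" for a
    by (intro integrable_mult_cis h) measurable
  show ?thesis
    by (simp add: fejer_kernel_expand sum_distrib_left int fourier_term)
qed

definition fejer_mean :: "(real \<Rightarrow> complex) \<Rightarrow> real \<Rightarrow> nat \<Rightarrow> real \<Rightarrow> real" where
  "fejer_mean h \<tau> M t = (LINT s|lborel. norm (h s) * fejer_kernel M (t - \<tau> * s))"

lemma fejer_mean_expand:
  assumes h: "integrable lborel h"
  shows "complex_of_real (fejer_mean h \<tau> M t) = (\<Sum>j<M. \<Sum>l<M.
    cis (of_int (int j - int l) * t) * (fourier (\<lambda>s. of_real (norm (h s))) ((real j - real l) * \<tau>) / M))"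
proof -
  have "integrable lborel (\<lambda>s. complex_of_real (norm (h s)))"
    using h by (intro integrable_of_real integrable_norm)
  from LINT_mult_fejer_kernel[OF this, of M t \<tau>] show ?thesis
    by (simp add: fejer_mean_def sum_divide_distrib mult.commute flip: integral_complex_of_real)
qed

lemma continuous_on_fejer_mean:
  assumes "integrable lborel h"
  shows "continuous_on S (fejer_mean h \<tau> M)"
proof -
  have "continuous_on S (\<lambda>t. Re (complex_of_real (fejer_mean h \<tau> M t)))"
    unfolding fejer_mean_expand[OF assms] by (intro continuous_intros)
  then show ?thesis by simp
qed

lemma circle_mean_fejer_mean:
  assumes h: "integrable lborel h" and M: "M > 0"
  shows "circle_mean (fejer_mean h \<tau> M) = L1norm h"
proof -
  let ?h = "\<lambda>s. complex_of_real (norm (h s))"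
  have "of_real (circle_mean (fejer_mean h \<tau> M)) = circle_mean (\<lambda>t. complex_of_real (fejer_mean h \<tau> M t))"
    by (rule circle_mean_bounded_linear[OF bounded_linear_of_real continuous_on_fejer_mean[OF h], symmetric])
  also have "\<dots> = (\<Sum>j<M. \<Sum>l<M. circle_mean (\<lambda>t. cis (of_int (int j - int l) * t)) *
      (fourier ?h ((real j - real l) * \<tau>) / M))"
    unfolding fejer_mean_expand[OF h]
    by (simp only: circle_mean_mult_left circle_mean_sum continuous_intros finite_lessThan)
  also have "\<dots> = (\<Sum>j<M. \<Sum>l<M. if j = l then fourier ?h 0 / M else 0)"
    unfolding circle_mean_cis by (intro sum.cong refl) auto
  also have "\<dots> = fourier ?h 0" using M by simp
  also have "\<dots> = of_real (L1norm h)"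
    using h by (simp add: fourier_eq_LINT integrable_of_real integral_complex_of_real L1norm_eq_LINT)
  finally show ?thesis by (simp only: of_real_eq_iff)
qed

definition fejer_poly :: "(real \<Rightarrow> complex) \<Rightarrow> real \<Rightarrow> nat \<Rightarrow> complex poly" where
  "fejer_poly h \<tau> M = smult (1 / of_nat M) (\<Sum>j<M. \<Sum>l<j. monom (fourier h (real (j - l) * \<tau>)) (j - l))"

lemma sum_sum_diff_eq:
  fixes a :: "nat \<Rightarrow> 'a::comm_ring_1"
  assumes "a 0 = 0"
  shows "(\<Sum>j<M. \<Sum>l<j. a (j - l)) = (\<Sum>n<M. of_nat (M - n) * a n)"
proof (induction M)
  case (Suc M)
  have "(\<Sum>l<M. a (M - l)) = (\<Sum>l<M. a (Suc (M - Suc l)))"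
    by (intro sum.cong) (auto simp: Suc_diff_Suc)
  also have "\<dots> = (\<Sum>i<M. a (Suc i))" by (rule sum.nat_diff_reindex)
  also have "\<dots> = (\<Sum>n<Suc M. a n)" using assms by (simp add: sum.lessThan_Suc_shift del: sum.lessThan_Suc)
  finally have "(\<Sum>j<Suc M. \<Sum>l<j. a (j - l)) = (\<Sum>n<M. of_nat (M - n) * a n) + (\<Sum>n<Suc M. a n)"
    using Suc by simp
  also have "\<dots> = (\<Sum>n<M. of_nat (M - n) * a n + a n) + a M"
    by (simp add: sum.distrib)
  also have "(\<Sum>n<M. of_nat (M - n) * a n + a n) = (\<Sum>n<M. of_nat (Suc M - n) * a n)"
    by (intro sum.cong) (auto simp: Suc_diff_le algebra_simps)
  finally show ?case by simp
qed simp

lemma coeff_pairing_fejer_poly: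
  assumes "fourier h 0 = 0" and M: "M > 0"
  shows "coeff_pairing \<phi> (fejer_poly h \<tau> M) = (\<Sum>n<M. of_real (1 - n / M) * (fourier h (real n * \<tau>) * \<phi> n))"
proof -
  have "coeff_pairing \<phi> (fejer_poly h \<tau> M) = (\<Sum>j<M. \<Sum>l<j. fourier h (real (j - l) * \<tau>) * \<phi> (j - l)) / of_nat M"
    by (simp add: fejer_poly_def coeff_pairing_smult coeff_pairing_sum coeff_pairing_monom)
  also have "\<dots> = (\<Sum>n<M. of_nat (M - n) * (fourier h (real n * \<tau>) * \<phi> n)) / of_nat M"
    using sum_sum_diff_eq[of "\<lambda>n. fourier h (real n * \<tau>) * \<phi> n" M] assms by simp
  also have "\<dots> = (\<Sum>n<M. of_real (1 - n / M) * (fourier h (real n * \<tau>) * \<phi> n))"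
    unfolding sum_divide_distrib
  proof (intro sum.cong refl)
    fix n assume "n \<in> {..<M}"
    then have "complex_of_nat (M - n) / of_nat M = of_real (1 - n / M)"
      using M by (simp add: of_nat_diff diff_divide_distrib)
    then show "of_nat (M - n) * (fourier h (real n * \<tau>) * \<phi> n) / of_nat M
        = of_real (1 - n / M) * (fourier h (real n * \<tau>) * \<phi> n)"
      by (metis times_divide_eq_left)
  qed
  finally show ?thesis .
qed

lemma poly_fejer_poly:
  assumes H1: "H1fun h" and h: "integrable lborel h" and \<tau>: "\<tau> \<ge> 0"
  shows "poly (fejer_poly h \<tau> M) (cis t) = (LINT s|lborel. h s * of_real (fejer_kernel M (t - \<tau> * s)))"
proof -
  have fourier_0: "fourier h u = 0" if "u \<le> 0" for u using H1 that by (simp add: H1fun_def)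
  have "(\<Sum>l<M. fourier h ((real j - real l) * \<tau>) * cis ((real j - real l) * t))
      = (\<Sum>l<j. fourier h (real (j - l) * \<tau>) * cis (real (j - l) * t))" if j: "j < M" for j
  proof (rule sum.mono_neutral_cong_right)
    show "\<forall>l\<in>{..<M} - {..<j}. fourier h ((real j - real l) * \<tau>) * cis ((real j - real l) * t) = 0"
      using \<tau> by (auto intro!: fourier_0 mult_nonpos_nonneg)
  qed (use j in \<open>auto simp: of_nat_diff\<close>)
  then show ?thesis
    by (simp add: LINT_mult_fejer_kernel[OF h] fejer_poly_def poly_sum poly_monom Complex.DeMoivre)
qed

lemma circle_mean_norm_fejer_poly_le:
  assumes H1: "H1fun h" and \<tau>: "\<tau> \<ge> 0" and M: "M > 0"
  shows "circle_mean (\<lambda>t. norm (poly (fejer_poly h \<tau> M) (cis t))) \<le> L1norm h"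
proof -
  obtain h' where h': "H1fun h'" "integrable lborel h'" "fourier h' = fourier h" "L1norm h' = L1norm h"
    using H1fun_representative[OF H1] by metis
  have "fejer_poly h \<tau> M = fejer_poly h' \<tau> M" by (simp add: fejer_poly_def h'(3))
  moreover have "norm (poly (fejer_poly h' \<tau> M) (cis t)) \<le> fejer_mean h' \<tau> M t" for t
    using integral_norm_bound[of lborel "\<lambda>s. h' s * of_real (fejer_kernel M (t - \<tau> * s))"]
    by (simp add: fejer_mean_def poly_fejer_poly[OF h'(1,2) \<tau>] norm_mult fejer_kernel_nonneg)
  ultimately have "circle_mean (\<lambda>t. norm (poly (fejer_poly h \<tau> M) (cis t))) \<le> circle_mean (fejer_mean h' \<tau> M)"
    by (intro circle_mean_mono continuous_intros continuous_on_fejer_mean h'(2)) simp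
  then show ?thesis by (simp add: circle_mean_fejer_mean[OF h'(2) M] h'(4))
qed

section \<open>The Hille--Phillips calculus\<close>

locale bounded_semigroup = cplx_hilbert J
  for J :: "'h::{real_inner,complete_space} \<Rightarrow> 'h" +
  fixes T :: "real \<Rightarrow> 'h \<Rightarrow>\<^sub>L 'h" and C :: real
  assumes semigroup: "bounded_C0_semigroup J T" and norm_T: "\<And>t. t \<ge> 0 \<Longrightarrow> norm (T t) \<le> C"
begin

lemma T_BH: "t \<ge> 0 \<Longrightarrow> T t \<in> BH J"
  and T_0: "T 0 = id_blinfun"
  and T_add: "s \<ge> 0 \<Longrightarrow> t \<ge> 0 \<Longrightarrow> T (s + t) = T s o\<^sub>L T t"
  and continuous_on_T: "continuous_on {0..} (\<lambda>t. T t x)"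
  using semigroup by (auto simp: bounded_C0_semigroup_def)

lemma C_nonneg: "C \<ge> 0"
  using norm_T[of 0] norm_ge_zero[of "T 0"] by linarith

lemma norm_T_apply: "t \<ge> 0 \<Longrightarrow> norm (T t x) \<le> C * norm x"
  by (rule order_trans[OF norm_blinfun mult_right_mono[OF norm_T]]) auto

lemma continuous_on_T_max: "continuous_on S (\<lambda>t. T (max 0 t) x)"
  by (rule continuous_on_compose2[OF continuous_on_T]) (auto intro!: continuous_intros)

definition matrix_coeff :: "'h \<Rightarrow> 'h \<Rightarrow> real \<Rightarrow> complex" where
  "matrix_coeff x y t = cinner J (T (max 0 t) x) y"

lemma norm_matrix_coeff_le: "norm (matrix_coeff x y t) \<le> C * norm x * norm y"
  unfolding matrix_coeff_def
  by (rule order_trans[OF norm_cinner_le mult_right_mono[OF norm_T_apply]]) auto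

lemma continuous_on_matrix_coeff: "continuous_on S (matrix_coeff x y)"
  unfolding matrix_coeff_def by (intro continuous_intros continuous_on_T_max)

lemma matrix_coeff_measurable [measurable]: "matrix_coeff x y \<in> borel_measurable borel"
  by (rule borel_measurable_continuous_onI[OF continuous_on_matrix_coeff])

lemma integrable_mult_matrix_coeff: "integrable lborel b \<Longrightarrow> integrable lborel (\<lambda>t. b t * matrix_coeff x y t)"
  by (rule integrable_mult_bounded[OF _ _ norm_matrix_coeff_le]) auto

lemma norm_LINT_mult_matrix_coeff_le:
  "integrable lborel b \<Longrightarrow> norm (LINT t|lborel. b t * matrix_coeff x y t) \<le> L1norm b * (C * norm x * norm y)"
  using norm_LINT_mult_le[of lborel b "matrix_coeff x y", OF _ _ norm_matrix_coeff_le]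
  by (simp add: L1norm_eq_LINT)

lemma hille_phillips_exists:
  assumes b: "integrable lborel b"
  shows "\<exists>S\<in>BH J. \<forall>x y. cinner J (blinfun_apply S x) y = (LINT t|lborel. b t * matrix_coeff x y t)"
proof (rule sesquilinear_form_representation)
  note int = integrable_mult_matrix_coeff[OF b]
  show "bounded_bilinear (\<lambda>x y. LINT t|lborel. b t * matrix_coeff x y t)"
  proof
    show "(LINT t|lborel. b t * matrix_coeff (x + x') y t)
        = (LINT t|lborel. b t * matrix_coeff x y t) + (LINT t|lborel. b t * matrix_coeff x' y t)"
      "(LINT t|lborel. b t * matrix_coeff x (y + y') t)
        = (LINT t|lborel. b t * matrix_coeff x y t) + (LINT t|lborel. b t * matrix_coeff x y' t)" for x x' y y'
      using int
      by (simp_all add: matrix_coeff_def blinfun.add_right cinner.add_left cinner.add_right distrib_left)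
    show "(LINT t|lborel. b t * matrix_coeff (r *\<^sub>R x) y t) = r *\<^sub>R (LINT t|lborel. b t * matrix_coeff x y t)"
      "(LINT t|lborel. b t * matrix_coeff x (r *\<^sub>R y) t) = r *\<^sub>R (LINT t|lborel. b t * matrix_coeff x y t)"
          for r x y
      by (simp_all add: matrix_coeff_def blinfun.scaleR_right cinner.scaleR_left cinner.scaleR_right)
    show "\<exists>K. \<forall>x y. norm (LINT t|lborel. b t * matrix_coeff x y t) \<le> norm x * norm y * K"
      using norm_LINT_mult_matrix_coeff_le[OF b] by (intro exI[of _ "L1norm b * C"]) (simp add: mult_ac)
  qed
  fix x y
  have "matrix_coeff (J x) y t = \<i> * matrix_coeff x y t" "matrix_coeff x (J y) t = - (\<i> * matrix_coeff x y t)"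
      for t
    using T_BH[of "max 0 t"] cinner_cscale[of \<i>] cinner_cscale_right[of _ \<i>]
    by (simp_all add: matrix_coeff_def BH_def cscale_def)
  then show "(LINT t|lborel. b t * matrix_coeff (J x) y t) = \<i> * (LINT t|lborel. b t * matrix_coeff x y t)"
    "(LINT t|lborel. b t * matrix_coeff x (J y) t) = - (\<i> * (LINT t|lborel. b t * matrix_coeff x y t))"
    by (simp_all add: mult.left_commute[of _ "\<i>"])
qed

text \<open>The operator \<open>\<integral> b(t) T\<^sub>t dt\<close>; unspecified if \<open>b\<close> is not integrable.\<close>

definition hille_phillips :: "(real \<Rightarrow> complex) \<Rightarrow> 'h \<Rightarrow>\<^sub>L 'h" where
  "hille_phillips b = (SOME S. S \<in> BH J \<and> (\<forall>x y. cinner J (blinfun_apply S x) y = (LINT t|lborel. b t * matrix_coeff x y t)))"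

lemma
  assumes b: "integrable lborel b"
  shows hille_phillips_BH: "hille_phillips b \<in> BH J"
    and cinner_hille_phillips: "cinner J (hille_phillips b x) y = (LINT t|lborel. b t * matrix_coeff x y t)"
  using someI_ex[OF hille_phillips_exists[OF b, unfolded Bex_def]] unfolding hille_phillips_def by auto

lemma hille_phillips_eqI:
  assumes "integrable lborel b" "\<And>x y. cinner J (blinfun_apply S x) y
      = (LINT t|lborel. b t * matrix_coeff x y t)"
  shows "hille_phillips b = S"
  by (intro blinfun_eqI cinner_eqI) (simp add: assms cinner_hille_phillips)

lemma norm_hille_phillips_le:
  assumes b: "integrable lborel b"
  shows "norm (hille_phillips b) \<le> C * L1norm b"
  using norm_LINT_mult_matrix_coeff_le[OF b]
  by (intro norm_blinfun_le_of_cinner mult_nonneg_nonneg C_nonneg L1norm_nonneg)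
     (simp add: cinner_hille_phillips[OF b] mult_ac)

lemma hille_phillips_add:
  "integrable lborel a \<Longrightarrow> integrable lborel b \<Longrightarrow>
    hille_phillips (\<lambda>t. a t + b t) = hille_phillips a + hille_phillips b"
  by (rule hille_phillips_eqI)
     (auto simp: blinfun.add_left cinner.add_left cinner_hille_phillips distrib_right
         integrable_mult_matrix_coeff)

lemma hille_phillips_diff:
  "integrable lborel a \<Longrightarrow> integrable lborel b \<Longrightarrow>
    hille_phillips (\<lambda>t. a t - b t) = hille_phillips a - hille_phillips b"
  by (rule hille_phillips_eqI)
     (auto simp: blinfun.diff_left cinner.diff_left cinner_hille_phillips left_diff_distrib
         integrable_mult_matrix_coeff)

lemma hille_phillips_cmult:
  "integrable lborel b \<Longrightarrow> hille_phillips (\<lambda>t. c * b t) = cscale_blinfun c o\<^sub>L hille_phillips b"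
  by (rule hille_phillips_eqI) (auto simp: cinner_cscale cinner_hille_phillips mult.assoc)

lemma matrix_coeff_hille_phillips:
  assumes b: "b \<in> L1_halfline" and s: "s \<ge> 0"
  shows "matrix_coeff (hille_phillips b x) y s = (LINT v|lborel. b v * matrix_coeff x y (v + s))"
proof -
  obtain S' :: "'h \<Rightarrow>\<^sub>L 'h" where S': "\<And>x y. cinner J (T s x) y = cinner J x (S' y)"
    using BH_adjoint_exists[OF T_BH[OF s]] by blast
  have "matrix_coeff (hille_phillips b x) y s = (LINT v|lborel. b v * matrix_coeff x (S' y) v)"
    using s by (simp add: matrix_coeff_def[of _ _ s] S' cinner_hille_phillips[OF L1_halflineD(1)[OF b]])
  also have "\<dots> = (LINT v|lborel. b v * matrix_coeff x y (v + s))"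
  proof (rule Bochner_Integration.integral_cong[OF refl])
    fix v
    show "b v * matrix_coeff x (S' y) v = b v * matrix_coeff x y (v + s)"
    proof (cases "v < 0")
      case False
      then have "matrix_coeff x (S' y) v = matrix_coeff x y (s + v)"
        using s T_add[OF s, of v] by (simp add: matrix_coeff_def flip: S')
      then show ?thesis by (simp add: add.commute)
    qed (simp add: L1_halflineD[OF b])
  qed
  finally show ?thesis .
qed

lemma hille_phillips_lborel_conv:
  assumes a: "a \<in> L1_halfline" and b: "b \<in> L1_halfline"
  shows "hille_phillips (lborel_conv a b) = hille_phillips a o\<^sub>L hille_phillips b"
proof (rule hille_phillips_eqI)
  note ab = L1_halflineD(1)[OF a] L1_halflineD(1)[OF b]
  show "integrable lborel (lborel_conv a b)" by (rule integrable_lborel_conv[OF ab])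
  fix x y
  have "cinner J ((hille_phillips a o\<^sub>L hille_phillips b) x) y
      = (LINT s|lborel. a s * matrix_coeff (hille_phillips b x) y s)"
    by (simp add: cinner_hille_phillips[OF ab(1)])
  also have "\<dots> = (LINT s|lborel. LINT v|lborel. a s * b v * matrix_coeff x y (v + s))"
  proof (rule Bochner_Integration.integral_cong[OF refl])
    fix s
    show "a s * matrix_coeff (hille_phillips b x) y s = (LINT v|lborel. a s * b v * matrix_coeff x y (v + s))"
      by (cases "s < 0") (auto simp: L1_halflineD[OF a] matrix_coeff_hille_phillips[OF b] mult.assoc)
  qed
  also have "\<dots> = (LINT t|lborel. lborel_conv a b t * matrix_coeff x y t)"
    by (rule LINT_lborel_conv_mult[OF ab _ norm_matrix_coeff_le, symmetric]) measurable
  finally show "cinner J ((hille_phillips a o\<^sub>L hille_phillips b) x) y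
      = (LINT t|lborel. lborel_conv a b t * matrix_coeff x y t)" .
qed

section \<open>The estimate by \<open>\<parallel>f\<parallel>\<^sub>\<infinity> \<parallel>h\<parallel>\<^sub>1\<close>\<close>

definition fejer_hankel_sum ::
  "(real \<Rightarrow> complex) \<Rightarrow> (real \<Rightarrow> complex) \<Rightarrow> real \<Rightarrow> nat \<Rightarrow> 'h \<Rightarrow> 'h \<Rightarrow> complex" where
  "fejer_hankel_sum f h \<tau> M x y = (\<Sum>n<M. of_real (1 - n / M) * (fourier h (real n * \<tau>) *
    (fourier_coeff (\<lambda>t. f (t / \<tau>)) n * matrix_coeff x y (real n * \<tau>))))"

lemma norm_fejer_hankel_sum_le:
  assumes f: "C0fun f" and h: "H1fun h" and \<tau>: "\<tau> > 0" and M: "M > 0"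
  shows "norm (fejer_hankel_sum f h \<tau> M x y) \<le> C\<^sup>2 * (supnorm f * L1norm h) * ((norm x)\<^sup>2 + (norm y)\<^sup>2) / 2"
proof -
  let ?p = "fejer_poly h \<tau> M"
  have cont: "continuous_on {-pi..pi} (\<lambda>t. f (t / \<tau>))"
    using f \<tau> unfolding C0fun_def by (auto intro!: continuous_on_compose2[of UNIV f] continuous_intros)
  have "fourier h 0 = 0" using h by (simp add: H1fun_def)
  then have "fejer_hankel_sum f h \<tau> M x y
      = coeff_pairing (\<lambda>n. fourier_coeff (\<lambda>t. f (t / \<tau>)) n * cinner J (T (real n * \<tau>) x) y) ?p"
    using \<tau> by (simp add: fejer_hankel_sum_def coeff_pairing_fejer_poly M matrix_coeff_def max_def)
  also have "norm \<dots>
      \<le> supnorm f * C\<^sup>2 * circle_mean (\<lambda>t. norm (poly ?p (cis t))) * ((norm x)\<^sup>2 + (norm y)\<^sup>2) / 2"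
    using \<tau> T_add[of "real m * \<tau>" "real k * \<tau>" for m k]
    by (intro norm_hankel_form_le cont norm_T norm_le_supnorm[OF f] T_BH) (auto simp: distrib_right)
  also have "\<dots> \<le> supnorm f * C\<^sup>2 * L1norm h * ((norm x)\<^sup>2 + (norm y)\<^sup>2) / 2"
    using \<tau> supnorm_nonneg[OF f]
    by (intro divide_right_mono mult_right_mono mult_left_mono circle_mean_norm_fejer_poly_le h M) auto
  finally show ?thesis by (simp add: mult_ac)
qed

lemma norm_fejer_hankel_sum_sampling_error_le:
  assumes f: "fourier_invertible f" and h: "H1fun h" and \<tau>: "\<tau> > 0"
  shows "norm (fejer_hankel_sum f h \<tau> M x y
      - (\<Sum>n<M. \<tau> *\<^sub>R (of_real (1 - n / M) * (conv_symbol f h (real n * \<tau>) * matrix_coeff x y (real n * \<tau>)))))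
    \<le> real M * \<tau> * (L1norm h * (L1_tail f (pi / \<tau>) / (2 * pi)) * (C * norm x * norm y))"
proof -
  let ?\<epsilon> = "\<lambda>n. fourier_coeff (\<lambda>t. f (t / \<tau>)) n - of_real \<tau> * (fourier f (real n * \<tau>) / of_real (2 * pi))"
  have "norm (of_real (1 - n / M) * (fourier h (real n * \<tau>) * ?\<epsilon> n * matrix_coeff x y (real n * \<tau>)))
      \<le> 1 * (L1norm h * (\<tau> * (L1_tail f (pi / \<tau>) / (2 * pi))) * (C * norm x * norm y))" if "n < M" for n
    unfolding norm_mult norm_of_real
    using that fourier_invertibleD[OF f] \<tau> L1norm_nonneg[of h] L1_tail_nonneg[of f "pi / \<tau>"] C_nonneg
    by (intro mult_mono norm_fourier_coeff_dilated_diff_le norm_fourier_H1fun_le h norm_matrix_coeff_le)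
       (auto simp: field_simps)
  then have "norm (\<Sum>n<M. of_real (1 - n / M) * (fourier h (real n * \<tau>) * ?\<epsilon> n * matrix_coeff x y (real n * \<tau>)))
      \<le> (\<Sum>n<M. 1 * (L1norm h * (\<tau> * (L1_tail f (pi / \<tau>) / (2 * pi))) * (C * norm x * norm y)))"
    by (intro sum_norm_le) auto
  moreover have "of_real (1 - n / M)
      * (fourier h (real n * \<tau>) * (fourier_coeff (\<lambda>t. f (t / \<tau>)) n * matrix_coeff x y (real n * \<tau>)))
      - \<tau> *\<^sub>R (of_real (1 - n / M) * (conv_symbol f h (real n * \<tau>) * matrix_coeff x y (real n * \<tau>)))
      = of_real (1 - n / M) * (fourier h (real n * \<tau>) * ?\<epsilon> n * matrix_coeff x y (real n * \<tau>))" for n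
    by (simp add: conv_symbol_def scaleR_conv_of_real right_diff_distrib left_diff_distrib mult_ac)
  ultimately show ?thesis
    by (simp add: fejer_hankel_sum_def sum_subtractf[symmetric] mult_ac)
qed

lemma norm_cesaro_integral_le:
  assumes f: "fourier_invertible f" and h: "H1fun h" and N: "N > 0"
  shows "norm (integral {0..N} (\<lambda>r. of_real (1 - r / N) * (conv_symbol f h r * matrix_coeff x y r)))
    \<le> C\<^sup>2 * (supnorm f * L1norm h) * ((norm x)\<^sup>2 + (norm y)\<^sup>2) / 2" (is "_ \<le> ?K")
proof -
  note f' = fourier_invertibleD[OF f]
  let ?\<psi> = "\<lambda>r. of_real (1 - r / N) * (conv_symbol f h r * matrix_coeff x y r)"
  define \<tau> where "\<tau> m = N / Suc m" for m
  have \<tau>: "\<tau> m > 0" "real (Suc m) * \<tau> m = N" "real n * \<tau> m / N = n / Suc m" for m n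
    using N by (simp_all add: \<tau>_def)
  define R where "R m = (\<Sum>n<Suc m. \<tau> m *\<^sub>R ?\<psi> (real n * \<tau> m))" for m
  define E where "E m = N * (L1norm h * (L1_tail f (pi / \<tau> m) / (2 * pi)) * (C * norm x * norm y))" for m
  have "norm (R m) \<le> ?K + E m" for m
  proof -
    let ?S = "fejer_hankel_sum f h (\<tau> m) (Suc m) x y"
    have "norm ?S \<le> ?K" by (rule norm_fejer_hankel_sum_le[OF f'(1) h \<tau>(1)]) simp
    moreover have "norm (?S - R m) \<le> E m"
      using norm_fejer_hankel_sum_sampling_error_le[OF f h \<tau>(1)[of m], where M = "Suc m" and x = x and y = y]
      by (simp only: R_def E_def \<tau>(2,3))
    ultimately show ?thesis using norm_triangle_ineq4[of ?S "?S - R m"] by simp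
  qed
  moreover have "R \<longlonglongrightarrow> integral {0..N} ?\<psi>"
    unfolding R_def \<tau>_def using N
    by (intro riemann_sum_tendsto continuous_intros continuous_on_matrix_coeff continuous_on_conv_symbol f h) auto
  moreover have "(\<lambda>m. ?K + E m) \<longlonglongrightarrow> ?K + N * (L1norm h * (0 / (2 * pi)) * (C * norm x * norm y))"
  proof -
    have "filterlim (\<lambda>m. pi / N * real (Suc m)) at_top sequentially"
      using N by (intro filterlim_tendsto_pos_mult_at_top[OF tendsto_const]
          filterlim_compose[OF filterlim_real_sequentially filterlim_Suc]) simp
    then have "(\<lambda>m. L1_tail f (pi / \<tau> m)) \<longlonglongrightarrow> 0"
      using filterlim_compose[OF L1_tail_tendsto_0[OF f'(3)]] by (simp add: \<tau>_def)
    then show ?thesis unfolding E_def by (intro tendsto_intros) auto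
  qed
  ultimately have "norm (integral {0..N} ?\<psi>) \<le> ?K + N * (L1norm h * (0 / (2 * pi)) * (C * norm x * norm y))"
    by (intro LIMSEQ_le[OF tendsto_norm]) auto
  then show ?thesis by simp
qed

theorem norm_hille_phillips_conv_symbol_le:
  assumes f: "fourier_invertible f" and h: "H1fun h"
  shows "norm (hille_phillips (conv_symbol f h)) \<le> C\<^sup>2 * (supnorm f * L1norm h)"
proof (rule norm_blinfun_le_of_quadratic)
  note b = L1_halflineD[OF conv_symbol_L1_halfline[OF f h]]
  show "0 \<le> C\<^sup>2 * (supnorm f * L1norm h)"
    using supnorm_nonneg[OF fourier_invertibleD(1)[OF f]] L1norm_nonneg[of h] by simp
  fix x y :: 'h
  let ?K = "C\<^sup>2 * (supnorm f * L1norm h) * ((norm x)\<^sup>2 + (norm y)\<^sup>2) / 2"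
  have "(\<lambda>k. integral {0..real (Suc k)} (\<lambda>r. of_real (1 - r / Suc k) * (conv_symbol f h r * matrix_coeff x y r)))
      \<longlonglongrightarrow> (LINT r|lborel. conv_symbol f h r * matrix_coeff x y r)"
  proof (rule cesaro_mean_tendsto[OF integrable_mult_matrix_coeff[OF b(1)]])
    show "continuous_on {0..} (\<lambda>r. conv_symbol f h r * matrix_coeff x y r)"
      by (intro continuous_intros continuous_on_matrix_coeff continuous_on_conv_symbol f h)
  qed (simp add: b(2))
  from tendsto_norm[OF this] have "norm (LINT r|lborel. conv_symbol f h r * matrix_coeff x y r) \<le> ?K"
    by (rule LIMSEQ_le_const2) (intro exI[of _ 0] allI impI norm_cesaro_integral_le f h, simp)
  then show "inner (hille_phillips (conv_symbol f h) x) y \<le> ?K"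
    using complex_Re_le_cmod[of "cinner J (hille_phillips (conv_symbol f h) x) y"]
    by (simp add: cinner_hille_phillips[OF b(1), symmetric]) (simp add: cinner_def)
qed

end

section \<open>Damping\<close>

definition damp :: "real \<Rightarrow> (real \<Rightarrow> complex) \<Rightarrow> real \<Rightarrow> complex" where
  "damp \<delta> b t = b t * laplace_kernel (of_real \<delta>) t"

lemma damp_0 [simp]: "damp 0 b = b"
  by (simp add: damp_def fun_eq_iff)

lemma damp_add: "damp \<delta> (\<lambda>t. a t + b t) = (\<lambda>t. damp \<delta> a t + damp \<delta> b t)"
  by (simp add: damp_def fun_eq_iff distrib_right)

lemma damp_diff: "damp \<delta> (\<lambda>t. a t - b t) = (\<lambda>t. damp \<delta> a t - damp \<delta> b t)"
  by (simp add: damp_def fun_eq_iff left_diff_distrib)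

lemma damp_cmult: "damp \<delta> (\<lambda>t. c * b t) = (\<lambda>t. c * damp \<delta> b t)"
  by (simp add: damp_def fun_eq_iff)

lemma norm_damp_le: "\<delta> \<ge> 0 \<Longrightarrow> norm (damp \<delta> b t) \<le> norm (b t)"
  using mult_left_mono[OF norm_laplace_kernel_le[of "of_real \<delta>" t], of "norm (b t)"]
  by (simp add: damp_def norm_mult)

lemma integrable_damp: "integrable lborel b \<Longrightarrow> \<delta> \<ge> 0 \<Longrightarrow> integrable lborel (damp \<delta> b)"
  unfolding damp_def by (rule integrable_mult_laplace_kernel) auto

lemma damp_L1_halfline: "b \<in> L1_halfline \<Longrightarrow> \<delta> \<ge> 0 \<Longrightarrow> damp \<delta> b \<in> L1_halfline"
  by (auto simp: L1_halfline_def integrable_damp) (simp add: damp_def)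

lemma L1norm_damp_le: "integrable lborel b \<Longrightarrow> \<delta> \<ge> 0 \<Longrightarrow> L1norm (damp \<delta> b) \<le> L1norm b"
  by (simp add: L1norm_eq_LINT integrable_damp norm_damp_le integral_mono)

lemma L1norm_damp_le_of_bounded:
  assumes b: "b \<in> L1_halfline" and \<delta>: "\<delta> > 0" and le: "\<And>t. norm (b t) \<le> B"
  shows "L1norm (damp \<delta> b) \<le> B / \<delta>"
proof -
  have damp_mem: "damp \<delta> b \<in> L1_halfline" using b \<delta> by (simp add: damp_L1_halfline)
  have exp_int: "((\<lambda>t. B * exp (- \<delta> * t)) has_integral B * (exp (- \<delta> * 0) / \<delta>)) {0..}"
    by (intro has_integral_mult_right has_integral_exp_minus_to_infinity \<delta>)
  have "L1norm (damp \<delta> b) = integral {0..} (\<lambda>t. norm (damp \<delta> b t))"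
    unfolding L1norm_def using L1_halflineD(2)[OF damp_mem]
    by (subst integral_restrict_UNIV[symmetric]) (auto intro!: integral_cong)
  also have "\<dots> \<le> integral {0..} (\<lambda>t. B * exp (- \<delta> * t))"
  proof (rule integral_le)
    show "(\<lambda>t. norm (damp \<delta> b t)) integrable_on {0..}"
      using absolutely_integrable_on_lborel[OF L1_halflineD(1)[OF damp_mem]]
      by (simp add: absolutely_integrable_on_def)
    show "norm (damp \<delta> b t) \<le> B * exp (- \<delta> * t)" if "t \<in> {0..}" for t
      using that le[of t]
      by (simp add: damp_def laplace_kernel_def norm_mult mult_right_mono mult.commute[of \<delta>])
  qed (use exp_int in blast)
  also have "\<dots> = B / \<delta>" using integral_unique[OF exp_int] by simp
  finally show ?thesis .
qed

lemma damp_lborel_conv: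
  assumes ab: "a \<in> L1_halfline" "b \<in> L1_halfline"
  shows "damp \<delta> (lborel_conv a b) = lborel_conv (damp \<delta> a) (damp \<delta> b)"
proof
  fix r
  have "a s * b (r - s) * laplace_kernel (of_real \<delta>) r = damp \<delta> a s * damp \<delta> b (r - s)" for s
    using ab laplace_kernel_add[of s "r - s" "of_real \<delta>"]
    by (cases "s < 0 \<or> r - s < 0") (auto simp: L1_halflineD damp_def)
  then show "damp \<delta> (lborel_conv a b) r = lborel_conv (damp \<delta> a) (damp \<delta> b) r"
    by (simp add: lborel_conv_def damp_def[of _ "lborel_conv a b"] flip: integral_mult_left_zero)
qed

context bounded_semigroup
begin

lemma damped_semigroup:
  assumes \<delta>: "\<delta> \<ge> 0"
  shows "bounded_semigroup J (\<lambda>t. exp (- (\<delta> * t)) *\<^sub>R T t) C"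
proof unfold_locales
  show bound: "norm (exp (- (\<delta> * t)) *\<^sub>R T t) \<le> C" if "t \<ge> 0" for t
  proof -
    have "exp (- (\<delta> * t)) * norm (T t) \<le> 1 * C"
      using \<delta> that norm_T[OF that] by (intro mult_mono) auto
    then show ?thesis by simp
  qed
  show "bounded_C0_semigroup J (\<lambda>t. exp (- (\<delta> * t)) *\<^sub>R T t)"
    unfolding bounded_C0_semigroup_def
  proof (intro conjI allI impI)
    show "exp (- (\<delta> * t)) *\<^sub>R T t \<in> BH J" if "t \<ge> 0" for t
      using T_BH[OF that] by (simp add: BH_def blinfun.scaleR_left J.scaleR)
    show "exp (- (\<delta> * 0)) *\<^sub>R T 0 = id_blinfun" by (simp add: T_0)
    show "exp (- (\<delta> * (s + t))) *\<^sub>R T (s + t) = (exp (- (\<delta> * s)) *\<^sub>R T s) o\<^sub>L (exp (- (\<delta> * t)) *\<^sub>R T t)"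
      if "s \<ge> 0" "t \<ge> 0" for s t
      by (rule blinfun_eqI)
         (simp add: T_add[OF that] blinfun.scaleR_left blinfun.scaleR_right mult_exp_exp algebra_simps)
    show "continuous_on {0..} (\<lambda>t. (exp (- (\<delta> * t)) *\<^sub>R T t) x)" for x
      unfolding blinfun.scaleR_left by (intro continuous_intros continuous_on_T)
    show "\<exists>M. \<forall>t\<ge>0. norm (exp (- (\<delta> * t)) *\<^sub>R T t) \<le> M" using bound by blast
  qed
qed

lemma norm_hille_phillips_damp_conv_symbol_le:
  assumes f: "fourier_invertible f" and h: "H1fun h" and \<delta>: "\<delta> \<ge> 0"
  shows "norm (hille_phillips (damp \<delta> (conv_symbol f h))) \<le> C\<^sup>2 * (supnorm f * L1norm h)"
proof -
  interpret D: bounded_semigroup J "\<lambda>t. exp (- (\<delta> * t)) *\<^sub>R T t" C by (rule damped_semigroup[OF \<delta>])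
  note b = L1_halflineD(1)[OF conv_symbol_L1_halfline[OF f h]]
  have "D.matrix_coeff x y t = laplace_kernel (of_real \<delta>) t * matrix_coeff x y t" for x y t
    unfolding D.matrix_coeff_def matrix_coeff_def laplace_kernel_def
    by (simp add: blinfun.scaleR_left cinner.scaleR_left scaleR_conv_of_real mult.commute flip: exp_of_real)
  then have "hille_phillips (damp \<delta> (conv_symbol f h)) = D.hille_phillips (conv_symbol f h)"
    by (intro hille_phillips_eqI integrable_damp b \<delta>)
       (simp add: D.cinner_hille_phillips[OF b] damp_def mult.assoc)
  then show ?thesis using D.norm_hille_phillips_conv_symbol_le[OF f h] by simp
qed

lemma norm_hille_phillips_damp_le:
  assumes "integrable lborel b" "\<delta> \<ge> 0"
  shows "norm (hille_phillips (damp \<delta> b)) \<le> C * L1norm b"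
  by (rule order_trans[OF norm_hille_phillips_le[OF integrable_damp[OF assms]]
        mult_left_mono[OF L1norm_damp_le[OF assms] C_nonneg]])

end

section \<open>The strong integral\<close>

lemma norm_riemann_term_mult_error_le:
  fixes b \<theta> :: "'n::euclidean_space \<Rightarrow> complex"
  assumes b: "b integrable_on K" "(\<lambda>s. norm (b s)) integrable_on K" "(\<lambda>s. b s * \<theta> s) integrable_on K"
    and \<theta>: "norm (\<theta> t) \<le> B" "\<And>s. s \<in> K \<Longrightarrow> norm (\<theta> t - \<theta> s) \<le> \<eta>"
  shows "norm (measure lborel K *\<^sub>R (b t * \<theta> t) - integral K (\<lambda>s. b s * \<theta> s))
    \<le> norm (measure lborel K *\<^sub>R b t - integral K b) * B + integral K (\<lambda>s. norm (b s)) * \<eta>"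
proof -
  have int: "(\<lambda>s. b s * (\<theta> t - \<theta> s)) integrable_on K"
    unfolding right_diff_distrib
    by (intro Henstock_Kurzweil_Integration.integrable_diff b integrable_on_mult_left)
  have "integral K (\<lambda>s. b s * (\<theta> t - \<theta> s)) = integral K b * \<theta> t - integral K (\<lambda>s. b s * \<theta> s)"
    unfolding right_diff_distrib using b
    by (simp add: Henstock_Kurzweil_Integration.integral_diff integrable_on_mult_left)
  then have "measure lborel K *\<^sub>R (b t * \<theta> t) - integral K (\<lambda>s. b s * \<theta> s)
      = (measure lborel K *\<^sub>R b t - integral K b) * \<theta> t + integral K (\<lambda>s. b s * (\<theta> t - \<theta> s))"
    by (simp add: left_diff_distrib)
  moreover have "norm ((measure lborel K *\<^sub>R b t - integral K b) * \<theta> t)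
      \<le> norm (measure lborel K *\<^sub>R b t - integral K b) * B"
    unfolding norm_mult by (intro mult_left_mono \<theta>) simp
  moreover have "norm (integral K (\<lambda>s. b s * (\<theta> t - \<theta> s))) \<le> integral K (\<lambda>s. norm (b s) * \<eta>)"
    by (intro integral_norm_bound_integral int integrable_on_mult_left b) (simp add: norm_mult mult_left_mono \<theta>)
  ultimately show ?thesis by (simp add: norm_triangle_mono)
qed

lemma norm_riemann_sum_mult_error_le:
  fixes b \<theta> :: "'n::euclidean_space \<Rightarrow> complex"
  assumes D: "D tagged_division_of cbox a d"
    and b: "b absolutely_integrable_on cbox a d" "(\<lambda>s. b s * \<theta> s) integrable_on cbox a d"
    and \<theta>: "\<And>t. t \<in> cbox a d \<Longrightarrow> norm (\<theta> t) \<le> B"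
      "\<And>t K s. (t, K) \<in> D \<Longrightarrow> s \<in> K \<Longrightarrow> norm (\<theta> t - \<theta> s) \<le> \<eta>"
  shows "norm ((\<Sum>(t, K)\<in>D. measure lborel K *\<^sub>R (b t * \<theta> t)) - integral (cbox a d) (\<lambda>s. b s * \<theta> s))
    \<le> (\<Sum>(t, K)\<in>D. norm (measure lborel K *\<^sub>R b t - integral K b)) * B
        + integral (cbox a d) (\<lambda>s. norm (b s)) * \<eta>"
proof -
  have int: "b integrable_on cbox a d" "(\<lambda>s. norm (b s)) integrable_on cbox a d"
    using b(1) by (auto simp: absolutely_integrable_on_def)
  have cell: "norm (measure lborel K *\<^sub>R (b t * \<theta> t) - integral K (\<lambda>s. b s * \<theta> s))
      \<le> norm (measure lborel K *\<^sub>R b t - integral K b) * B + integral K (\<lambda>s. norm (b s)) * \<eta>"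
    if tK: "(t, K) \<in> D" for t K
  proof -
    obtain u w where K: "K = cbox u w" "K \<subseteq> cbox a d" "t \<in> K"
      using tagged_division_ofD(2-4)[OF D tK] by blast
    show ?thesis
    proof (rule norm_riemann_term_mult_error_le)
      show "b integrable_on K" "(\<lambda>s. norm (b s)) integrable_on K" "(\<lambda>s. b s * \<theta> s) integrable_on K"
        using int b(2) K(2) unfolding K(1) by (blast intro: integrable_on_subcbox)+
    qed (use K \<theta>(1) \<theta>(2)[OF tK] in auto)
  qed
  have "norm ((\<Sum>(t, K)\<in>D. measure lborel K *\<^sub>R (b t * \<theta> t)) - integral (cbox a d) (\<lambda>s. b s * \<theta> s))
      = norm (\<Sum>(t, K)\<in>D. measure lborel K *\<^sub>R (b t * \<theta> t) - integral K (\<lambda>s. b s * \<theta> s))"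
    by (simp add: integral_combine_tagged_division_topdown[OF b(2) D] sum_subtractf split_def)
  also have "\<dots>
      \<le> (\<Sum>(t, K)\<in>D. norm (measure lborel K *\<^sub>R b t - integral K b) * B + integral K (\<lambda>s. norm (b s)) * \<eta>)"
    using cell by (intro sum_norm_le) auto
  also have "\<dots> = (\<Sum>(t, K)\<in>D. norm (measure lborel K *\<^sub>R b t - integral K b)) * B
      + integral (cbox a d) (\<lambda>s. norm (b s)) * \<eta>"
    by (simp add: integral_combine_tagged_division_topdown[OF int(2) D] split_def sum.distrib sum_distrib_right)
  finally show ?thesis .
qed

context cplx_hilbert
begin

lemma norm_riemann_sum_cscale_diff_le:
  fixes b :: "'n::euclidean_space \<Rightarrow> complex"
  assumes D: "D tagged_division_of cbox a d" and b: "b absolutely_integrable_on cbox a d"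
    and y: "\<And>v. ((\<lambda>t. b t * cinner J (k t) v) has_integral cinner J y v) (cbox a d)"
    and B: "\<And>t. t \<in> cbox a d \<Longrightarrow> norm (k t) \<le> B" "B \<ge> 0"
    and \<eta>: "\<And>t K s. (t, K) \<in> D \<Longrightarrow> s \<in> K \<Longrightarrow> norm (k t - k s) \<le> \<eta>" "\<eta> \<ge> 0"
  shows "norm ((\<Sum>(t, K)\<in>D. measure lborel K *\<^sub>R cscale J (b t) (k t)) - y)
    \<le> (\<Sum>(t, K)\<in>D. norm (measure lborel K *\<^sub>R b t - integral K b)) * B
        + integral (cbox a d) (\<lambda>s. norm (b s)) * \<eta>"
    (is "norm (?S - y) \<le> ?E * B + ?n * \<eta>")
proof (rule norm_le_of_cinner)
  show "0 \<le> ?E * B + ?n * \<eta>"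
    using b B(2) \<eta>(2)
    by (intro add_nonneg_nonneg mult_nonneg_nonneg sum_nonneg integral_nonneg)
       (auto simp: absolutely_integrable_on_def)
  fix v
  have "cinner J (?S - y) v = (\<Sum>(t, K)\<in>D. measure lborel K *\<^sub>R (b t * cinner J (k t) v))
      - integral (cbox a d) (\<lambda>s. b s * cinner J (k s) v)"
    by (simp add: cinner.diff_left cinner.sum_left cinner.scaleR_left cinner_cscale
        integral_unique[OF y] split_def)
  also have "norm \<dots> \<le> ?E * (B * norm v) + ?n * (\<eta> * norm v)"
  proof (rule norm_riemann_sum_mult_error_le[OF D b has_integral_integrable[OF y]])
    show "norm (cinner J (k t) v) \<le> B * norm v" if "t \<in> cbox a d" for t
      using B(1)[OF that] by (rule order_trans[OF norm_cinner_le mult_right_mono]) simp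
    show "norm (cinner J (k t) v - cinner J (k s) v) \<le> \<eta> * norm v" if "(t, K) \<in> D" "s \<in> K" for t K s
      unfolding cinner.diff_left[symmetric] using \<eta>(1)[OF that]
      by (rule order_trans[OF norm_cinner_le mult_right_mono]) simp
  qed
  finally show "norm (cinner J (?S - y) v) \<le> (?E * B + ?n * \<eta>) * norm v" by (simp add: distrib_right mult.assoc)
qed

text \<open>Without a \<open>banach\<close> instance the library provides no integrability criterion, so the Riemann
  sums are compared with a weak integral.\<close>

lemma has_integral_cscale_of_weak:
  fixes b :: "'n::euclidean_space \<Rightarrow> complex"
  assumes b: "b absolutely_integrable_on cbox a d" and k: "continuous_on (cbox a d) k"
    and y: "\<And>v. ((\<lambda>t. b t * cinner J (k t) v) has_integral cinner J y v) (cbox a d)"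
  shows "((\<lambda>t. cscale J (b t) (k t)) has_integral y) (cbox a d)"
  unfolding has_integral
proof (intro allI impI)
  fix e :: real assume e: "e > 0"
  have int: "b integrable_on cbox a d" "(\<lambda>s. norm (b s)) integrable_on cbox a d"
    using b by (auto simp: absolutely_integrable_on_def)
  obtain B where B: "B > 0" "\<And>t. t \<in> cbox a d \<Longrightarrow> norm (k t) \<le> B"
    using compact_imp_bounded[OF compact_continuous_image[OF k compact_cbox]] by (auto simp: bounded_pos)
  define n where "n = integral (cbox a d) (\<lambda>s. norm (b s)) + 1"
  have n: "n > 0" using integral_nonneg[OF int(2)] by (simp add: n_def add_nonneg_pos)
  obtain \<gamma> where \<gamma>: "gauge \<gamma>" "\<And>D. D tagged_partial_division_of cbox a d \<Longrightarrow> \<gamma> fine D \<Longrightarrow>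
      (\<Sum>(t, K)\<in>D. norm (measure lborel K *\<^sub>R b t - integral K b)) < e / (4 * B)"
    using Henstock_lemma[OF int(1), of "e / (4 * B)"] e B by auto
  obtain \<eta> where \<eta>: "\<eta> > 0"
    "\<And>s t. s \<in> cbox a d \<Longrightarrow> t \<in> cbox a d \<Longrightarrow> dist s t < \<eta> \<Longrightarrow> dist (k s) (k t) < e / (4 * n)"
    using compact_uniformly_continuous[OF k compact_cbox] e n unfolding uniformly_continuous_on_def
    by (metis divide_pos_pos mult_pos_pos zero_less_numeral)
  show "\<exists>\<gamma>. gauge \<gamma> \<and> (\<forall>D. D tagged_division_of cbox a d \<and> \<gamma> fine D \<longrightarrow>
      norm ((\<Sum>(t, K)\<in>D. measure lborel K *\<^sub>R cscale J (b t) (k t)) - y) < e)"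
  proof (intro exI[of _ "\<lambda>t. \<gamma> t \<inter> ball t \<eta>"] conjI allI impI gauge_Int gauge_ball \<gamma>(1) \<eta>(1))
    fix D assume "D tagged_division_of cbox a d \<and> (\<lambda>t. \<gamma> t \<inter> ball t \<eta>) fine D"
    then have D: "D tagged_division_of cbox a d" "\<gamma> fine D" "(\<lambda>t. ball t \<eta>) fine D"
      by (auto simp: fine_Int)
    let ?E = "\<Sum>(t, K)\<in>D. norm (measure lborel K *\<^sub>R b t - integral K b)"
    have E: "?E < e / (4 * B)"
      using \<gamma>(2)[OF _ D(2)] D(1) by (simp add: tagged_division_of_def)
    have osc: "norm (k t - k s) \<le> e / (4 * n)" if "(t, K) \<in> D" "s \<in> K" for t K s
    proof -
      have "t \<in> cbox a d" "s \<in> cbox a d" "dist t s < \<eta>"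
        using that tagged_division_ofD(2,3)[OF D(1) that(1)] fineD[OF D(3) that(1)] by auto
      then show ?thesis using \<eta>(2)[of t s] by (simp add: dist_norm less_imp_le)
    qed
    have "norm ((\<Sum>(t, K)\<in>D. measure lborel K *\<^sub>R cscale J (b t) (k t)) - y)
        \<le> ?E * B + integral (cbox a d) (\<lambda>s. norm (b s)) * (e / (4 * n))"
      using e B n by (intro norm_riemann_sum_cscale_diff_le[OF D(1) b y _ _ osc]) auto
    also have "\<dots> \<le> e / (4 * B) * B + n * (e / (4 * n))"
      using E e B n by (intro add_mono mult_right_mono) (auto simp: n_def)
    also have "\<dots> < e" using e B n by simp
    finally show "norm ((\<Sum>(t, K)\<in>D. measure lborel K *\<^sub>R cscale J (b t) (k t)) - y) < e" .
  qed
qed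

end

context bounded_semigroup
begin

lemma has_integral_interval_hille_phillips:
  assumes b: "integrable lborel b"
  shows "((\<lambda>t. cscale J (b t) (T (max 0 t) x)) has_integral
    hille_phillips (\<lambda>t. indicator {a..d} t *\<^sub>R b t) x) (cbox a d)"
proof (rule has_integral_cscale_of_weak[OF absolutely_integrable_on_lborel[OF b] continuous_on_T_max])
  fix v
  have "set_integrable lborel {a..d} (\<lambda>t. b t * matrix_coeff x v t)"
    unfolding set_integrable_def by (intro integrable_mult_indicator integrable_mult_matrix_coeff b) simp
  then have "((\<lambda>t. b t * matrix_coeff x v t) has_integral (LINT t:{a..d}|lborel. b t * matrix_coeff x v t)) {a..d}"
    by (simp add: set_borel_integral_eq_integral has_integral_integral[symmetric])
  then show "((\<lambda>t. b t * cinner J (T (max 0 t) x) v) has_integral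
      cinner J (hille_phillips (\<lambda>t. indicator {a..d} t *\<^sub>R b t) x) v) (cbox a d)"
    using integrable_mult_indicator[OF _ b, of "{a..d}"]
    by (simp add: cinner_hille_phillips set_lebesgue_integral_def matrix_coeff_def)
qed simp

lemma norm_hille_phillips_restrict_diff_le:
  assumes b: "integrable lborel b" and sub: "ball 0 R \<subseteq> {u..v}"
  shows "norm (hille_phillips (\<lambda>t. indicator {u..v} t *\<^sub>R b t) - hille_phillips b) \<le> C * L1_tail b R"
proof -
  have int: "integrable lborel (\<lambda>t. indicator {u..v} t *\<^sub>R b t)" using b
    by (intro integrable_mult_indicator) auto
  have pointwise: "norm (indicator {u..v} t *\<^sub>R b t - b t) \<le> norm (b t) * indicator {t. R \<le> \<bar>t\<bar>} t" for t
    using sub by (auto simp: indicator_def subset_iff not_le)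
  have "norm (hille_phillips (\<lambda>t. indicator {u..v} t *\<^sub>R b t - b t))
      \<le> C * L1norm (\<lambda>t. indicator {u..v} t *\<^sub>R b t - b t)"
    by (intro norm_hille_phillips_le Bochner_Integration.integrable_diff int b)
  also have "L1norm (\<lambda>t. indicator {u..v} t *\<^sub>R b t - b t) \<le> L1_tail b R"
    unfolding L1norm_eq_LINT[OF Bochner_Integration.integrable_diff[OF int b]] L1_tail_def
    using integrable_mult_indicator[of "{t. R \<le> \<bar>t\<bar>}" lborel "\<lambda>t. norm (b t)"] int b
    by (intro integral_mono pointwise) (auto simp: mult.commute)
  finally show ?thesis
    by (simp add: hille_phillips_diff[OF int b] mult_left_mono C_nonneg)
qed

theorem hille_phillips_has_integral:
  assumes b: "b \<in> L1_halfline"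
  shows "((\<lambda>t. cscale J (b t) (T t x)) has_integral hille_phillips b x) {0..}"
proof -
  note b' = L1_halflineD[OF b]
  have extend: "(if t \<in> {0..} then cscale J (b t) (T t x) else 0) = cscale J (b t) (T (max 0 t) x)" for t
    by (simp add: cscale_def max_def b'(2))
  have "\<exists>B>0. \<forall>u v. ball 0 B \<subseteq> cbox u v \<longrightarrow>
      (\<exists>z. ((\<lambda>t. if t \<in> {0..} then cscale J (b t) (T t x) else 0) has_integral z) (cbox u v) \<and>
        norm (z - hille_phillips b x) < e)" if "e > 0" for e
  proof -
    have "((\<lambda>R. C * L1_tail b R * norm x) \<longlongrightarrow> C * 0 * norm x) at_top"
      by (intro tendsto_intros L1_tail_tendsto_0 b')
    then have "eventually (\<lambda>R. R > 0 \<and> C * L1_tail b R * norm x < e) at_top"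
      using that by (intro eventually_conj eventually_gt_at_top order_tendstoD(2)) auto
    then obtain R where R: "R > 0" "C * L1_tail b R * norm x < e"
      by (auto simp: eventually_at_top_linorder)
    show ?thesis unfolding extend
    proof (intro exI[of _ R] conjI allI impI R(1))
      fix u v :: real assume "ball 0 R \<subseteq> cbox u v"
      then have "norm (hille_phillips (\<lambda>t. indicator {u..v} t *\<^sub>R b t) - hille_phillips b) \<le> C * L1_tail b R"
        by (intro norm_hille_phillips_restrict_diff_le b') simp
      then have "norm (hille_phillips (\<lambda>t. indicator {u..v} t *\<^sub>R b t) x - hille_phillips b x) < e"
        unfolding blinfun.diff_left[symmetric] using R(2)
        by (meson norm_blinfun mult_right_mono norm_ge_zero order_trans le_less_trans)
      then show "\<exists>z. ((\<lambda>t. cscale J (b t) (T (max 0 t) x)) has_integral z) (cbox u v)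
          \<and> norm (z - hille_phillips b x) < e"
        using has_integral_interval_hille_phillips[OF b'(1)] by blast
    qed
  qed
  then show ?thesis by (subst has_integral_alt) (simp add: not_Ici_eq_Icc)
qed

end

section \<open>The closure of the Hille--Phillips calculus\<close>

lemma uniform_limit_of_norm_le:
  fixes f :: "nat \<Rightarrow> 'a \<Rightarrow> 'b::real_normed_vector"
  assumes "e \<longlonglongrightarrow> 0" "\<And>n x. x \<in> S \<Longrightarrow> norm (f n x - l x) \<le> e n"
  shows "uniform_limit S f l sequentially"
proof (rule uniform_limitI)
  fix r :: real assume "r > 0"
  then have "\<forall>\<^sub>F n in sequentially. e n < r" using order_tendstoD(2)[OF assms(1)] by blast
  then show "\<forall>\<^sub>F n in sequentially. \<forall>x\<in>S. dist (f n x) (l x) < r"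
    by eventually_elim (auto simp: dist_norm intro: le_less_trans[OF assms(2)])
qed

lemma uniform_limit_transform:
  "uniform_limit S f l F \<Longrightarrow> (\<And>n x. x \<in> S \<Longrightarrow> f n x = g n x) \<Longrightarrow> uniform_limit S g l F"
  using uniform_limit_cong'[of S f g l l F] by blast

lemma uniform_limit_tildeF_conv:
  assumes f: "C0fun f" and g: "\<And>n. C0fun (g n)" and h: "H1fun h"
    and e: "e \<longlonglongrightarrow> 0" and le: "\<And>n t. norm (f t - g n t) \<le> e n"
  shows "uniform_limit S (\<lambda>n. tildeF (conv (g n) h)) (tildeF (conv f h)) sequentially"
proof (rule uniform_limit_of_norm_le)
  show "(\<lambda>n. e n * L1norm h) \<longlonglongrightarrow> 0" using e by (rule tendsto_mult_left_zero)
  fix n z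
  have "supnorm (\<lambda>t. g n t - f t) * L1norm h \<le> e n * L1norm h"
    by (intro mult_right_mono supnorm_le L1norm_nonneg) (metis le norm_minus_commute)
  then show "norm (tildeF (conv (g n) h) z - tildeF (conv f h) z) \<le> e n * L1norm h"
    using norm_tildeF_conv_diff_le[OF g f h, of n z] by linarith
qed

lemma mult_inverse_Suc_tendsto_0: "(\<lambda>n. K * (1 / real (Suc n))) \<longlonglongrightarrow> 0"
  using tendsto_mult_right_zero[OF LIMSEQ_Suc[OF lim_const_over_n[of 1]]] by simp

context bounded_semigroup
begin

text \<open>The pair \<open>(\<phi>, \<beta>)\<close> is a limit of the pairs \<open>(L\<^sub>b, \<delta> \<mapsto> L\<^sub>b(A + \<delta>))\<close>, uniformly on the
  half-plane and uniformly in \<open>\<delta> \<ge> 0\<close>; then \<open>\<phi>(A)\<close> is \<open>\<beta> 0\<close>. The family in \<open>\<delta>\<close> is what makes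
  the calculus single-valued: \<open>\<beta> \<delta>\<close> for \<open>\<delta> > 0\<close> is determined by \<open>\<phi>\<close>. Products of elements of
  \<open>\<A>\<^sub>0\<close> belong to the domain without showing that \<open>\<A>\<^sub>0\<close> is an algebra.\<close>

definition calculus_limit ::
  "(nat \<Rightarrow> real \<Rightarrow> complex) \<Rightarrow> (complex \<Rightarrow> complex) \<Rightarrow> (real \<Rightarrow> 'h \<Rightarrow>\<^sub>L 'h) \<Rightarrow> bool" where
  "calculus_limit b \<phi> \<beta> \<longleftrightarrow> (\<forall>n. b n \<in> L1_halfline) \<and>
     uniform_limit {z. 0 < Re z} (\<lambda>n. laplace (b n)) \<phi> sequentially \<and>
     uniform_limit {0..} (\<lambda>n \<delta>. hille_phillips (damp \<delta> (b n))) \<beta> sequentially"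

definition calculus_pair :: "(complex \<Rightarrow> complex) \<Rightarrow> (real \<Rightarrow> 'h \<Rightarrow>\<^sub>L 'h) \<Rightarrow> bool" where
  "calculus_pair \<phi> \<beta> \<longleftrightarrow> (\<exists>b. calculus_limit b \<phi> \<beta>)"

lemma calculus_limitD:
  assumes "calculus_limit b \<phi> \<beta>"
  shows "b n \<in> L1_halfline" "integrable lborel (b n)"
    "uniform_limit {z. 0 < Re z} (\<lambda>n. laplace (b n)) \<phi> sequentially"
    "uniform_limit {0..} (\<lambda>n \<delta>. hille_phillips (damp \<delta> (b n))) \<beta> sequentially"
  using assms by (auto simp: calculus_limit_def L1_halflineD)

lemma calculus_pair_laplace: "b \<in> L1_halfline \<Longrightarrow> calculus_pair (laplace b) (\<lambda>\<delta>. hille_phillips (damp \<delta> b))"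
  unfolding calculus_pair_def calculus_limit_def
  by (intro exI[of _ "\<lambda>_. b"] conjI allI uniform_limit_const)

lemma calculus_pair_add:
  assumes "calculus_pair \<phi> \<beta>" "calculus_pair \<psi> \<gamma>"
  shows "calculus_pair (\<lambda>z. \<phi> z + \<psi> z) (\<lambda>\<delta>. \<beta> \<delta> + \<gamma> \<delta>)"
proof -
  obtain a b where "calculus_limit a \<phi> \<beta>" "calculus_limit b \<psi> \<gamma>"
    using assms unfolding calculus_pair_def by blast
  note a = calculus_limitD[OF this(1)] and b = calculus_limitD[OF this(2)]
  have "calculus_limit (\<lambda>n t. a n t + b n t) (\<lambda>z. \<phi> z + \<psi> z) (\<lambda>\<delta>. \<beta> \<delta> + \<gamma> \<delta>)"
    unfolding calculus_limit_def
  proof (intro conjI allI L1_halfline_add a(1) b(1))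
    show "uniform_limit {z. 0 < Re z} (\<lambda>n. laplace (\<lambda>t. a n t + b n t)) (\<lambda>z. \<phi> z + \<psi> z) sequentially"
      by (rule uniform_limit_transform[OF uniform_limit_add[OF a(3) b(3)]]) (simp add: laplace_add a b)
    show "uniform_limit {0..} (\<lambda>n \<delta>. hille_phillips (damp \<delta> (\<lambda>t. a n t + b n t))) (\<lambda>\<delta>. \<beta> \<delta> + \<gamma> \<delta>) sequentially"
      by (rule uniform_limit_transform[OF uniform_limit_add[OF a(4) b(4)]])
         (simp add: damp_add hille_phillips_add integrable_damp a b)
  qed
  then show ?thesis unfolding calculus_pair_def by blast
qed

lemma calculus_pair_cmult:
  assumes "calculus_pair \<phi> \<beta>"
  shows "calculus_pair (\<lambda>z. c * \<phi> z) (\<lambda>\<delta>. cscale_blinfun c o\<^sub>L \<beta> \<delta>)"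
proof -
  obtain b where "calculus_limit b \<phi> \<beta>" using assms unfolding calculus_pair_def by blast
  note b = calculus_limitD[OF this]
  have "calculus_limit (\<lambda>n t. c * b n t) (\<lambda>z. c * \<phi> z) (\<lambda>\<delta>. cscale_blinfun c o\<^sub>L \<beta> \<delta>)"
    unfolding calculus_limit_def
  proof (intro conjI allI L1_halfline_cmult b(1))
    show "uniform_limit {z. 0 < Re z} (\<lambda>n. laplace (\<lambda>t. c * b n t)) (\<lambda>z. c * \<phi> z) sequentially"
      by (rule uniform_limit_transform[OF bounded_linear.uniform_limit[OF bounded_linear_mult_right b(3)]])
         (simp add: laplace_cmult b)
    show "uniform_limit {0..} (\<lambda>n \<delta>. hille_phillips (damp \<delta> (\<lambda>t. c * b n t))) (\<lambda>\<delta>. cscale_blinfun c o\<^sub>L \<beta> \<delta>) sequentially"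
      by (rule uniform_limit_transform[OF bounded_linear.uniform_limit[OF
            bounded_bilinear.bounded_linear_right[OF bounded_bilinear_blinfun_compose] b(4)]])
         (simp add: damp_cmult hille_phillips_cmult integrable_damp b)
  qed
  then show ?thesis unfolding calculus_pair_def by blast
qed

lemma calculus_limit_bounded:
  assumes "calculus_limit b \<phi> \<beta>"
  shows "bounded (\<phi> ` {z. 0 < Re z})" "bounded (\<beta> ` {0..})"
proof -
  note b = calculus_limitD[OF assms]
  have "bounded (laplace (b n) ` {z. 0 < Re z})" for n
    unfolding bounded_iff using norm_laplace_le[OF b(1)] by blast
  then show "bounded (\<phi> ` {z. 0 < Re z})"
    by (intro uniform_limit_bounded[OF b(3)]) auto
  have "bounded ((\<lambda>\<delta>. hille_phillips (damp \<delta> (b n))) ` {0..})" for n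
    unfolding bounded_iff using norm_hille_phillips_damp_le[OF b(2)] by force
  then show "bounded (\<beta> ` {0..})"
    by (intro uniform_limit_bounded[OF b(4)]) auto
qed

lemma calculus_pair_mult:
  assumes "calculus_pair \<phi> \<beta>" "calculus_pair \<psi> \<gamma>"
  shows "calculus_pair (\<lambda>z. \<phi> z * \<psi> z) (\<lambda>\<delta>. \<beta> \<delta> o\<^sub>L \<gamma> \<delta>)"
proof -
  obtain a b where ab: "calculus_limit a \<phi> \<beta>" "calculus_limit b \<psi> \<gamma>"
    using assms unfolding calculus_pair_def by blast
  note a = calculus_limitD[OF ab(1)] calculus_limit_bounded[OF ab(1)]
    and b = calculus_limitD[OF ab(2)] calculus_limit_bounded[OF ab(2)]
  have "calculus_limit (\<lambda>n. lborel_conv (a n) (b n)) (\<lambda>z. \<phi> z * \<psi> z) (\<lambda>\<delta>. \<beta> \<delta> o\<^sub>L \<gamma> \<delta>)"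
    unfolding calculus_limit_def
  proof (intro conjI allI L1_halfline_lborel_conv a(1) b(1))
    show "uniform_limit {z. 0 < Re z} (\<lambda>n. laplace (lborel_conv (a n) (b n))) (\<lambda>z. \<phi> z * \<psi> z) sequentially"
      by (rule uniform_limit_transform[OF uniform_lim_mult[OF a(3) b(3) a(5) b(5)]])
         (simp add: laplace_lborel_conv a b)
    show "uniform_limit {0..} (\<lambda>n \<delta>. hille_phillips (damp \<delta> (lborel_conv (a n) (b n)))) (\<lambda>\<delta>. \<beta> \<delta> o\<^sub>L \<gamma> \<delta>) sequentially"
      by (rule uniform_limit_transform[OF bounded_bilinear.bounded_uniform_limit[OF
            bounded_bilinear_blinfun_compose a(4) b(4) b(6) a(6)]])
         (simp add: damp_lborel_conv hille_phillips_lborel_conv damp_L1_halfline a b)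
  qed
  then show ?thesis unfolding calculus_pair_def by blast
qed

lemma calculus_limit_tendsto: "calculus_limit b \<phi> \<beta> \<Longrightarrow> \<delta> \<ge> 0 \<Longrightarrow> (\<lambda>n. hille_phillips (damp \<delta> (b n))) \<longlonglongrightarrow> \<beta> \<delta>"
  by (rule tendsto_uniform_limitI[OF calculus_limitD(4)]) auto

lemma calculus_pair_BH:
  assumes "calculus_pair \<phi> \<beta>" "\<delta> \<ge> 0"
  shows "\<beta> \<delta> \<in> BH J"
proof -
  obtain b where b: "calculus_limit b \<phi> \<beta>" using assms unfolding calculus_pair_def by blast
  let ?S = "\<lambda>n. hille_phillips (damp \<delta> (b n))"
  have lim: "(\<lambda>n. ?S n x) \<longlonglongrightarrow> \<beta> \<delta> x" for x
    by (intro blinfun.tendsto tendsto_const calculus_limit_tendsto[OF b] assms(2))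
  have comm: "?S n (J x) = J (?S n x)" for n x
    using hille_phillips_BH[OF integrable_damp[OF calculus_limitD(2)[OF b] assms(2)]] by (simp add: BH_def)
  have "\<beta> \<delta> (J x) = J (\<beta> \<delta> x)" for x
    using LIMSEQ_unique[OF lim[of "J x", unfolded comm] J.tendsto[OF lim[of x]]] .
  then show ?thesis by (simp add: BH_def)
qed

lemma calculus_limit_zero_compose:
  assumes b: "calculus_limit b \<phi> \<beta>" and \<phi>: "\<And>z. 0 < Re z \<Longrightarrow> \<phi> z = 0"
    and g: "fourier_invertible g" "g \<in> L1_halfline" and \<delta>: "\<delta> > 0"
  shows "\<beta> \<delta> o\<^sub>L hille_phillips (damp \<delta> g) = 0"
proof -
  note b' = calculus_limitD[OF b]
  let ?S = "\<lambda>n. hille_phillips (damp \<delta> (b n)) o\<^sub>L hille_phillips (damp \<delta> g)"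
  define K where "K = C * (L1norm (fourier g) / (2 * pi) / \<delta>)"
  have K: "K \<ge> 0" using C_nonneg L1norm_nonneg[of "fourier g"] \<delta> by (simp add: K_def)
  have le: "norm (?S n) \<le> K * e" if e: "\<And>z. 0 < Re z \<Longrightarrow> norm (laplace (b n) z) \<le> e" for n e
  proof -
    have conv: "lborel_conv (b n) g \<in> L1_halfline" by (intro L1_halfline_lborel_conv b' g)
    have "?S n = hille_phillips (damp \<delta> (lborel_conv (b n) g))"
      using \<delta> by (simp add: damp_lborel_conv hille_phillips_lborel_conv damp_L1_halfline b' g)
    also have "norm \<dots> \<le> C * L1norm (damp \<delta> (lborel_conv (b n) g))"
      using \<delta> by (intro norm_hille_phillips_le integrable_damp L1_halflineD(1)[OF conv]) simp
    also have "\<dots> \<le> C * (L1norm (fourier g) / (2 * pi) * e / \<delta>)"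
      by (intro mult_left_mono L1norm_damp_le_of_bounded conv \<delta> C_nonneg
          norm_lborel_conv_le_of_fourier g(1) b'(2) norm_fourier_le_of_laplace[OF b'(1)] e)
    finally show ?thesis by (simp add: K_def)
  qed
  have "?S \<longlonglongrightarrow> 0"
  proof (rule tendstoI)
    fix e :: real assume "e > 0"
    then have "e / (K + 1) > 0" using K by simp
    from uniform_limitD[OF b'(3) this]
    show "\<forall>\<^sub>F n in sequentially. dist (?S n) 0 < e"
    proof eventually_elim
      case (elim n)
      then have "norm (?S n) \<le> K * (e / (K + 1))" using \<phi> by (intro le) (auto simp: less_imp_le)
      also have "\<dots> < e" using K \<open>e > 0\<close> by (simp add: field_simps)
      finally show ?case by simp
    qed
  qed
  moreover have "?S \<longlonglongrightarrow> (\<beta> \<delta> o\<^sub>L hille_phillips (damp \<delta> g))"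
    using \<delta> by (intro bounded_bilinear.tendsto[OF bounded_bilinear_blinfun_compose]
        calculus_limit_tendsto[OF b] tendsto_const) simp
  ultimately show ?thesis by (rule LIMSEQ_unique[symmetric])
qed

lemma hille_phillips_damp_dilate_tendsto:
  assumes k: "integrable lborel k" and \<delta>: "\<delta> \<ge> 0"
  shows "(\<lambda>n. cinner J (hille_phillips (damp \<delta> (dilate (real (Suc n)) k)) x) y)
      \<longlonglongrightarrow> (LINT t|lborel. k t) * cinner J x y"
proof -
  have "(\<lambda>n. LINT t|lborel. dilate (real (Suc n)) k t * (laplace_kernel (of_real \<delta>) t * matrix_coeff x y t))
      \<longlonglongrightarrow> (LINT t|lborel. k t) * (laplace_kernel (of_real \<delta>) 0 * matrix_coeff x y 0)"
  proof (rule dilate_tendsto_delta[OF k])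
    show "continuous_on UNIV (\<lambda>t. laplace_kernel (of_real \<delta>) t * matrix_coeff x y t)"
      unfolding laplace_kernel_def by (intro continuous_intros continuous_on_matrix_coeff)
    show "norm (laplace_kernel (of_real \<delta>) t * matrix_coeff x y t) \<le> 1 * (C * norm x * norm y)" for t
      unfolding norm_mult using \<delta> by (intro mult_mono norm_laplace_kernel_le norm_matrix_coeff_le) auto
  qed
  then show ?thesis
    using \<delta> by (simp add: cinner_hille_phillips integrable_damp integrable_dilate k damp_def mult.assoc
        del: of_nat_Suc)
       (simp add: matrix_coeff_def T_0 laplace_kernel_def)
qed

lemma calculus_limit_zero_damped:
  assumes b: "calculus_limit b \<phi> \<beta>" and \<phi>: "\<And>z. 0 < Re z \<Longrightarrow> \<phi> z = 0" and \<delta>: "\<delta> > 0"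
  shows "\<beta> \<delta> = 0"
proof (intro blinfun_eqI cinner_eqI)
  fix x y
  have "\<beta> \<delta> \<in> BH J" using calculus_pair_BH[of \<phi> \<beta> \<delta>] b \<delta> unfolding calculus_pair_def by auto
  then obtain S' :: "'h \<Rightarrow>\<^sub>L 'h" where S': "\<And>x y. cinner J (\<beta> \<delta> x) y = cinner J x (S' y)"
    using BH_adjoint_exists by blast
  have "dilate (real (Suc n)) gamma2 \<in> L1_halfline" for n
    unfolding L1_halfline_def
    using integrable_dilate[OF integrable_gamma2, of "real (Suc n)"]
    by (auto simp: dilate_def gamma2_neg mult_pos_neg simp del: of_nat_Suc)
  then have "\<beta> \<delta> o\<^sub>L hille_phillips (damp \<delta> (dilate (real (Suc n)) gamma2)) = 0" for n
    by (intro calculus_limit_zero_compose[OF b \<phi> _ _ \<delta>] fourier_invertible_dilate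
        fourier_invertible_gamma2) auto
  then have "cinner J (hille_phillips (damp \<delta> (dilate (real (Suc n)) gamma2)) x) (S' y) = 0" for n
    by (metis S' blinfun_apply_blinfun_compose zero_blinfun.rep_eq cinner.zero_left)
  then have "cinner J x (S' y) = 0"
    using hille_phillips_damp_dilate_tendsto[OF integrable_gamma2, of \<delta> x "S' y"] \<delta>
    by (simp add: LINT_gamma2 LIMSEQ_const_iff del: of_nat_Suc)
  then show "cinner J (\<beta> \<delta> x) y = cinner J (blinfun_apply 0 x) y" by (simp add: S' cinner.zero_left)
qed

lemma continuous_on_hille_phillips_damp:
  assumes b: "integrable lborel b"
  shows "continuous_on {0..} (\<lambda>\<delta>. cinner J (hille_phillips (damp \<delta> b) x) y)"
  unfolding continuous_on_sequentially
proof (intro allI ballI impI)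
  fix d and \<delta> :: real assume "\<delta> \<in> {0..}" and "(\<forall>n. d n \<in> {0..}) \<and> d \<longlonglongrightarrow> \<delta>"
  then have d: "\<delta> \<ge> 0" "\<And>n. d n \<ge> 0" "d \<longlonglongrightarrow> \<delta>" by auto
  have "(\<lambda>n. LINT t|lborel. b t * matrix_coeff x y t * laplace_kernel (of_real (d n)) t)
      \<longlonglongrightarrow> (LINT t|lborel. b t * matrix_coeff x y t * laplace_kernel (of_real \<delta>) t)"
    using d by (intro tendsto_LINT_mult_bounded[where B = 1] integrable_mult_matrix_coeff b
        laplace_kernel_tendsto tendsto_of_real norm_laplace_kernel_le) auto
  then show "((\<lambda>\<delta>. cinner J (hille_phillips (damp \<delta> b) x) y) \<circ> d) \<longlonglongrightarrow> cinner J (hille_phillips (damp \<delta> b) x) y"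
    using d by (simp add: o_def cinner_hille_phillips integrable_damp b damp_def mult_ac)
qed

lemma calculus_pair_zero:
  assumes "calculus_pair \<phi> \<beta>" and \<phi>: "\<And>z. 0 < Re z \<Longrightarrow> \<phi> z = 0" and \<delta>: "\<delta> \<ge> 0"
  shows "\<beta> \<delta> = 0"
proof (intro blinfun_eqI cinner_eqI)
  fix x y :: 'h
  obtain b where b: "calculus_limit b \<phi> \<beta>" using assms(1) unfolding calculus_pair_def by blast
  have "bounded_linear (\<lambda>S. cinner J (blinfun_apply S x) y)"
    by (intro bounded_linear_compose[OF cinner.bounded_linear_left blinfun.bounded_linear_left])
  from bounded_linear.uniform_limit[OF this calculus_limitD(4)[OF b]]
  have "continuous_on (closure {0<..}) (\<lambda>\<delta>. cinner J (\<beta> \<delta> x) y)"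
    unfolding closure_greaterThan
    by (rule uniform_limit_theorem[OF always_eventually _ trivial_limit_sequentially, rotated])
       (intro allI continuous_on_hille_phillips_damp calculus_limitD(2)[OF b])
  then have "cinner J (\<beta> \<delta> x) y = 0"
    by (rule continuous_constant_on_closure)
       (use \<delta> calculus_limit_zero_damped[OF b \<phi>] in \<open>auto simp: cinner.zero_left\<close>)
  then show "cinner J (\<beta> \<delta> x) y = cinner J (blinfun_apply 0 x) y" by (simp add: cinner.zero_left)
qed

theorem calculus_pair_unique:
  assumes "calculus_pair \<phi> \<beta>" "calculus_pair \<phi> \<gamma>" "\<delta> \<ge> 0"
  shows "\<beta> \<delta> = \<gamma> \<delta>"
proof -
  have "\<beta> \<delta> + (cscale_blinfun (-1) o\<^sub>L \<gamma> \<delta>) = 0"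
    by (rule calculus_pair_zero[OF calculus_pair_add[OF assms(1) calculus_pair_cmult[OF assms(2), of "-1"]] _ assms(3)]) simp
  moreover have "cscale_blinfun (-1) o\<^sub>L \<gamma> \<delta> = - \<gamma> \<delta>"
    by (rule blinfun_eqI) (simp add: cscale_def blinfun.minus_left)
  ultimately show ?thesis by simp
qed

lemma calculus_pair_closed:
  assumes pair: "\<And>n. calculus_pair (\<phi> n) (\<beta> n)"
    and lim: "uniform_limit {z. 0 < Re z} \<phi> \<psi> sequentially" "uniform_limit {0..} \<beta> \<gamma> sequentially"
  shows "calculus_pair \<psi> \<gamma>"
proof -
  let ?e = "\<lambda>n. 1 * (1 / real (Suc n))"
  have "\<exists>b\<in>L1_halfline. (\<forall>z\<in>{z. 0 < Re z}. norm (laplace b z - \<phi> n z) \<le> ?e n) \<and>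
      (\<forall>\<delta>\<in>{0..}. norm (hille_phillips (damp \<delta> b) - \<beta> n \<delta>) \<le> ?e n)" for n
  proof -
    obtain b where "calculus_limit b (\<phi> n) (\<beta> n)" using pair unfolding calculus_pair_def by blast
    note b = calculus_limitD[OF this]
    have "?e n > 0" by simp
    from eventually_conj[OF uniform_limitD[OF b(3) this] uniform_limitD[OF b(4) this]]
    obtain m where "\<forall>z\<in>{z. 0 < Re z}. dist (laplace (b m) z) (\<phi> n z) < ?e n"
      "\<forall>\<delta>\<in>{0..}. dist (hille_phillips (damp \<delta> (b m))) (\<beta> n \<delta>) < ?e n"
      by (auto simp: eventually_sequentially)
    then show ?thesis using b(1)[of m] by (auto simp: dist_norm intro: less_imp_le)
  qed
  then obtain b where b: "\<And>n. b n \<in> L1_halfline"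
    "\<And>n z. z \<in> {z. 0 < Re z} \<Longrightarrow> norm (laplace (b n) z - \<phi> n z) \<le> ?e n"
    "\<And>n \<delta>. \<delta> \<in> {0..} \<Longrightarrow> norm (hille_phillips (damp \<delta> (b n)) - \<beta> n \<delta>) \<le> ?e n" by metis
  have "uniform_limit {z. 0 < Re z} (\<lambda>n z. laplace (b n) z - \<phi> n z) (\<lambda>_. 0) sequentially"
    "uniform_limit {0..} (\<lambda>n \<delta>. hille_phillips (damp \<delta> (b n)) - \<beta> n \<delta>) (\<lambda>_. 0) sequentially"
    by (rule uniform_limit_of_norm_le[OF mult_inverse_Suc_tendsto_0[of 1]], use b in simp)+
  from uniform_limit_add[OF this(1) lim(1)] uniform_limit_add[OF this(2) lim(2)]
  have "calculus_limit b \<psi> \<gamma>" using b(1) by (simp add: calculus_limit_def)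
  then show ?thesis unfolding calculus_pair_def by blast
qed

lemma calculus_pair_limit_exists:
  assumes pair: "\<And>n. calculus_pair (\<phi> n) (\<beta> n)" and \<psi>: "uniform_limit {z. 0 < Re z} \<phi> \<psi> sequentially"
    and e: "e \<longlonglongrightarrow> 0" and le: "\<And>i j \<delta>. i \<le> j \<Longrightarrow> \<delta> \<ge> 0 \<Longrightarrow> norm (\<beta> i \<delta> - \<beta> j \<delta>) \<le> e i"
  obtains \<gamma> where "calculus_pair \<psi> \<gamma>" "\<And>i \<delta>. \<delta> \<ge> 0 \<Longrightarrow> norm (\<beta> i \<delta> - \<gamma> \<delta>) \<le> e i"
proof -
  have "\<exists>L. \<delta> \<ge> 0 \<longrightarrow> (\<forall>i. norm (\<beta> i \<delta> - L) \<le> e i)" for \<delta>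
    using blinfun_limit_exists[OF e, of "\<lambda>i. \<beta> i \<delta>"] le by blast
  then obtain \<gamma> where \<gamma>: "\<And>i \<delta>. \<delta> \<ge> 0 \<Longrightarrow> norm (\<beta> i \<delta> - \<gamma> \<delta>) \<le> e i" by metis
  then have "uniform_limit {0..} \<beta> \<gamma> sequentially" by (intro uniform_limit_of_norm_le[OF e]) simp
  from calculus_pair_closed[OF pair \<psi> this] \<gamma> that show thesis by blast
qed

lemma norm_hille_phillips_damp_conv_symbol_le_of_bound:
  assumes f: "fourier_invertible f" "\<And>t. norm (f t) \<le> B" and h: "H1fun h" and \<delta>: "\<delta> \<ge> 0"
  shows "norm (hille_phillips (damp \<delta> (conv_symbol f h))) \<le> C\<^sup>2 * (B * L1norm h)"
proof -
  have "C\<^sup>2 * (supnorm f * L1norm h) \<le> C\<^sup>2 * (B * L1norm h)"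
    by (intro mult_left_mono mult_right_mono supnorm_le f L1norm_nonneg) simp
  then show ?thesis using norm_hille_phillips_damp_conv_symbol_le[OF f(1) h \<delta>] by linarith
qed

lemma norm_hille_phillips_damp_conv_symbol_diff_le:
  assumes f: "fourier_invertible f" and g: "fourier_invertible g" and le: "\<And>t. norm (f t - g t) \<le> e"
    and h: "H1fun h" and \<delta>: "\<delta> \<ge> 0"
  shows "norm (hille_phillips (damp \<delta> (conv_symbol f h)) - hille_phillips (damp \<delta> (conv_symbol g h)))
    \<le> C\<^sup>2 * (e * L1norm h)"
proof -
  have "integrable lborel (conv_symbol f h)" "integrable lborel (conv_symbol g h)"
    by (intro L1_halflineD(1) conv_symbol_L1_halfline f g h)+
  then have "hille_phillips (damp \<delta> (conv_symbol f h)) - hille_phillips (damp \<delta> (conv_symbol g h))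
      = hille_phillips (damp \<delta> (conv_symbol (\<lambda>t. f t - g t) h))"
    using \<delta> by (simp add: conv_symbol_diff fourier_invertibleD(3)[OF f] fourier_invertibleD(3)[OF g]
        damp_diff hille_phillips_diff integrable_damp)
  then show ?thesis
    using norm_hille_phillips_damp_conv_symbol_le_of_bound[OF fourier_invertible_diff[OF f g] le h \<delta>] by simp
qed

lemma calculus_pair_tildeF_conv:
  assumes f: "C0fun f" and h: "H1fun h"
  obtains \<beta> where "calculus_pair (tildeF (conv f h)) \<beta>"
    "\<And>\<delta>. \<delta> \<ge> 0 \<Longrightarrow> norm (\<beta> \<delta>) \<le> C\<^sup>2 * (supnorm f * L1norm h)"
proof -
  let ?r = "\<lambda>n. 1 / real (Suc n)"
  have "\<exists>g. fourier_invertible g \<and> (\<forall>t. norm (f t - g t) \<le> ?r n)" for n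
    by (rule fourier_invertible_dense[OF f]) simp
  then obtain g where g: "\<And>n. fourier_invertible (g n)" "\<And>n t. norm (f t - g n t) \<le> ?r n" by metis
  define \<beta> where "\<beta> n \<delta> = hille_phillips (damp \<delta> (conv_symbol (g n) h))" for n \<delta>
  have pair: "calculus_pair (tildeF (conv (g n) h)) (\<beta> n)" for n
    unfolding \<beta>_def tildeF_conv[OF g(1) h] by (intro calculus_pair_laplace conv_symbol_L1_halfline g h)
  have lim: "uniform_limit {z. 0 < Re z} (\<lambda>n. tildeF (conv (g n) h)) (tildeF (conv f h)) sequentially"
    by (rule uniform_limit_tildeF_conv[OF f fourier_invertibleD(1)[OF g(1)] h LIMSEQ_Suc[OF lim_const_over_n] g(2)])
  let ?e = "\<lambda>n. C\<^sup>2 * (2 * L1norm h) * ?r n"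
  have cauchy: "norm (\<beta> i \<delta> - \<beta> j \<delta>) \<le> ?e i" if "i \<le> j" "\<delta> \<ge> 0" for i j \<delta>
  proof -
    have "?r j \<le> ?r i" using that(1) by (simp add: frac_le)
    then have "norm (g i t - g j t) \<le> 2 * ?r i" for t
      using norm_triangle_ineq4[of "f t - g j t" "f t - g i t"] g(2)[of t i] g(2)[of t j] by simp
    from norm_hille_phillips_damp_conv_symbol_diff_le[OF g(1) g(1) this h that(2)]
    show ?thesis by (simp add: \<beta>_def mult_ac)
  qed
  obtain \<gamma> where \<gamma>: "calculus_pair (tildeF (conv f h)) \<gamma>" "\<And>i \<delta>. \<delta> \<ge> 0 \<Longrightarrow> norm (\<beta> i \<delta> - \<gamma> \<delta>) \<le> ?e i"
    using calculus_pair_limit_exists[OF pair lim mult_inverse_Suc_tendsto_0 cauchy] by blast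
  have "norm (\<gamma> \<delta>) \<le> C\<^sup>2 * (supnorm f * L1norm h)" if "\<delta> \<ge> 0" for \<delta>
  proof -
    let ?B = "\<lambda>i. C\<^sup>2 * ((supnorm f + 1 * ?r i) * L1norm h)"
    have "norm (g i t) \<le> supnorm f + 1 * ?r i" for i t
      using norm_le_supnorm[OF f, of t] g(2)[of t i] norm_triangle_ineq4[of "f t" "f t - g i t"] by simp
    from norm_hille_phillips_damp_conv_symbol_le_of_bound[OF g(1) this h that]
    have "norm (\<beta> i \<delta>) \<le> ?B i" for i unfolding \<beta>_def .
    then have "norm (\<gamma> \<delta>) \<le> ?B i + ?e i" for i
      using \<gamma>(2)[OF that, of i] norm_triangle_sub[of "\<gamma> \<delta>" "\<beta> i \<delta>"]
      by (simp add: norm_minus_commute add_mono order_trans)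
    moreover have "(\<lambda>i. ?B i + ?e i) \<longlonglongrightarrow> C\<^sup>2 * ((supnorm f + 0) * L1norm h) + 0"
      by (intro tendsto_intros mult_inverse_Suc_tendsto_0)
    ultimately show ?thesis using LIMSEQ_le_const[of "\<lambda>i. ?B i + ?e i"] by simp
  qed
  with \<gamma>(1) that show thesis by blast
qed

lemma calculus_pair_sum:
  "(\<And>k. calculus_pair (\<phi> k) (\<beta> k)) \<Longrightarrow> calculus_pair (\<lambda>z. \<Sum>k<n. \<phi> k z) (\<lambda>\<delta>. \<Sum>k<n. \<beta> k \<delta>)" for n :: nat
proof (induction n)
  case 0
  have "calculus_pair (\<lambda>z. 0 * \<phi> 0 z) (\<lambda>\<delta>. cscale_blinfun 0 o\<^sub>L \<beta> 0 \<delta>)" by (intro calculus_pair_cmult 0)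
  moreover have "cscale_blinfun 0 o\<^sub>L \<beta> 0 \<delta> = 0" for \<delta> by (rule blinfun_eqI) (simp add: cscale_def)
  ultimately show ?case by simp
qed (simp add: calculus_pair_add)

theorem calculus_pair_tildeF:
  assumes rep: "A0R_rep F fs hs"
  obtains \<beta> where "calculus_pair (tildeF F) \<beta>" "norm (\<beta> 0) \<le> C\<^sup>2 * rep_norm fs hs"
proof -
  let ?a = "\<lambda>k. supnorm (fs k) * L1norm (hs k)"
  have "\<exists>\<beta>. calculus_pair (tildeF (conv (fs k) (hs k))) \<beta> \<and> (\<forall>\<delta>\<ge>0. norm (\<beta> \<delta>) \<le> C\<^sup>2 * ?a k)" for k
    by (rule calculus_pair_tildeF_conv[OF A0R_repD(1,2)[OF rep]]) blast
  then obtain \<beta> where \<beta>: "\<And>k. calculus_pair (tildeF (conv (fs k) (hs k))) (\<beta> k)"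
    "\<And>k \<delta>. \<delta> \<ge> 0 \<Longrightarrow> norm (\<beta> k \<delta>) \<le> C\<^sup>2 * ?a k" by metis
  let ?tail = "\<lambda>n. rep_norm (\<lambda>k. fs (k + n)) (\<lambda>k. hs (k + n))"
  have lim: "uniform_limit {z. 0 < Re z} (\<lambda>n z. \<Sum>k<n. tildeF (conv (fs k) (hs k)) z) (tildeF F) sequentially"
    by (rule uniform_limit_of_norm_le[OF rep_norm_tail_tendsto[OF rep]])
       (metis norm_minus_commute norm_tildeF_minus_partial_sum_le[OF rep])
  have cauchy: "norm ((\<Sum>k<i. \<beta> k \<delta>) - (\<Sum>k<j. \<beta> k \<delta>)) \<le> C\<^sup>2 * ?tail i" if "i \<le> j" "\<delta> \<ge> 0" for i j \<delta>
  proof -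
    have "norm ((\<Sum>k<i. \<beta> k \<delta>) - (\<Sum>k<j. \<beta> k \<delta>)) = norm (\<Sum>k=i..<j. \<beta> k \<delta>)"
      using that(1) sum_diff_nat_ivl[of 0 i j "\<lambda>k. \<beta> k \<delta>"]
      by (simp add: norm_minus_commute[of "\<Sum>k<i. _ k"] atLeast0LessThan)
    also have "\<dots> = norm (\<Sum>k<j - i. \<beta> (k + i) \<delta>)"
      using that(1) by (simp add: sum.atLeastLessThan_shift_0[of _ i] atLeast0LessThan add.commute)
    also have "\<dots> \<le> (\<Sum>k<j - i. C\<^sup>2 * ?a (k + i))" by (intro sum_norm_le \<beta> that)
    also have "\<dots> \<le> C\<^sup>2 * ?tail i"
      unfolding rep_norm_def sum_distrib_left[symmetric] using A0R_repD[OF A0R_rep_tail[OF rep, of i]]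
      by (intro mult_left_mono sum_le_suminf mult_nonneg_nonneg supnorm_nonneg L1norm_nonneg) auto
    finally show ?thesis .
  qed
  have "(\<lambda>n. C\<^sup>2 * ?tail n) \<longlonglongrightarrow> 0" by (rule tendsto_mult_right_zero[OF rep_norm_tail_tendsto[OF rep]])
  from calculus_pair_limit_exists[OF calculus_pair_sum[OF \<beta>(1)] lim this cauchy]
  obtain \<gamma> where \<gamma>: "calculus_pair (tildeF F) \<gamma>" "\<And>i \<delta>. \<delta> \<ge> 0 \<Longrightarrow> norm ((\<Sum>k<i. \<beta> k \<delta>) - \<gamma> \<delta>) \<le> C\<^sup>2 * ?tail i"
    by blast
  show thesis using \<gamma>(2)[of 0 0] by (intro that[OF \<gamma>(1)]) simp
qed

section \<open>The functional calculus on \<open>\<A>\<^sub>0\<close>\<close>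

definition A0_calculus :: "(complex \<Rightarrow> complex) \<Rightarrow> 'h \<Rightarrow>\<^sub>L 'h" where
  "A0_calculus \<phi> = (SOME S. \<exists>\<beta>. calculus_pair \<phi> \<beta> \<and> S = \<beta> 0)"

lemma A0_calculus_eq:
  assumes "calculus_pair \<phi> \<beta>"
  shows "A0_calculus \<phi> = \<beta> 0"
proof -
  have "\<exists>\<gamma>. calculus_pair \<phi> \<gamma> \<and> A0_calculus \<phi> = \<gamma> 0"
    unfolding A0_calculus_def by (rule someI[of _ "\<beta> 0"]) (use assms in blast)
  then show ?thesis using calculus_pair_unique[OF assms] by auto
qed

lemma A0C_calculus_pair:
  assumes "\<phi> \<in> A0C"
  obtains \<beta> where "calculus_pair \<phi> \<beta>"
  using assms calculus_pair_tildeF unfolding A0C_def A0R_def by blast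

lemma norm_A0_calculus_le:
  assumes "\<phi> \<in> A0C"
  shows "norm (A0_calculus \<phi>) \<le> C\<^sup>2 * A0C_norm \<phi>"
proof (rule le_mult_A0C_norm[OF assms])
  fix F fs hs assume "A0R_rep F fs hs" "tildeF F = \<phi>"
  then show "norm (A0_calculus \<phi>) \<le> C\<^sup>2 * rep_norm fs hs"
    using calculus_pair_tildeF[of F fs hs] A0_calculus_eq by metis
qed simp

theorem A0_calculus_bounded_hom: "A0C_bounded_hom J A0_calculus"
  unfolding A0C_bounded_hom_def
proof (intro conjI ballI allI)
  fix \<phi> assume "\<phi> \<in> A0C"
  then obtain \<beta> where \<beta>: "calculus_pair \<phi> \<beta>" by (rule A0C_calculus_pair)
  show "A0_calculus \<phi> \<in> BH J" using calculus_pair_BH[OF \<beta>] by (simp add: A0_calculus_eq[OF \<beta>])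
  show "A0_calculus (\<lambda>z. c * \<phi> z) x = cscale J c (A0_calculus \<phi> x)" for c x
    by (simp add: A0_calculus_eq[OF \<beta>] A0_calculus_eq[OF calculus_pair_cmult[OF \<beta>]])
  fix \<psi> assume "\<psi> \<in> A0C"
  then obtain \<gamma> where \<gamma>: "calculus_pair \<psi> \<gamma>" by (rule A0C_calculus_pair)
  show "A0_calculus (\<lambda>z. \<phi> z + \<psi> z) = A0_calculus \<phi> + A0_calculus \<psi>"
    by (simp add: A0_calculus_eq[OF \<beta>] A0_calculus_eq[OF \<gamma>] A0_calculus_eq[OF calculus_pair_add[OF \<beta> \<gamma>]])
  show "A0_calculus (\<lambda>z. \<phi> z * \<psi> z) = A0_calculus \<phi> o\<^sub>L A0_calculus \<psi>"
    by (simp add: A0_calculus_eq[OF \<beta>] A0_calculus_eq[OF \<gamma>] A0_calculus_eq[OF calculus_pair_mult[OF \<beta> \<gamma>]])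
next
  show "\<exists>K. \<forall>\<phi>\<in>A0C. norm (A0_calculus \<phi>) \<le> K * A0C_norm \<phi>" using norm_A0_calculus_le by blast
qed

theorem A0_calculus_laplace:
  assumes "b absolutely_integrable_on {0..}"
  shows "((\<lambda>t. cscale J (b t) (T t x)) has_integral A0_calculus (laplace b) x) {0..}"
proof -
  obtain b' where b': "b' \<in> L1_halfline" "laplace b = laplace b'" "negligible {t \<in> {0..}. b t \<noteq> b' t}"
    using L1_halfline_representative[OF assms] by blast
  have "((\<lambda>t. cscale J (b' t) (T t x)) has_integral A0_calculus (laplace b) x) {0..}"
    using hille_phillips_has_integral[OF b'(1)] A0_calculus_eq[OF calculus_pair_laplace[OF b'(1)]] b'(2) by simp
  then show ?thesis by (rule has_integral_spike[OF b'(3), rotated]) auto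
qed

end

lemma eq_0_of_norm_le_null_sequence:
  fixes x :: "'a::real_normed_vector"
  assumes "\<And>n. norm x \<le> K * e n" "e \<longlonglongrightarrow> 0"
  shows "x = 0"
  using LIMSEQ_le_const[OF tendsto_mult_right_zero[OF assms(2)], of "norm x" K] assms(1) by auto

locale A0C_additive_vanishing_on_laplace =
  fixes D :: "(complex \<Rightarrow> complex) \<Rightarrow> 'b::real_normed_vector" and K :: real
  assumes add: "\<And>\<phi> \<psi>. \<phi> \<in> A0C \<Longrightarrow> \<psi> \<in> A0C \<Longrightarrow> D (\<lambda>z. \<phi> z + \<psi> z) = D \<phi> + D \<psi>"
    and bound: "\<And>\<phi>. \<phi> \<in> A0C \<Longrightarrow> norm (D \<phi>) \<le> K * A0C_norm \<phi>" and K_nonneg: "K \<ge> 0"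
    and laplace_0: "\<And>b. b \<in> L1_halfline \<Longrightarrow> D (laplace b) = 0"
begin

lemma tildeF_conv_0:
  assumes f: "C0fun f" and h: "H1fun h"
  shows "D (tildeF (conv f h)) = 0"
proof (rule eq_0_of_norm_le_null_sequence[OF _ mult_inverse_Suc_tendsto_0])
  fix n
  obtain g where g: "fourier_invertible g" "\<And>t. norm (f t - g t) \<le> 1 / real (Suc n)"
    using fourier_invertible_dense[OF f, of "1 / real (Suc n)"] by auto
  note gC0 = fourier_invertibleD(1)[OF g(1)]
  have mem: "tildeF (conv (\<lambda>t. f t - g t) h) \<in> A0C" "tildeF (conv g h) \<in> A0C"
    using f gC0 h by (auto intro!: tildeF_in_A0C[OF A0R_rep_conv] C0fun_diff)
  have "D (tildeF (conv f h)) = D (tildeF (conv (\<lambda>t. f t - g t) h))"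
    by (simp add: tildeF_conv_eq_add_diff[OF f gC0 h] add mem)
       (simp add: tildeF_conv[OF g(1) h] laplace_0 conv_symbol_L1_halfline[OF g(1) h])
  also have "norm \<dots> \<le> K * A0C_norm (tildeF (conv (\<lambda>t. f t - g t) h))" by (rule bound[OF mem(1)])
  also have "\<dots> \<le> K * (supnorm (\<lambda>t. f t - g t) * L1norm h)"
    by (intro mult_left_mono A0C_norm_tildeF_conv_le C0fun_diff f gC0 h K_nonneg)
  also have "\<dots> \<le> K * (1 / real (Suc n) * L1norm h)"
    by (intro mult_left_mono mult_right_mono supnorm_le g(2) L1norm_nonneg K_nonneg)
  finally show "norm (D (tildeF (conv f h))) \<le> K * (L1norm h * (1 / real (Suc n)))" by (simp add: mult.commute)
qed

lemma partial_sum_0: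
  fixes n :: nat
  assumes fh: "\<And>k. C0fun (fs k)" "\<And>k. H1fun (hs k)"
  shows "D (\<lambda>z. \<Sum>k<n. tildeF (conv (fs k) (hs k)) z) = 0"
proof (induction n)
  case 0
  have "laplace (\<lambda>_. 0) = (\<lambda>_. 0)" by (simp add: laplace_def fun_eq_iff)
  then show ?case using laplace_0[OF L1_halfline_zero] by simp
next
  case (Suc n)
  have "(\<lambda>z. \<Sum>k<n. tildeF (conv (fs k) (hs k)) z) \<in> A0C"
    using tildeF_in_A0C[OF A0R_rep_finite_sum[of fs hs n]] by (simp add: tildeF_partial_sum fh)
  moreover have "tildeF (conv (fs n) (hs n)) \<in> A0C" by (rule tildeF_in_A0C[OF A0R_rep_conv[OF fh]])
  ultimately show ?case using Suc by (simp add: add tildeF_conv_0[OF fh])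
qed

theorem eq_0:
  assumes "\<phi> \<in> A0C"
  shows "D \<phi> = 0"
proof -
  obtain F fs hs where F: "\<phi> = tildeF F" and rep: "A0R_rep F fs hs"
    using assms by (auto simp: A0C_def A0R_def)
  note fh = A0R_repD(1,2)[OF rep]
  show ?thesis
    unfolding F
  proof (rule eq_0_of_norm_le_null_sequence[OF _ rep_norm_tail_tendsto[OF rep]])
    fix n
    note tail = A0R_rep_tail[OF rep, of n]
    let ?R = "tildeF (\<lambda>t. F t - (\<Sum>k<n. conv (fs k) (hs k) t))"
    have "D (tildeF F) = D (\<lambda>z. \<Sum>k<n. tildeF (conv (fs k) (hs k)) z) + D ?R"
      unfolding tildeF_eq_partial_sum_add_tail[OF rep, of n] tildeF_partial_sum[OF fh, symmetric]
      by (rule add[OF tildeF_in_A0C[OF A0R_rep_finite_sum[OF fh]] tildeF_in_A0C[OF tail]])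
    then have "norm (D (tildeF F)) = norm (D ?R)" by (simp add: partial_sum_0[OF fh])
    also have "\<dots> \<le> K * A0C_norm ?R" by (rule bound[OF tildeF_in_A0C[OF tail]])
    also have "\<dots> \<le> K * rep_norm (\<lambda>k. fs (k + n)) (\<lambda>k. hs (k + n))"
      by (rule mult_left_mono[OF A0C_norm_le_rep_norm[OF tail] K_nonneg])
    finally show "norm (D (tildeF F)) \<le> K * rep_norm (\<lambda>k. fs (k + n)) (\<lambda>k. hs (k + n))" .
  qed
qed

end

lemma A0C_bounded_hom_bound:
  assumes "A0C_bounded_hom J \<rho>"
  obtains K where "K \<ge> 0" "\<And>\<phi>. \<phi> \<in> A0C \<Longrightarrow> norm (\<rho> \<phi>) \<le> K * A0C_norm \<phi>"
proof -
  obtain K where K: "\<And>\<phi>. \<phi> \<in> A0C \<Longrightarrow> norm (\<rho> \<phi>) \<le> K * A0C_norm \<phi>"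
    using assms unfolding A0C_bounded_hom_def by blast
  have "norm (\<rho> \<phi>) \<le> \<bar>K\<bar> * A0C_norm \<phi>" if "\<phi> \<in> A0C" for \<phi>
    using K[OF that] mult_right_mono[OF abs_ge_self[of K] A0C_norm_nonneg[OF that]] by linarith
  then show thesis using that[of "\<bar>K\<bar>"] by simp
qed

theorem A0C_bounded_hom_eqI:
  assumes hom: "A0C_bounded_hom J \<rho>" "A0C_bounded_hom J \<rho>'"
    and laplace: "\<And>b. b \<in> L1_halfline \<Longrightarrow> \<rho> (laplace b) = \<rho>' (laplace b)" and \<phi>: "\<phi> \<in> A0C"
  shows "\<rho> \<phi> = \<rho>' \<phi>"
proof -
  obtain K where K: "K \<ge> 0" "\<And>\<phi>. \<phi> \<in> A0C \<Longrightarrow> norm (\<rho> \<phi>) \<le> K * A0C_norm \<phi>"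
    using A0C_bounded_hom_bound[OF hom(1)] by blast
  obtain K' where K': "K' \<ge> 0" "\<And>\<phi>. \<phi> \<in> A0C \<Longrightarrow> norm (\<rho>' \<phi>) \<le> K' * A0C_norm \<phi>"
    using A0C_bounded_hom_bound[OF hom(2)] by blast
  interpret A0C_additive_vanishing_on_laplace "\<lambda>\<phi>. \<rho> \<phi> - \<rho>' \<phi>" "K + K'"
  proof
    show "norm (\<rho> \<psi> - \<rho>' \<psi>) \<le> (K + K') * A0C_norm \<psi>" if "\<psi> \<in> A0C" for \<psi>
      unfolding distrib_right by (rule order_trans[OF norm_triangle_ineq4 add_mono[OF K(2) K'(2)]]) fact+
  qed (use hom K(1) K'(1) laplace in \<open>auto simp: A0C_bounded_hom_def\<close>)
  show ?thesis using eq_0[OF \<phi>] by simp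
qed

lemma (in bounded_semigroup) A0_calculus_unique:
  assumes hom: "A0C_bounded_hom J \<rho>"
    and laplace: "\<And>b x. b absolutely_integrable_on {0..} \<Longrightarrow>
      ((\<lambda>t. cscale J (b t) (T t x)) has_integral \<rho> (laplace b) x) {0..}"
    and \<phi>: "\<phi> \<in> A0C"
  shows "\<rho> \<phi> = A0_calculus \<phi>"
proof (rule A0C_bounded_hom_eqI[OF hom A0_calculus_bounded_hom _ \<phi>])
  fix b assume "b \<in> L1_halfline"
  then have "b absolutely_integrable_on {0..}" by (intro absolutely_integrable_on_lborel L1_halflineD) simp_all
  then show "\<rho> (laplace b) = A0_calculus (laplace b)"
    by (intro blinfun_eqI has_integral_unique[OF laplace A0_calculus_laplace])
qed

theorem mainTheorem10:
  fixes J :: "'h::{real_inner,complete_space} \<Rightarrow> 'h"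
    and T :: "real \<Rightarrow> 'h \<Rightarrow>\<^sub>L 'h"
  assumes "cplx_struct J"
    and "bounded_C0_semigroup J T"
  shows "\<exists>\<rho>. A0C_bounded_hom J \<rho> \<and>
           (\<forall>b. b absolutely_integrable_on {0..} \<longrightarrow>
              (\<forall>x. ((\<lambda>t. cscale J (b t) (blinfun_apply (T t) x)) has_integral
                       blinfun_apply (\<rho> (laplace b)) x) {0..})) \<and>
           (\<forall>\<rho>'. A0C_bounded_hom J \<rho>' \<and>
              (\<forall>b. b absolutely_integrable_on {0..} \<longrightarrow>
                 (\<forall>x. ((\<lambda>t. cscale J (b t) (blinfun_apply (T t) x)) has_integral
                          blinfun_apply (\<rho>' (laplace b)) x) {0..}))
              \<longrightarrow> (\<forall>\<phi>\<in>A0C. \<rho>' \<phi> = \<rho> \<phi>)) \<and>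
           (\<forall>\<phi>\<in>A0C. norm (\<rho> \<phi>) \<le> (SUP t\<in>{0..}. norm (T t))\<^sup>2 * A0C_norm \<phi>)"
proof -
  obtain M where M: "\<And>t. t \<ge> 0 \<Longrightarrow> norm (T t) \<le> M"
    using assms(2) unfolding bounded_C0_semigroup_def by blast
  have "norm (T t) \<le> (SUP t\<in>{0..}. norm (T t))" if "t \<ge> 0" for t
    using that M by (intro cSUP_upper bdd_aboveI2[of _ _ M]) auto
  then interpret bounded_semigroup J T "SUP t\<in>{0..}. norm (T t)"
    using assms by unfold_locales auto
  show ?thesis
    by (intro exI[of _ A0_calculus] conjI allI impI ballI A0_calculus_bounded_hom A0_calculus_laplace
        norm_A0_calculus_le)
       (auto intro: A0_calculus_unique)
qed

end
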